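(* Suppose $v$ satisfies Assumptions A1 and A2 (stated in the context) with constants $s_0,c_0$. Let $s\ge s^*$ be such that $\mathcal U(s)\subset\Theta$, and suppose $\epsilon_3,\epsilon_4(s)\lesssim1$. Let $\bar x=\int x\,d\pi(x)$ and let $\Sigma_\pi=\int(x-\bar x)(x-\bar x)^\top d\pi(x)$ be the covariance of $\pi$. Then $$\|\Sigma_\pi-H_V^{-1}\|_{H_V^{-1}}=\|H_V^{1/2}(\Sigma_\pi-H_V^{-1})H_V^{1/2}\|\lesssim E_s^2\big(\epsilon_3^2+\epsilon_4(s)^2\big)+\tau_s .$$
   Context: Setting: $d\ge1$ is an integer, $n>0$, $\Theta\subseteq\mathbb R^d$ is open, $v:\Theta\to\mathbb R$, $V=nv$, and $\pi$ is the probability measure with density proportional to $e^{-V}$ on $\Theta$ (and zero outside $\Theta$). Notation: $\langle T,S\rangle$ is the entrywise inner product of tensors of the same order. For a symmetric positive definite matrix $H$, $\|x\|_H=\sqrt{x^\top Hx}$ for vectors and $\|T\|_H=\sup_{\|u\|_H=1}|\langle T,u^{\otimes k}\rangle|$ for symmetric tensors of order $k\ge2$ (symmetric matrices being the case $k=2$). $\|\cdot\|$ without subscript is the usual operator norm. Assumption A1: $v\in C^4(\Theta)$ has a unique global minimizer $\hat x\in\Theta$, and $H_v:=\nabla^2v(\hat x)\succ0$. Local region: $\mathcal U(s)=\{x\in\mathbb R^d:\|x-\hat x\|_{H_v}\le s\sqrt{d/n}\}$. Assumption A2: there exist $s_0>0$ and $c_0$ with $1\ge c_0>C/\sqrt d$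 for some absolute constant $C>0$ such that $v(x)-v(\hat x)\ge c_0\sqrt{d/n}\,\|x-\hat x\|_{H_v}$ for all $x\in\Theta\setminus\mathcal U(s_0)$. $H_V=\nabla^2V(\hat x)=nH_v$; $H_V^{-1}$ is the covariance of the Laplace approximation $\hat\gamma=\mathcal N(\hat x,H_V^{-1})$ to $\pi$. Small quantities: $\epsilon_3=d\,\|\nabla^3V(\hat x)\|_{H_V}$ and $\epsilon_4(s)=d\sup_{x\in\mathcal U(s)}\|\nabla^4V(x)\|_{H_V}^{1/2}$. Also $E_s=\exp\big((\epsilon_3^2+\epsilon_4(s)^2)s^4\big)$, $\tau_s=d\,e^{-c_0sd/8}$, $s^*=\max\big(s_0,\frac{8}{c_0}\log\frac{2e}{c_0}\big)$. Convention: $a\lesssim b$ means $a\le Cb$ for an absolute constant $C>0$; the hypothesis "$\epsilon_3,\epsilon_4(s)\lesssim1$" means both are bounded by some absolute constant, and the constant in the conclusion may depend on that bound and on the absolute constant in A2, but on nothing else. *)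

theory Defs
  imports "HOL-Analysis.Analysis" "Jordan_Normal_Form.Gauss_Jordan_Elimination"
begin

unbundle no inner_syntax
unbundle no vec_syntax

text \<open>
  The dimension is a natural number variable \<open>d\<close> and not a type, because the constants in the
  final estimate must be uniform in \<open>d\<close>. Points of the space are the functions in
  \<open>{..<d} \<rightarrow>\<^sub>E UNIV\<close>, which is the carrier both of the topology \<open>powertop_real {..<d}\<close> and of the
  product measure below. Directions are elements of \<open>carrier_vec d\<close>, matrices of
  \<open>carrier_mat d d\<close>. A tensor of order \<open>k\<close> is given by its entries, a function on index lists of
  length \<open>k\<close> over \<open>{..<d}\<close>.
\<close>

type_synonym point = "nat \<Rightarrow> real"
type_synonym tensor = "nat list \<Rightarrow> real"

definition lborel_dim :: "nat \<Rightarrow> point measure" where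
  "lborel_dim d = (\<Pi>\<^sub>M i\<in>{..<d}. lborel)"


subsection \<open>Derivatives\<close>

definition partial_deriv :: "nat \<Rightarrow> (point \<Rightarrow> real) \<Rightarrow> point \<Rightarrow> real" where
  "partial_deriv i f x = deriv (\<lambda>t. f (x(i := t))) (x i)"

fun partial_derivs :: "nat list \<Rightarrow> (point \<Rightarrow> real) \<Rightarrow> point \<Rightarrow> real" where
  "partial_derivs [] f = f"
| "partial_derivs (i # is) f = partial_deriv i (partial_derivs is f)"

definition indices :: "nat \<Rightarrow> nat \<Rightarrow> nat list set" where
  "indices d k = {is. length is = k \<and> set is \<subseteq> {..<d}}"

text \<open>
  All iterated partial derivatives of order at most \<open>k\<close> exist and are continuous on the open set
  \<open>\<Theta>\<close>. Existence has to be required explicitly since \<open>deriv\<close> is total.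
\<close>

definition C_k_on :: "nat \<Rightarrow> nat \<Rightarrow> point set \<Rightarrow> (point \<Rightarrow> real) \<Rightarrow> bool" where
  "C_k_on d k \<Theta> f \<longleftrightarrow>
     (\<forall>j<k. \<forall>is\<in>indices d j. \<forall>i<d. \<forall>x\<in>\<Theta>.
        (\<lambda>t. partial_derivs is f (x(i := t))) field_differentiable at (x i)) \<and>
     (\<forall>j\<le>k. \<forall>is\<in>indices d j.
        continuous_map (subtopology (powertop_real {..<d}) \<Theta>) euclideanreal (partial_derivs is f))"

definition deriv_tensor :: "(point \<Rightarrow> real) \<Rightarrow> point \<Rightarrow> tensor" where
  "deriv_tensor f x = (\<lambda>is. partial_derivs is f x)"

definition hessian :: "nat \<Rightarrow> (point \<Rightarrow> real) \<Rightarrow> point \<Rightarrow> real mat" where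
  "hessian d f x = mat d d (\<lambda>(i, j). partial_derivs [i, j] f x)"


subsection \<open>Matrices and norms\<close>

definition pos_def :: "nat \<Rightarrow> real mat \<Rightarrow> bool" where
  "pos_def d A \<longleftrightarrow> A \<in> carrier_mat d d \<and> transpose_mat A = A \<and>
     (\<forall>u\<in>carrier_vec d. u \<noteq> 0\<^sub>v d \<longrightarrow> u \<bullet> (A *\<^sub>v u) > 0)"

text \<open>The next two operations are only meaningful for positive definite arguments.\<close>

definition mat_inv :: "real mat \<Rightarrow> real mat" where
  "mat_inv A = the (mat_inverse A)"

definition mat_sqrt :: "nat \<Rightarrow> real mat \<Rightarrow> real mat" where
  "mat_sqrt d A = (THE R. pos_def d R \<and> R * R = A)"

definition wnorm :: "real mat \<Rightarrow> real vec \<Rightarrow> real" where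
  "wnorm H u = sqrt (u \<bullet> (H *\<^sub>v u))"

definition op_norm :: "nat \<Rightarrow> real mat \<Rightarrow> real" where
  "op_norm d A =
     (SUP u\<in>{u \<in> carrier_vec d. u \<bullet> u = 1}. sqrt ((A *\<^sub>v u) \<bullet> (A *\<^sub>v u)))"

definition tensor_inner :: "nat \<Rightarrow> nat \<Rightarrow> tensor \<Rightarrow> tensor \<Rightarrow> real" where
  "tensor_inner d k T S = (\<Sum>is\<in>indices d k. T is * S is)"

definition tensor_power :: "real vec \<Rightarrow> tensor" where
  "tensor_power u = (\<lambda>is. \<Prod>i\<leftarrow>is. u $ i)"

definition tensor_norm :: "nat \<Rightarrow> nat \<Rightarrow> real mat \<Rightarrow> tensor \<Rightarrow> real" where
  "tensor_norm d k H T =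
     (SUP u\<in>{u \<in> carrier_vec d. wnorm H u = 1}. \<bar>tensor_inner d k T (tensor_power u)\<bar>)"

definition mat_tensor :: "real mat \<Rightarrow> tensor" where
  "mat_tensor A = (\<lambda>is. A $$ (is ! 0, is ! 1))"

definition mat_wnorm :: "nat \<Rightarrow> real mat \<Rightarrow> real mat \<Rightarrow> real" where
  "mat_wnorm d H A = tensor_norm d 2 H (mat_tensor A)"

definition point_diff :: "nat \<Rightarrow> point \<Rightarrow> point \<Rightarrow> real vec" where
  "point_diff d x y = vec d (\<lambda>i. x i - y i)"


subsection \<open>Target measure\<close>

definition target :: "nat \<Rightarrow> point set \<Rightarrow> (point \<Rightarrow> real) \<Rightarrow> point measure" where
  "target d \<Theta> V = density (lborel_dim d)
     (\<lambda>x. ennreal (indicator \<Theta> x * exp (- V x) /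
            (\<integral>y. indicator \<Theta> y * exp (- V y) \<partial>lborel_dim d)))"

definition mean :: "point measure \<Rightarrow> point" where
  "mean \<mu> = (\<lambda>i. \<integral>x. x i \<partial>\<mu>)"

definition covariance :: "nat \<Rightarrow> point measure \<Rightarrow> real mat" where
  "covariance d \<mu> = mat d d (\<lambda>(i, j). \<integral>x. (x i - mean \<mu> i) * (x j - mean \<mu> j) \<partial>\<mu>)"


subsection \<open>Assumptions and small quantities\<close>

definition local_region ::
    "nat \<Rightarrow> real \<Rightarrow> (point \<Rightarrow> real) \<Rightarrow> point \<Rightarrow> real \<Rightarrow> point set" where
  "local_region d n v xhat s =
     {x \<in> {..<d} \<rightarrow>\<^sub>E UNIV. wnorm (hessian d v xhat) (point_diff d x xhat) \<le> s * sqrt (d / n)}"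

definition assumption_A1 :: "nat \<Rightarrow> point set \<Rightarrow> (point \<Rightarrow> real) \<Rightarrow> point \<Rightarrow> bool" where
  "assumption_A1 d \<Theta> v xhat \<longleftrightarrow>
     C_k_on d 4 \<Theta> v \<and>
     {x. is_arg_min v (\<lambda>x. x \<in> \<Theta>) x} = {xhat} \<and>
     pos_def d (hessian d v xhat)"

text \<open>\<open>a\<close> is the absolute constant in the lower bound on \<open>c0\<close>.\<close>

definition assumption_A2 ::
    "real \<Rightarrow> nat \<Rightarrow> real \<Rightarrow> point set \<Rightarrow> (point \<Rightarrow> real) \<Rightarrow> point \<Rightarrow> real \<Rightarrow> real \<Rightarrow> bool" where
  "assumption_A2 a d n \<Theta> v xhat s0 c0 \<longleftrightarrow>
     s0 > 0 \<and> c0 \<le> 1 \<and> c0 > a / sqrt d \<and>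
     (\<forall>x \<in> \<Theta> - local_region d n v xhat s0.
        v x - v xhat \<ge> c0 * sqrt (d / n) * wnorm (hessian d v xhat) (point_diff d x xhat))"

definition eps3 :: "nat \<Rightarrow> real \<Rightarrow> (point \<Rightarrow> real) \<Rightarrow> point \<Rightarrow> real" where
  "eps3 d n v xhat =
     (let V = (\<lambda>x. n * v x) in d * tensor_norm d 3 (hessian d V xhat) (deriv_tensor V xhat))"

definition eps4 :: "nat \<Rightarrow> real \<Rightarrow> (point \<Rightarrow> real) \<Rightarrow> point \<Rightarrow> real \<Rightarrow> real" where
  "eps4 d n v xhat s =
     (let V = (\<lambda>x. n * v x) in
        d * (SUP x\<in>local_region d n v xhat s.
               sqrt (tensor_norm d 4 (hessian d V xhat) (deriv_tensor V x))))"

definition E_factor :: "nat \<Rightarrow> real \<Rightarrow> (point \<Rightarrow> real) \<Rightarrow> point \<Rightarrow> real \<Rightarrow> real" where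
  "E_factor d n v xhat s = exp (((eps3 d n v xhat)\<^sup>2 + (eps4 d n v xhat s)\<^sup>2) * s ^ 4)"

definition tau :: "nat \<Rightarrow> real \<Rightarrow> real \<Rightarrow> real" where
  "tau d c0 s = d * exp (- c0 * s * d / 8)"

definition s_star :: "real \<Rightarrow> real \<Rightarrow> real" where
  "s_star s0 c0 = max s0 (8 / c0 * ln (2 * exp 1 / c0))"

end

theory Submission
  imports Defs "HOL-Probability.Distributions" "HOL-Real_Asymp.Real_Asymp"
    "Jordan_Normal_Form.Determinant"
begin

unbundle no inner_syntax
unbundle no vec_syntax

text \<open>
  In the coordinate \<open>y = x - xhat\<close> the target density on the local region is \<open>exp (- q y / 2 - r y)\<close> with
  \<open>q\<close> the quadratic form of the Hessian and \<open>r\<close> the sum of the cubic Taylor term and a quartic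
  remainder. Expanding \<open>exp (- r)\<close> under the Gaussian measure, the cubic term contributes nothing to
  the second moments by oddness, so that the variance in every direction changes by \<open>O(\<epsilon>\<^sup>2)\<close> only,
  while the squared mean is \<open>O(\<epsilon>\<^sup>2)\<close>. For constants independent of \<open>d\<close> one needs that the cubic form,
  of supremum of order \<open>sqrt d\<close> on the ball \<open>q \<le> 16 * d\<close>, has bounded exponential moments there; this
  follows from the invariance of a pair of Gaussian vectors under rotation by 45 degrees. Between
  this ball and the boundary of the local region the Gaussian weight beats \<open>exp (- r)\<close> up to the
  factor \<open>exp (\<epsilon>\<^sup>2 * s ^ 4)\<close>, and outside the region the linear growth of \<open>V\<close> is summed over dyadic
  shells. Only scalings and translations of Lebesgue measure are used,
  never a general linear change of variables.
\<close>

subsection \<open>Lebesgue and Gaussian measures\<close>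

text \<open>The obstacle is uniformity in \<open>d\<close>: on the ball \<open>q <= 16 * d\<close> a
  pointwise bound of exp (- r) costs exp (C * sqrt d), so only integrated bounds can work there. The
  matrix norm is treated one direction at a time. For \<open>u\<close> on the unit sphere of the
  inverse Hessian and h the inverse Hessian applied to \<open>u\<close>, the functional u . y is
  \<open>bil h y\<close> and \<open>q h = 1\<close>, so all estimates concern a scalar that has
  variance 1 under the Gaussian. The test function is (bil h)^2 - 1, not (bil h)^2: its Gaussian
  mean is 0, so the normalising constant enters only as a denominator bounded from below and is
  never expanded. The integrals over the local region carry one factor exp (\<epsilon>^2 * s ^ 4)
  each; the second power of \<open>E_factor\<close> in the result comes from squaring the mean.
  Estimates of the form \<open>b ^ d\<close> are always arranged with \<open>b <= 1\<close>, and
  \<open>d >= 1\<close> then reduces them to a single factor.\<close>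

lemma space_lborel_dim [simp]: "space (lborel_dim d) = {..<d} \<rightarrow>\<^sub>E UNIV"
  by (simp add: lborel_dim_def space_PiM)

interpretation lb: product_sigma_finite "\<lambda>_::nat. lborel :: real measure"
  by standard

lemma sigma_finite_lborel_dim: "sigma_finite_measure (lborel_dim d)"
  unfolding lborel_dim_def by (rule lb.sigma_finite) simp

lemma measurable_coord [measurable]: "i < d \<Longrightarrow> (\<lambda>x. x i) \<in> borel_measurable (lborel_dim d)"
  unfolding lborel_dim_def
  using measurable_component_singleton[of i "{..<d}" "\<lambda>_. lborel :: real measure"] by simp

lemma measurable_affine_point:
  "(\<lambda>x. \<lambda>i\<in>{..<d}. c * x i + h i) \<in> lborel_dim d \<rightarrow>\<^sub>M lborel_dim d"
proof -
  have "(\<lambda>x. \<lambda>i\<in>{..<d}. c * x i + h i) \<in> lborel_dim d \<rightarrow>\<^sub>M PiM {..<d} (\<lambda>_. lborel :: real measure)"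
    by (rule measurable_restrict) (use measurable_coord in auto)
  then show ?thesis by (simp add: lborel_dim_def)
qed

text \<open>Boxes determine a product measure and are pulled back to boxes, so the one-dimensional
  \<open>lborel_real_affine\<close> applies in each coordinate and contributes one factor
  |c|.\<close>

lemma lborel_dim_affine:
  fixes c :: real
  assumes c: "c \<noteq> 0"
  shows "lborel_dim d = density (distr (lborel_dim d) (lborel_dim d) (\<lambda>x. \<lambda>i\<in>{..<d}. c * x i + h i))
           (\<lambda>_. ennreal (\<bar>c\<bar> ^ d))" (is "_ = ?D")
proof -
  let ?T = "\<lambda>x. \<lambda>i\<in>{..<d}. c * x i + (h i :: real)"
  have "PiM {..<d} (\<lambda>_::nat. lborel :: real measure) = ?D"
  proof (rule lb.PiM_eqI[symmetric])
    show "finite {..<d}" by simp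
    show "sets ?D = sets (PiM {..<d} (\<lambda>_. lborel :: real measure))"
      by (simp add: lborel_dim_def)
    fix A :: "nat \<Rightarrow> real set"
    assume A: "\<And>i. i \<in> {..<d} \<Longrightarrow> A i \<in> sets lborel"
    define B where "B i = {t. c * t + h i \<in> A i}" for i
    have B_eq: "B i = (\<lambda>x. h i + c * x) -` A i" for i by (auto simp: B_def add.commute)
    have B: "B i \<in> sets lborel" if "i < d" for i
    proof -
      have "A i \<in> sets borel" using A[of i] that by simp
      then have "(\<lambda>x. h i + c * x) -` A i \<inter> space borel \<in> sets borel"
        by (rule measurable_sets[rotated]) measurable
      then show ?thesis by (simp add: B_eq)
    qed
    have em: "emeasure lborel (A i) = ennreal \<bar>c\<bar> * emeasure lborel (B i)" if "i < d" for i
    proof -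
      have "emeasure lborel (A i) =
         emeasure (density (distr lborel borel (\<lambda>x. h i + c * x)) (\<lambda>_. ennreal \<bar>c\<bar>)) (A i)"
        by (rule arg_cong[OF lborel_real_affine[OF c], of "\<lambda>M. emeasure M (A i)"])
      also have "\<dots> = ennreal \<bar>c\<bar> * emeasure (distr lborel borel (\<lambda>x. h i + c * x)) (A i)"
        using A[of i] that by (simp add: emeasure_density_const)
      also have "emeasure (distr lborel borel (\<lambda>x. h i + c * x)) (A i) = emeasure lborel (B i)"
        unfolding B_eq using A[of i] that by (subst emeasure_distr) simp_all
      finally show ?thesis .
    qed
    have pre: "?T -` (Pi\<^sub>E {..<d} A) \<inter> space (lborel_dim d) = Pi\<^sub>E {..<d} B"
      by (rule Set.set_eqI) (simp add: PiE_iff B_def)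
    have PA: "Pi\<^sub>E {..<d} A \<in> sets (lborel_dim d)"
      unfolding lborel_dim_def by (rule sets_PiM_I_finite) (use A in auto)
    have "emeasure ?D (Pi\<^sub>E {..<d} A) = ennreal (\<bar>c\<bar> ^ d) *
        emeasure (distr (lborel_dim d) (lborel_dim d) ?T) (Pi\<^sub>E {..<d} A)"
      using PA by (simp add: emeasure_density_const)
    also have "emeasure (distr (lborel_dim d) (lborel_dim d) ?T) (Pi\<^sub>E {..<d} A)
        = emeasure (lborel_dim d) (Pi\<^sub>E {..<d} B)"
      unfolding pre[symmetric] by (rule emeasure_distr[OF measurable_affine_point PA])
    also have "\<dots> = (\<Prod>i<d. emeasure lborel (B i))"
      unfolding lborel_dim_def by (rule lb.emeasure_PiM) (use B in auto)
    also have "ennreal (\<bar>c\<bar> ^ d) * \<dots> = (\<Prod>i<d. ennreal \<bar>c\<bar> * emeasure lborel (B i))"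
      by (simp add: prod.distrib ennreal_power)
    also have "\<dots> = (\<Prod>i<d. emeasure lborel (A i))"
      by (rule prod.cong) (use em in auto)
    finally show "emeasure ?D (Pi\<^sub>E {..<d} A) = (\<Prod>i<d. emeasure lborel (A i))" .
  qed
  then show ?thesis by (simp add: lborel_dim_def)
qed

lemma nn_integral_affine_point:
  fixes c :: real
  assumes c: "c \<noteq> 0" and f: "f \<in> borel_measurable (lborel_dim d)"
  shows "(\<integral>\<^sup>+x. f x \<partial>lborel_dim d)
       = ennreal (\<bar>c\<bar> ^ d) * (\<integral>\<^sup>+x. f (\<lambda>i\<in>{..<d}. c * x i + h i) \<partial>lborel_dim d)"
proof -
  note [measurable] = measurable_affine_point f
  have "(\<integral>\<^sup>+x. f x \<partial>lborel_dim d) = (\<integral>\<^sup>+x. f x \<partial>density (distr (lborel_dim d) (lborel_dim d)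
          (\<lambda>x. \<lambda>i\<in>{..<d}. c * x i + h i)) (\<lambda>_. ennreal (\<bar>c\<bar> ^ d)))"
    by (rule arg_cong[OF lborel_dim_affine[OF c], of "\<lambda>M. integral\<^sup>N M f"])
  also have "\<dots> = ennreal (\<bar>c\<bar> ^ d) * (\<integral>\<^sup>+x. f (\<lambda>i\<in>{..<d}. c * x i + h i) \<partial>lborel_dim d)"
    by (subst nn_integral_density) (auto simp: nn_integral_cmult nn_integral_distr)
  finally show ?thesis .
qed

lemma
  fixes f :: "point \<Rightarrow> real" and c :: real
  assumes c: "c \<noteq> 0" and f: "f \<in> borel_measurable (lborel_dim d)"
  shows integral_affine_point: "(\<integral>x. f x \<partial>lborel_dim d)
       = \<bar>c\<bar> ^ d * (\<integral>x. f (\<lambda>i\<in>{..<d}. c * x i + h i) \<partial>lborel_dim d)" (is ?A)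
    and integrable_affine_point: "integrable (lborel_dim d) f \<longleftrightarrow>
       integrable (lborel_dim d) (\<lambda>x. f (\<lambda>i\<in>{..<d}. c * x i + h i))" (is ?B)
proof -
  note [measurable] = measurable_affine_point f
  let ?D = "density (distr (lborel_dim d) (lborel_dim d)
          (\<lambda>x. \<lambda>i\<in>{..<d}. c * x i + h i)) (\<lambda>_. ennreal (\<bar>c\<bar> ^ d))"
  have "(\<integral>x. f x \<partial>lborel_dim d) = (\<integral>x. f x \<partial>?D)"
    by (rule arg_cong[OF lborel_dim_affine[OF c], of "\<lambda>M. integral\<^sup>L M f"])
  also have "\<dots> = \<bar>c\<bar> ^ d * (\<integral>x. f (\<lambda>i\<in>{..<d}. c * x i + h i) \<partial>lborel_dim d)"
    by (subst integral_density) (auto simp: integral_distr)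
  finally show ?A .
  have "integrable (lborel_dim d) f \<longleftrightarrow> integrable ?D f"
    by (rule arg_cong[OF lborel_dim_affine[OF c], of "\<lambda>M. integrable M f"])
  also have "\<dots> \<longleftrightarrow> integrable (lborel_dim d) (\<lambda>x. f (\<lambda>i\<in>{..<d}. c * x i + h i))"
    using c by (subst integrable_density) (auto simp: integrable_distr_eq)
  finally show ?B .
qed

section \<open>Positive definite forms and their Gaussian measures\<close>

definition bilf :: "nat \<Rightarrow> (nat \<Rightarrow> nat \<Rightarrow> real) \<Rightarrow> (nat \<Rightarrow> real) \<Rightarrow> (nat \<Rightarrow> real) \<Rightarrow> real" where
  "bilf d H x y = (\<Sum>i<d. \<Sum>j<d. H i j * x i * y j)"

text \<open>\<open>riesz\<close> is invertibility of \<open>H\<close> in the form in which it is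
  used: every linear functional has a representing vector. It yields bounds on coordinates and,
  later, the representer of the derivative of a cubic form.\<close>

locale pos_def_form =
  fixes d :: nat and H :: "nat \<Rightarrow> nat \<Rightarrow> real"
  assumes d_ge_1: "d \<ge> 1"
    and H_sym: "i < d \<Longrightarrow> j < d \<Longrightarrow> H i j = H j i"
    and H_pos: "(\<exists>i<d. x i \<noteq> 0) \<Longrightarrow> bilf d H x x > 0"
    and riesz: "\<exists>h. \<forall>x. bilf d H h x = (\<Sum>i<d. b i * x i)"
begin

abbreviation bil where "bil \<equiv> bilf d H"
abbreviation q where "q x \<equiv> bilf d H x x"

lemma bil_sym: "bil x y = bil y x"
  unfolding bilf_def
  by (subst sum.swap, intro sum.cong) (auto simp: H_sym mult_ac)

lemma bil_restrict [simp]: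
  "bil (restrict x {..<d}) y = bil x y" "bil y (restrict x {..<d}) = bil y x"
  unfolding bilf_def by (auto intro!: sum.cong)

lemma bil_lincomb: "bil (\<lambda>i. a * x i + b * y i) z = a * bil x z + b * bil y z"
  unfolding bilf_def by (simp add: sum_distrib_left sum.distrib[symmetric] algebra_simps)

lemma bil_lincomb_right: "bil z (\<lambda>i. a * x i + b * y i) = a * bil z x + b * bil z y"
  by (simp only: bil_sym[of z] bil_lincomb)

lemma q_lincomb: "q (\<lambda>i. a * x i + b * y i) = a\<^sup>2 * q x + 2 * a * b * bil x y + b\<^sup>2 * q y"
  by (simp add: bil_lincomb bil_lincomb_right bil_sym[of y x] power2_eq_square algebra_simps)

lemma q_scale: "q (\<lambda>i. a * x i) = a\<^sup>2 * q x"
  using q_lincomb[of a x 0 x] by simp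

lemma q_nonneg [simp]: "0 \<le> q x"
proof (cases "\<exists>i<d. x i \<noteq> 0")
  case False
  then have "q x = 0" by (auto simp: bilf_def)
  then show ?thesis by simp
qed (use H_pos less_imp_le in blast)

lemma q_eq_0_iff: "q x = 0 \<longleftrightarrow> (\<forall>i<d. x i = 0)"
proof
  show "q x = 0 \<Longrightarrow> \<forall>i<d. x i = 0" using H_pos[of x] by fastforce
qed (auto simp: bilf_def)

lemma bil_Cauchy_Schwarz: "(bil x y)\<^sup>2 \<le> q x * q y"
proof (cases "q y = 0")
  case True
  then have "\<forall>i<d. y i = 0" using q_eq_0_iff by blast
  then have "bil x y = 0" by (auto simp: bilf_def)
  then show ?thesis by simp
next
  case False
  then have p: "q y > 0" using q_nonneg[of y] by linarith
  define t where "t = bil x y / q y"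
  have "0 \<le> q (\<lambda>i. 1 * x i + (- t) * y i)" by (rule q_nonneg)
  also have "\<dots> = q x - 2 * t * bil x y + t\<^sup>2 * q y" by (subst q_lincomb) simp
  also have "\<dots> = q x - (bil x y)\<^sup>2 / q y"
    using p by (simp add: t_def power2_eq_square field_simps)
  finally show ?thesis using p by (simp add: field_simps)
qed

lemma abs_bil_le: "\<bar>bil x y\<bar> \<le> sqrt (q x) * sqrt (q y)"
  using bil_Cauchy_Schwarz[of x y] real_le_rsqrt[of "\<bar>bil x y\<bar>" "q x * q y"]
  by (simp add: real_sqrt_mult)

text \<open>Each coordinate is a functional \<open>bil (h i)\<close>, so Cauchy-Schwarz bounds it.
  \<open>C\<close> plays the role of an inverse smallest eigenvalue. It depends on \<open>H\<close>
  and serves only qualitative purposes (integrability, compactness, existence of square roots); it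
  enters no final constant.\<close>

lemma coord_bound:
  obtains C where "C > 0" "\<And>x i. i < d \<Longrightarrow> (x i)\<^sup>2 \<le> C * q x"
proof -
  have "\<forall>i. \<exists>h. \<forall>x. bil h x = (\<Sum>j<d. (if j = i then 1 else 0) * x j)"
    by (intro allI riesz)
  then obtain h where h: "\<And>i x. bil (h i) x = (\<Sum>j<d. (if j = i then 1 else 0) * x j)" by metis
  have hx: "bil (h i) x = x i" if "i < d" for i x using that by (simp add: h if_distrib[of "\<lambda>t. t * _"] cong: if_cong)
  define C where "C = 1 + (\<Sum>i<d. q (h i))"
  have "C > 0" unfolding C_def by (intro add_pos_nonneg sum_nonneg) auto
  moreover have "(x i)\<^sup>2 \<le> C * q x" if "i < d" for x i
  proof -
    have "(x i)\<^sup>2 \<le> q (h i) * q x" using bil_Cauchy_Schwarz[of "h i" x] hx[OF that] by simp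
    also have "q (h i) \<le> (\<Sum>i<d. q (h i))" by (rule member_le_sum) (use that in auto)
    then have "q (h i) * q x \<le> C * q x" unfolding C_def by (intro mult_right_mono) auto
    finally show ?thesis .
  qed
  ultimately show ?thesis using that by blast
qed

lemma measurable_bil_right [measurable]: "(\<lambda>x. bil h x) \<in> borel_measurable (lborel_dim d)"
  unfolding bilf_def by (intro borel_measurable_sum borel_measurable_times measurable_coord) auto

lemma measurable_q [measurable]: "(\<lambda>x. q x) \<in> borel_measurable (lborel_dim d)"
  unfolding bilf_def by (intro borel_measurable_sum borel_measurable_times measurable_coord) auto

text \<open>Kept symbolic: its value would bring in the determinant of \<open>H\<close>, and it
  cancels in all Gaussian expectations.\<close>

definition Z where "Z = (\<integral>x. exp (- q x / 2) \<partial>lborel_dim d)"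

lemma integrable_exp_q: "integrable (lborel_dim d) (\<lambda>x. exp (- q x / 2))"
proof -
  obtain C where C: "C > 0" "\<And>x i. i < d \<Longrightarrow> (x i)\<^sup>2 \<le> C * q x" by (rule coord_bound) blast
  \<comment> \<open>Summing \<open>coord_bound\<close> over the \<open>d\<close> coordinates gives
    |x|^2 <= C * d * q x, so a product of one-dimensional Gaussians of variance \<open>C * d\<close>
    is a majorant.\<close>
  define \<sigma> where "\<sigma> = sqrt (C * d)"
  have \<sigma>: "\<sigma> > 0" "\<sigma>\<^sup>2 = C * d" using C(1) d_ge_1 by (simp_all add: \<sigma>_def)
  define g where "g t = sqrt (2 * pi * \<sigma>\<^sup>2) * normal_density 0 \<sigma> t" for t
  have g: "g t = exp (- t\<^sup>2 / (2 * \<sigma>\<^sup>2))" for t using \<sigma>(1) by (simp add: g_def normal_density_def)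
  have gi: "integrable lborel g" unfolding g_def using \<sigma> by simp
  have i: "integrable (lborel_dim d) (\<lambda>x. \<Prod>i<d. g (x i))"
    unfolding lborel_dim_def by (rule lb.product_integrable_prod) (use gi in auto)
  show ?thesis
  proof (rule Bochner_Integration.integrable_bound[OF i])
    show "(\<lambda>x. exp (- q x / 2)) \<in> borel_measurable (lborel_dim d)" by measurable
    have "exp (- q x / 2) \<le> (\<Prod>i<d. g (x i))" for x
    proof -
      have "(\<Sum>i<d. (x i)\<^sup>2) \<le> (\<Sum>i<d. C * q x)" by (rule sum_mono) (use C in auto)
      then have "(\<Sum>i<d. (x i)\<^sup>2) \<le> \<sigma>\<^sup>2 * q x" by (simp add: \<sigma> mult_ac)
      then have "- q x / 2 \<le> (\<Sum>i<d. - (x i)\<^sup>2 / (2 * \<sigma>\<^sup>2))"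
        using \<sigma>(1) by (simp add: sum_negf sum_divide_distrib[symmetric] field_simps)
      then have "exp (- q x / 2) \<le> exp (\<Sum>i<d. - (x i)\<^sup>2 / (2 * \<sigma>\<^sup>2))" by simp
      then show ?thesis by (simp add: exp_sum g)
    qed
    then show "AE x in lborel_dim d. norm (exp (- q x / 2)) \<le> norm (\<Prod>i<d. g (x i))"
      by (auto simp: prod_nonneg g)
  qed
qed

lemma Z_pos: "Z > 0"
proof -
  have "Z \<noteq> 0"
  proof
    assume "Z = 0"
    then have "AE x in lborel_dim d. exp (- q x / 2) = 0"
      unfolding Z_def using integrable_exp_q by (subst (asm) integral_nonneg_eq_0_iff_AE) auto
    then have "AE x in lborel_dim d. False" by simp
    then have "emeasure (lborel_dim d) (space (lborel_dim d)) = 0"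
      by (simp only: trivial_limit_def[symmetric] ae_filter_eq_bot_iff)
    moreover have "emeasure (lborel_dim d) (space (lborel_dim d)) = (\<Prod>i<d. emeasure lborel (UNIV::real set))"
      unfolding space_lborel_dim unfolding lborel_dim_def by (rule lb.emeasure_PiM) auto
    ultimately show False by (simp add: prod_zero_iff)
  qed
  moreover have "Z \<ge> 0" unfolding Z_def by simp
  ultimately show ?thesis by simp
qed

lemma
  assumes "c > 0"
  shows integrable_exp_q_scaled: "integrable (lborel_dim d) (\<lambda>x. exp (- c\<^sup>2 * q x / 2))"
    and integral_exp_q_scaled: "(\<integral>x. exp (- c\<^sup>2 * q x / 2) \<partial>lborel_dim d) = Z / c ^ d"
proof -
  have eq: "exp (- q (\<lambda>i\<in>{..<d}. c * x i + 0) / 2) = exp (- c\<^sup>2 * q x / 2)" for x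
    by (simp add: q_scale)
  show "integrable (lborel_dim d) (\<lambda>x. exp (- c\<^sup>2 * q x / 2))"
    using integrable_affine_point[of c "\<lambda>x. exp (- q x / 2)" d "\<lambda>_. 0"] integrable_exp_q assms
    unfolding eq by simp
  show "(\<integral>x. exp (- c\<^sup>2 * q x / 2) \<partial>lborel_dim d) = Z / c ^ d"
    using integral_affine_point[of c "\<lambda>x. exp (- q x / 2)" d "\<lambda>_. 0"] assms
    unfolding eq Z_def by simp
qed

definition G where "G = density (lborel_dim d) (\<lambda>x. ennreal (exp (- q x / 2) / Z))"

lemma sets_G [measurable_cong, simp]: "sets G = sets (lborel_dim d)" by (simp add: G_def)
lemma space_G [simp]: "space G = {..<d} \<rightarrow>\<^sub>E UNIV" by (simp add: G_def)

lemma integral_G: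
  fixes f :: "point \<Rightarrow> real"
  assumes "f \<in> borel_measurable (lborel_dim d)"
  shows "(\<integral>x. f x \<partial>G) = (\<integral>x. f x * exp (- q x / 2) \<partial>lborel_dim d) / Z"
proof -
  have "(\<integral>x. f x \<partial>G) = (\<integral>x. (f x * exp (- q x / 2)) / Z \<partial>lborel_dim d)"
    unfolding G_def using assms Z_pos by (subst integral_density) (auto simp: mult_ac)
  then show ?thesis by simp
qed

lemma integrable_G:
  fixes f :: "point \<Rightarrow> real"
  assumes "f \<in> borel_measurable (lborel_dim d)"
  shows "integrable G f \<longleftrightarrow> integrable (lborel_dim d) (\<lambda>x. f x * exp (- q x / 2))"
proof -
  have "integrable G f \<longleftrightarrow> integrable (lborel_dim d) (\<lambda>x. (1 / Z) * (f x * exp (- q x / 2)))"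
    unfolding G_def using assms Z_pos by (subst integrable_density) (auto simp: mult_ac)
  also have "\<dots> \<longleftrightarrow> integrable (lborel_dim d) (\<lambda>x. f x * exp (- q x / 2))"
    using Z_pos integrable_mult_left_iff[of "lborel_dim d" "1 / Z" "\<lambda>x. f x * exp (- q x / 2)"] by simp
  finally show ?thesis .
qed

lemma prob_space_G: "prob_space G"
proof
  have "emeasure G (space G) = (\<integral>\<^sup>+x. ennreal (exp (- q x / 2) / Z) \<partial>lborel_dim d)"
    unfolding G_def using sets.top[of "lborel_dim d"]
    by (subst emeasure_density) (auto intro!: nn_integral_cong)
  also have "\<dots> = ennreal (\<integral>x. exp (- q x / 2) / Z \<partial>lborel_dim d)"
    by (rule nn_integral_eq_integral) (use integrable_exp_q Z_pos in auto)
  also have "\<dots> = 1" using Z_pos by (simp add: Z_def)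
  finally show "emeasure G (space G) = 1" .
qed

sublocale prob_space G by (rule prob_space_G)

text \<open>This is the moment generating function of a chi-square variable with \<open>d\<close>
  degrees of freedom. Tilting by exp (\<beta> * q) merely rescales the Gaussian weight, so the
  scaling formula gives the exact value.\<close>

lemma
  assumes "\<beta> < 1 / 2"
  shows integrable_G_exp_q: "integrable G (\<lambda>x. exp (\<beta> * q x))"
    and integral_G_exp_q: "(\<integral>x. exp (\<beta> * q x) \<partial>G) = (1 / sqrt (1 - 2 * \<beta>)) ^ d"
proof -
  define c where "c = sqrt (1 - 2 * \<beta>)"
  have c: "c > 0" "c\<^sup>2 = 1 - 2 * \<beta>" using assms by (auto simp: c_def)
  have eq: "exp (\<beta> * q x) * exp (- q x / 2) = exp (- c\<^sup>2 * q x / 2)" for x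
    unfolding exp_add[symmetric] c(2) by (simp add: field_simps)
  have m: "(\<lambda>x. exp (\<beta> * q x)) \<in> borel_measurable (lborel_dim d)" by measurable
  show "integrable G (\<lambda>x. exp (\<beta> * q x))"
    unfolding integrable_G[OF m] eq by (rule integrable_exp_q_scaled[OF c(1)])
  show "(\<integral>x. exp (\<beta> * q x) \<partial>G) = (1 / sqrt (1 - 2 * \<beta>)) ^ d"
    unfolding integral_G[OF m] eq integral_exp_q_scaled[OF c(1)] c_def[symmetric]
    using Z_pos by (simp add: power_one_over field_simps del: power_divide)
qed

text \<open>Completing the square: the weight translated by \<open>h\<close> equals the original one
  times exp (bil h x - q h / 2).\<close>

lemma
  shows integrable_G_exp_bil: "integrable G (\<lambda>x. exp (bil h x))"
    and integral_G_exp_bil: "(\<integral>x. exp (bil h x) \<partial>G) = exp (q h / 2)"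
proof -
  have eq: "exp (- q (\<lambda>i\<in>{..<d}. 1 * x i + - h i) / 2) = exp (- q h / 2) * (exp (bil h x) * exp (- q x / 2))" for x
  proof -
    have "q (\<lambda>i\<in>{..<d}. 1 * x i + - h i) = q (\<lambda>i. 1 * x i + (-1) * h i)" by simp
    also have "\<dots> = q x - 2 * bil h x + q h" by (subst q_lincomb) (simp add: bil_sym[of x h])
    finally have "- q (\<lambda>i\<in>{..<d}. 1 * x i + - h i) / 2 = - q h / 2 + (bil h x + - q x / 2)" by simp
    then show ?thesis by (simp only: exp_add)
  qed
  have "integrable (lborel_dim d) (\<lambda>x. exp (- q h / 2) * (exp (bil h x) * exp (- q x / 2)))"
    unfolding eq[symmetric]
    by (rule iffD1[OF integrable_affine_point integrable_exp_q]) (simp, measurable)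
  then have i: "integrable (lborel_dim d) (\<lambda>x. exp (bil h x) * exp (- q x / 2))"
    by (simp only: integrable_mult_left_iff exp_not_eq_zero simp_thms)
  have m: "(\<lambda>x. exp (bil h x)) \<in> borel_measurable (lborel_dim d)" by measurable
  have m0: "(\<lambda>x. exp (- q x / 2)) \<in> borel_measurable (lborel_dim d)" by measurable
  show "integrable G (\<lambda>x. exp (bil h x))"
    unfolding integrable_G[OF m] by (rule i)
  have "Z = exp (- q h / 2) * (\<integral>x. exp (bil h x) * exp (- q x / 2) \<partial>lborel_dim d)"
    using integral_affine_point[of 1 "\<lambda>x. exp (- q x / 2)" d "\<lambda>i. - h i", OF _ m0] unfolding eq Z_def
    by (simp only: abs_one power_one mult_1_left) simp
  then have "exp (q h / 2) * Z = (exp (q h / 2) * exp (- q h / 2)) * (\<integral>x. exp (bil h x) * exp (- q x / 2) \<partial>lborel_dim d)"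
    by (simp only: mult.assoc)
  also have "exp (q h / 2) * exp (- q h / 2) = 1" by (simp flip: exp_add)
  finally have I: "exp (q h / 2) * Z = (\<integral>x. exp (bil h x) * exp (- q x / 2) \<partial>lborel_dim d)"
    by (simp only: mult_1_left)
  have "(\<integral>x. exp (bil h x) \<partial>G) = exp (q h / 2) * Z / Z"
    unfolding I by (rule integral_G[OF m])
  then show "(\<integral>x. exp (bil h x) \<partial>G) = exp (q h / 2)"
    using Z_pos by (simp only: nonzero_mult_div_cancel_right less_imp_neq[symmetric] not_False_eq_True)
qed

lemma integral_G_reflect:
  fixes f :: "point \<Rightarrow> real"
  assumes [measurable]: "f \<in> borel_measurable (lborel_dim d)"
  shows "(\<integral>x. f (\<lambda>i\<in>{..<d}. - x i) \<partial>G) = (\<integral>x. f x \<partial>G)"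
proof -
  have q: "q (\<lambda>i\<in>{..<d}. - x i) = q x" for x using q_scale[of "-1" x] by simp
  have m: "(\<lambda>x. f (\<lambda>i\<in>{..<d}. - x i)) \<in> borel_measurable (lborel_dim d)"
    using measurable_affine_point[where d = d and c = "-1" and h = "\<lambda>_. 0"] by (intro measurable_compose[OF _ assms]) simp
  show ?thesis
    unfolding integral_G[OF assms] integral_G[OF m]
    using integral_affine_point[of "-1" "\<lambda>x. f x * exp (- q x / 2)" d "\<lambda>_. 0"] by (simp add: q del: bil_restrict)
qed

end

subsection \<open>Rotation of a pair of Gaussian vectors\<close>

lemma power_le_exp:
  fixes x :: real
  assumes "x \<ge> 0" "n \<ge> 1"
  shows "x ^ n \<le> real n ^ n * exp x"
proof -
  have "(x / n) ^ n \<le> (1 + x / n) ^ n" using assms by (intro power_mono) auto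
  also have "\<dots> \<le> exp x" by (rule exp_ge_one_plus_x_over_n_power_n) (use assms in auto)
  finally show ?thesis using assms by (simp add: power_divide field_simps)
qed

lemma even_power_le_exp:
  fixes x :: real
  assumes "even n" "n \<ge> 1"
  shows "x ^ n \<le> real n ^ n * (exp x + exp (- x))"
proof -
  have "x ^ n = \<bar>x\<bar> ^ n" using assms by (simp add: power_even_abs)
  also have "\<dots> \<le> real n ^ n * exp \<bar>x\<bar>" by (rule power_le_exp) (use assms in auto)
  also have "exp \<bar>x\<bar> \<le> exp x + exp (- x)" by (simp add: abs_if)
  finally show ?thesis by (simp add: mult_left_mono)
qed

lemma measurable_lincomb_pair:
  "(\<lambda>p. \<lambda>i\<in>{..<d}. a * fst p i + b * snd p i) \<in> lborel_dim d \<Otimes>\<^sub>M lborel_dim d \<rightarrow>\<^sub>M lborel_dim d"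
proof -
  have "(\<lambda>p. a * fst p i + b * snd p i) \<in> lborel_dim d \<Otimes>\<^sub>M lborel_dim d \<rightarrow>\<^sub>M (lborel :: real measure)" if "i < d" for i
  proof -
    have "(\<lambda>p. fst p i) \<in> borel_measurable (lborel_dim d \<Otimes>\<^sub>M lborel_dim d)"
      by (rule measurable_compose[OF measurable_fst measurable_coord[OF that]])
    moreover have "(\<lambda>p. snd p i) \<in> borel_measurable (lborel_dim d \<Otimes>\<^sub>M lborel_dim d)"
      by (rule measurable_compose[OF measurable_snd measurable_coord[OF that]])
    ultimately show ?thesis by simp
  qed
  then have "(\<lambda>p. \<lambda>i\<in>{..<d}. a * fst p i + b * snd p i)
      \<in> lborel_dim d \<Otimes>\<^sub>M lborel_dim d \<rightarrow>\<^sub>M PiM {..<d} (\<lambda>_. lborel :: real measure)"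
    by (intro measurable_restrict) auto
  then show ?thesis by (simp add: lborel_dim_def)
qed

definition rot_p :: "nat \<Rightarrow> point \<Rightarrow> point \<Rightarrow> point" where
  "rot_p d y z = (\<lambda>i\<in>{..<d}. (1 / sqrt 2) * y i + (1 / sqrt 2) * z i)"
definition rot_m :: "nat \<Rightarrow> point \<Rightarrow> point \<Rightarrow> point" where
  "rot_m d y z = (\<lambda>i\<in>{..<d}. (1 / sqrt 2) * y i + (- 1 / sqrt 2) * z i)"

text \<open>The rotation is performed one variable at a time. For fixed \<open>z\<close> the
  substitution x = (y + z) / sqrt 2 is a scaling with a translation, and for fixed \<open>x\<close>
  so is x' = x - sqrt 2 * z. The two Jacobians are inverse to each other.\<close>

lemma nn_integral_lborel_dim_rotate:
  assumes F [measurable]: "case_prod F \<in> borel_measurable (lborel_dim d \<Otimes>\<^sub>M lborel_dim d)"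
  shows "(\<integral>\<^sup>+y. \<integral>\<^sup>+z. F (rot_p d y z) (rot_m d y z) \<partial>lborel_dim d \<partial>lborel_dim d)
       = (\<integral>\<^sup>+x. \<integral>\<^sup>+x'. F x x' \<partial>lborel_dim d \<partial>lborel_dim d)"
proof -
  interpret sigma_finite_measure "lborel_dim d" by (rule sigma_finite_lborel_dim)
  interpret pr: pair_sigma_finite "lborel_dim d" "lborel_dim d" ..
  note m = measurable_lincomb_pair[where d = d]
  let ?k = "ennreal (sqrt 2 ^ d)"
  \<comment> \<open>\<open>S x z\<close> is \<open>rot_m d y z\<close> expressed by the new first
    variable \<open>x = rot_p d y z\<close> and the old \<open>z\<close>.\<close>
  define S where "S x z = (\<lambda>i\<in>{..<d}. 1 * x i + (- sqrt 2) * z i)" for x z :: point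
  have mS: "(\<lambda>p. S (fst p) (snd p)) \<in> lborel_dim d \<Otimes>\<^sub>M lborel_dim d \<rightarrow>\<^sub>M lborel_dim d"
    unfolding S_def by (rule m)
  have mR: "(\<lambda>p. rot_p d (fst p) (snd p)) \<in> lborel_dim d \<Otimes>\<^sub>M lborel_dim d \<rightarrow>\<^sub>M lborel_dim d"
    "(\<lambda>p. rot_m d (fst p) (snd p)) \<in> lborel_dim d \<Otimes>\<^sub>M lborel_dim d \<rightarrow>\<^sub>M lborel_dim d"
    unfolding rot_p_def rot_m_def by (rule m)+
  have F1: "(\<lambda>p. F (rot_p d (fst p) (snd p)) (rot_m d (fst p) (snd p)))
      \<in> borel_measurable (lborel_dim d \<Otimes>\<^sub>M lborel_dim d)"
    using measurable_compose[OF measurable_Pair[OF mR] F] by simp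
  have F2: "(\<lambda>p. F (fst p) (S (fst p) (snd p))) \<in> borel_measurable (lborel_dim d \<Otimes>\<^sub>M lborel_dim d)"
    using measurable_compose[OF measurable_Pair[OF measurable_fst mS] F] by simp
  have F2': "(\<lambda>x. F x (S x z)) \<in> borel_measurable (lborel_dim d)" if "z \<in> space (lborel_dim d)" for z
    using measurable_compose[OF measurable_Pair2'[OF that] F2] by simp
  have F3: "(\<lambda>x'. F x x') \<in> borel_measurable (lborel_dim d)" if "x \<in> space (lborel_dim d)" for x
    using measurable_compose[OF measurable_Pair1'[OF that] F] by simp
  have inner: "?k * (\<integral>\<^sup>+y. F (rot_p d y z) (rot_m d y z) \<partial>lborel_dim d)
     = ?k * (?k * (\<integral>\<^sup>+x. F x (S x z) \<partial>lborel_dim d))" if "z \<in> space (lborel_dim d)" for z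
  proof -
    have eq: "S (rot_p d y z) z = rot_m d y z" for y
      by (auto simp: S_def rot_p_def rot_m_def fun_eq_iff field_simps)
    have "(\<integral>\<^sup>+x. F x (S x z) \<partial>lborel_dim d) = ennreal ((1 / sqrt 2) ^ d) *
       (\<integral>\<^sup>+y. F (rot_p d y z) (rot_m d y z) \<partial>lborel_dim d)"
      using nn_integral_affine_point[OF _ F2'[OF that], of "1 / sqrt 2" "\<lambda>i. (1 / sqrt 2) * z i"]
      unfolding rot_p_def[symmetric] eq by simp
    then have "?k * (\<integral>\<^sup>+x. F x (S x z) \<partial>lborel_dim d) = (?k * ennreal ((1 / sqrt 2) ^ d)) *
       (\<integral>\<^sup>+y. F (rot_p d y z) (rot_m d y z) \<partial>lborel_dim d)" by (simp only: mult.assoc)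
    also have "?k * ennreal ((1 / sqrt 2) ^ d) = 1"
      by (simp add: ennreal_mult[symmetric] power_mult_distrib[symmetric])
    finally show ?thesis by simp
  qed
  have k: "?k \<noteq> 0" "?k \<noteq> \<infinity>" by auto
  have inner': "(\<integral>\<^sup>+y. F (rot_p d y z) (rot_m d y z) \<partial>lborel_dim d)
     = ?k * (\<integral>\<^sup>+x. F x (S x z) \<partial>lborel_dim d)" if "z \<in> space (lborel_dim d)" for z
    using inner[OF that] k by (simp add: ennreal_mult_cancel_left)
  have outer: "?k * (\<integral>\<^sup>+z. F x (S x z) \<partial>lborel_dim d) = (\<integral>\<^sup>+x'. F x x' \<partial>lborel_dim d)"
    if "x \<in> space (lborel_dim d)" for x
  proof -
    have "(\<lambda>i\<in>{..<d}. (- sqrt 2) * z i + x i) = S x z" for z by (simp add: S_def add.commute)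
    then show ?thesis
      using nn_integral_affine_point[OF _ F3[OF that], of "- sqrt 2" x] by simp
  qed
  have "(\<integral>\<^sup>+y. \<integral>\<^sup>+z. F (rot_p d y z) (rot_m d y z) \<partial>lborel_dim d \<partial>lborel_dim d)
      = (\<integral>\<^sup>+z. \<integral>\<^sup>+y. F (rot_p d y z) (rot_m d y z) \<partial>lborel_dim d \<partial>lborel_dim d)"
    by (rule pr.Fubini'[symmetric]) (use F1 in \<open>simp add: case_prod_beta\<close>)
  also have "\<dots> = (\<integral>\<^sup>+z. ?k * (\<integral>\<^sup>+x. F x (S x z) \<partial>lborel_dim d) \<partial>lborel_dim d)"
    by (rule nn_integral_cong) (rule inner')
  also have "\<dots> = ?k * (\<integral>\<^sup>+z. \<integral>\<^sup>+x. F x (S x z) \<partial>lborel_dim d \<partial>lborel_dim d)"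
    by (rule nn_integral_cmult)
       (use borel_measurable_nn_integral[of "\<lambda>z x. F x (S x z)" "lborel_dim d"]
            measurable_compose[OF measurable_pair_swap' F2] in \<open>simp add: case_prod_beta\<close>)
  also have "(\<integral>\<^sup>+z. \<integral>\<^sup>+x. F x (S x z) \<partial>lborel_dim d \<partial>lborel_dim d)
      = (\<integral>\<^sup>+x. \<integral>\<^sup>+z. F x (S x z) \<partial>lborel_dim d \<partial>lborel_dim d)"
    by (rule pr.Fubini') (use F2 in \<open>simp add: case_prod_beta\<close>)
  also have "?k * \<dots> = (\<integral>\<^sup>+x. ?k * (\<integral>\<^sup>+z. F x (S x z) \<partial>lborel_dim d) \<partial>lborel_dim d)"
    by (rule nn_integral_cmult[symmetric])
       (use borel_measurable_nn_integral[of "\<lambda>x z. F x (S x z)" "lborel_dim d"] F2 in \<open>simp add: case_prod_beta\<close>)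
  also have "\<dots> = (\<integral>\<^sup>+x. \<integral>\<^sup>+x'. F x x' \<partial>lborel_dim d \<partial>lborel_dim d)"
    by (rule nn_integral_cong) (rule outer)
  finally show ?thesis .
qed

context pos_def_form begin

lemma q_rot: "q (rot_p d y z) + q (rot_m d y z) = q y + q z"
proof -
  have "q (rot_p d y z) = q (\<lambda>i. (1 / sqrt 2) * y i + (1 / sqrt 2) * z i)" unfolding rot_p_def by simp
  also have "\<dots> = q y / 2 + bil y z + q z / 2" by (subst q_lincomb) (simp add: power_divide)
  finally have 1: "q (rot_p d y z) = q y / 2 + bil y z + q z / 2" .
  have "q (rot_m d y z) = q (\<lambda>i. (1 / sqrt 2) * y i + (- 1 / sqrt 2) * z i)" unfolding rot_m_def by simp
  also have "\<dots> = q y / 2 - bil y z + q z / 2" by (subst q_lincomb) (simp add: power_divide)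
  finally show ?thesis using 1 by simp
qed

lemma nn_integral_G:
  assumes [measurable]: "f \<in> borel_measurable (lborel_dim d)"
  shows "(\<integral>\<^sup>+x. f x \<partial>G) = (\<integral>\<^sup>+x. ennreal (exp (- q x / 2) / Z) * f x \<partial>lborel_dim d)"
  unfolding G_def by (rule nn_integral_density) measurable

text \<open>The density of the pair depends only on \<open>q x + q x'\<close>, which the rotation
  preserves by \<open>q_rot\<close>.\<close>

lemma nn_integral_G_rotate:
  assumes F: "case_prod F \<in> borel_measurable (lborel_dim d \<Otimes>\<^sub>M lborel_dim d)"
  shows "(\<integral>\<^sup>+y. \<integral>\<^sup>+z. F (rot_p d y z) (rot_m d y z) \<partial>G \<partial>G) = (\<integral>\<^sup>+x. \<integral>\<^sup>+x'. F x x' \<partial>G \<partial>G)"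
proof -
  interpret lbd: sigma_finite_measure "lborel_dim d" by (rule sigma_finite_lborel_dim)
  define w where "w x = ennreal (exp (- q x / 2) / Z)" for x
  have w [measurable]: "w \<in> borel_measurable (lborel_dim d)" unfolding w_def by measurable
  have expand: "(\<integral>\<^sup>+x. \<integral>\<^sup>+x'. K x x' \<partial>G \<partial>G) = (\<integral>\<^sup>+x. \<integral>\<^sup>+x'. w x * (w x' * K x x') \<partial>lborel_dim d \<partial>lborel_dim d)"
    if K: "case_prod K \<in> borel_measurable (lborel_dim d \<Otimes>\<^sub>M lborel_dim d)" for K
  proof -
    have K2: "(\<lambda>p. K (fst p) (snd p)) \<in> borel_measurable (lborel_dim d \<Otimes>\<^sub>M lborel_dim d)"
      using K by (simp add: case_prod_beta)
    have K3: "(\<lambda>(x, x'). w x' * K x x') \<in> borel_measurable (lborel_dim d \<Otimes>\<^sub>M lborel_dim d)"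
      unfolding case_prod_beta
      by (rule borel_measurable_times_ennreal[OF measurable_compose[OF measurable_snd w] K2])
    have K1: "K x \<in> borel_measurable (lborel_dim d)" if "x \<in> space (lborel_dim d)" for x
      using measurable_compose[OF measurable_Pair1'[OF that] K] by simp
    have "(\<integral>\<^sup>+x. \<integral>\<^sup>+x'. K x x' \<partial>G \<partial>G) = (\<integral>\<^sup>+x. \<integral>\<^sup>+x'. w x' * K x x' \<partial>lborel_dim d \<partial>G)"
      unfolding w_def by (rule nn_integral_cong, rule nn_integral_G) (use K1 in simp)
    also have "\<dots> = (\<integral>\<^sup>+x. w x * (\<integral>\<^sup>+x'. w x' * K x x' \<partial>lborel_dim d) \<partial>lborel_dim d)"
      unfolding w_def
      by (rule nn_integral_G, rule lbd.borel_measurable_nn_integral) (rule K3[unfolded w_def])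
    also have "\<dots> = (\<integral>\<^sup>+x. \<integral>\<^sup>+x'. w x * (w x' * K x x') \<partial>lborel_dim d \<partial>lborel_dim d)"
    proof (rule nn_integral_cong)
      fix x assume x: "x \<in> space (lborel_dim d)"
      note [measurable] = K1[OF x]
      show "w x * (\<integral>\<^sup>+x'. w x' * K x x' \<partial>lborel_dim d) = (\<integral>\<^sup>+x'. w x * (w x' * K x x') \<partial>lborel_dim d)"
        by (rule nn_integral_cmult[symmetric]) measurable
    qed
    finally show ?thesis .
  qed
  have ww: "w (rot_p d y z) * (w (rot_m d y z) * a) = w y * (w z * a)" for y z a
  proof -
    have "w x * w x' = ennreal (exp (- (q x + q x') / 2) / Z\<^sup>2)" for x x'
      unfolding w_def using Z_pos
      by (subst ennreal_mult[symmetric]) (simp_all add: exp_add[symmetric] power2_eq_square field_simps)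
    then have "w (rot_p d y z) * w (rot_m d y z) = w y * w z" by (simp only: q_rot)
    then show ?thesis by (simp only: mult.assoc[symmetric])
  qed
  have mR: "(\<lambda>p. rot_p d (fst p) (snd p)) \<in> lborel_dim d \<Otimes>\<^sub>M lborel_dim d \<rightarrow>\<^sub>M lborel_dim d"
    "(\<lambda>p. rot_m d (fst p) (snd p)) \<in> lborel_dim d \<Otimes>\<^sub>M lborel_dim d \<rightarrow>\<^sub>M lborel_dim d"
    unfolding rot_p_def rot_m_def by (rule measurable_lincomb_pair)+
  have F1: "case_prod (\<lambda>y z. F (rot_p d y z) (rot_m d y z))
      \<in> borel_measurable (lborel_dim d \<Otimes>\<^sub>M lborel_dim d)"
    using measurable_compose[OF measurable_Pair[OF mR] F] by (simp add: case_prod_beta)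
  have F2: "case_prod (\<lambda>x x'. w x * (w x' * F x x')) \<in> borel_measurable (lborel_dim d \<Otimes>\<^sub>M lborel_dim d)"
    unfolding case_prod_beta
    by (rule borel_measurable_times_ennreal[OF measurable_compose[OF measurable_fst w]
          borel_measurable_times_ennreal[OF measurable_compose[OF measurable_snd w]]])
       (use F in \<open>simp add: case_prod_beta\<close>)
  show ?thesis
    unfolding expand[OF F] expand[OF F1]
    by (rule nn_integral_lborel_dim_rotate[OF F2, unfolded ww])
qed

text \<open>For q x >= 16 * d one has q x / 8 <= q x / 4 - 2 * d, so the chi-square moment at 1/4
  bounds the integral by (exp (- 2) * sqrt 2) ^ d, uniformly in \<open>d\<close>.\<close>

lemma shell_bound: "(\<integral>x. indicator {x. q x \<ge> 16 * d} x * exp (q x / 8) \<partial>G) \<le> 1"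
    (is "?I \<le> 1")
  and shell_integrable: "integrable G (\<lambda>x. indicator {x. q x \<ge> 16 * d} x * exp (q x / 8))"
proof -
  have i: "integrable G (\<lambda>x. exp (- 2 * real d) * exp (1 / 4 * q x))"
    using integrable_G_exp_q[of "1/4"] by simp
  have le: "indicator {x. q x \<ge> 16 * d} x * exp (q x / 8) \<le> exp (- 2 * real d) * exp (1 / 4 * q x)" for x
    by (auto simp: indicator_def exp_add[symmetric])
  show i2: "integrable G (\<lambda>x. indicator {x. q x \<ge> 16 * d} x * exp (q x / 8))"
  proof (rule Bochner_Integration.integrable_bound[OF i])
    show "(\<lambda>x. indicator {x. q x \<ge> 16 * d} x * exp (q x / 8)) \<in> borel_measurable G" by measurable
    show "AE x in G. norm (indicator {x. q x \<ge> 16 * d} x * exp (q x / 8))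
        \<le> norm (exp (- 2 * real d) * exp (1 / 4 * q x))"
      using le by (simp add: abs_mult)
  qed
  have "?I \<le> (\<integral>x. exp (- 2 * real d) * exp (1 / 4 * q x) \<partial>G)"
    by (rule integral_mono[OF i2 i]) (rule le)
  also have "\<dots> = exp (- 2 * real d) * sqrt 2 ^ d"
    using integral_G_exp_q[of "1/4"] by (simp add: real_sqrt_divide)
  also have "\<dots> = (exp (- 2) * sqrt 2) ^ d"
    by (simp add: power_mult_distrib flip: exp_of_nat_mult)
  also have "\<dots> \<le> 1"
  proof (rule power_le_one)
    have "sqrt 2 \<le> (2::real)" by (simp add: sqrt2_less_2 less_imp_le)
    also have "\<dots> \<le> exp 2" using exp_ge_add_one_self[of 2] by simp
    finally show "exp (- 2) * sqrt 2 \<le> (1::real)" by (simp add: exp_minus field_simps)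
  qed simp
  finally show "?I \<le> 1" .
qed

lemma prob_points [simp]: "measure G ({..<d} \<rightarrow>\<^sub>E UNIV) = 1"
  using prob_space by simp

text \<open>Chernoff's bound with exponent q / 4: the complement has mass at most (exp (- 4) * sqrt
  2) ^ d, and exp 4 >= 16.\<close>

lemma measure_ball_ge: "7 / 8 \<le> (\<integral>x. indicat_real {x. q x \<le> 16 * d} x \<partial>G)"
proof -
  have i: "integrable G (\<lambda>x. exp (- 4 * real d) * exp (1 / 4 * q x))"
    using integrable_G_exp_q[of "1/4"] by simp
  have ii: "integrable G (\<lambda>x. indicat_real {x. q x \<le> 16 * d} x)"
    by (rule integrable_const_bound[of _ 1]) (auto simp: indicator_def, measurable)
  have "(\<integral>x. 1 - indicat_real {x. q x \<le> 16 * d} x \<partial>G) \<le> (\<integral>x. exp (- 4 * real d) * exp (1 / 4 * q x) \<partial>G)"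
    by (rule integral_mono[OF _ i]) (use ii in \<open>auto simp: indicator_def exp_add[symmetric]\<close>)
  also have "\<dots> = exp (- 4 * real d) * sqrt 2 ^ d"
    using integral_G_exp_q[of "1/4"] by (simp add: real_sqrt_divide)
  also have "\<dots> = (exp (- 4) * sqrt 2) ^ d"
    by (simp add: power_mult_distrib flip: exp_of_nat_mult)
  also have b: "exp (- 4) * sqrt 2 \<le> (1 / 8)"
  proof -
    have "sqrt 2 \<le> (2::real)" by (simp add: sqrt2_less_2 less_imp_le)
    moreover have "(2::real) ^ 4 \<le> exp 1 ^ 4" by (intro power_mono) (use exp_ge_add_one_self[of 1] in auto)
    then have "(16::real) \<le> exp 4" by (simp flip: exp_of_nat_mult)
    ultimately show ?thesis by (simp add: exp_minus field_simps)
  qed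
  have "(exp (- 4) * sqrt 2) ^ d \<le> (exp (- 4) * sqrt 2 :: real) ^ 1"
    by (rule power_decreasing) (use d_ge_1 b in auto)
  also have "\<dots> \<le> 1 / 8" using b by simp
  finally have "(\<integral>x. 1 - indicat_real {x. q x \<le> 16 * d} x \<partial>G) \<le> 1 / 8" .
  moreover have "(\<integral>x. 1 - indicat_real {x. q x \<le> 16 * d} x \<partial>G) = 1 - (\<integral>x. indicat_real {x. q x \<le> 16 * d} x \<partial>G)"
    using ii prob_space by (subst Bochner_Integration.integral_diff) auto
  ultimately show ?thesis by simp
qed

text \<open>The variance is the second derivative at 0 of the Laplace transform. It is taken as a
  limit of symmetric second differences with step 1 / (k + 1), whose expectations are known exactly,
  by dominated convergence.\<close>

lemma
  shows integrable_bil_sq: "integrable G (\<lambda>x. (bil h x)\<^sup>2)"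
    and integral_bil_sq: "(\<integral>x. (bil h x)\<^sup>2 \<partial>G) = q h"
proof -
  have em: "integrable G (\<lambda>x. exp (t * bil h x))" "(\<integral>x. exp (t * bil h x) \<partial>G) = exp (t\<^sup>2 * q h / 2)" for t
    using integrable_G_exp_bil[of "\<lambda>i. t * h i"] integral_G_exp_bil[of "\<lambda>i. t * h i"]
      bil_lincomb[of t h 0 h] q_scale[of t h] by auto
  have em': "integrable G (\<lambda>x. exp (- (t * bil h x)))" "(\<integral>x. exp (- (t * bil h x)) \<partial>G) = exp (t\<^sup>2 * q h / 2)" for t
    using em[of "- t"] by auto
  define s where "s k x = (real (Suc k))\<^sup>2 * (exp (bil h x / Suc k) + exp (- (bil h x / Suc k)) - 2)" for k :: nat and x
  have si: "integrable G (s k)" "(\<integral>x. s k x \<partial>G) = (real (Suc k))\<^sup>2 * (2 * exp (q h / (2 * (real (Suc k))\<^sup>2)) - 2)" for k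
    unfolding s_def using em[of "1 / Suc k"] em'[of "1 / Suc k"] by (simp_all add: prob_space power_divide algebra_simps)
  \<comment> \<open>Majorant of all \<open>s k\<close>: exp u + exp (- u) - 2 <= u^2 * exp u for u =
    |bil h x| / (k + 1), followed by l^2 <= 4 * exp |l|.\<close>
  define w where "w x = 4 * (exp (2 * bil h x) + exp (- (2 * bil h x)) + 2)" for x
  have iw: "integrable G w" unfolding w_def using em[of 2] em'[of 2] by simp
  have lim: "(\<lambda>k. s k x) \<longlonglongrightarrow> (bil h x)\<^sup>2" for x
  proof -
    have "(\<lambda>k. (real (Suc k))\<^sup>2 * (exp (l / Suc k) + exp (- (l / Suc k)) - 2)) \<longlonglongrightarrow> l\<^sup>2" for l :: real
    proof (cases "l = 0")
      case False
      then have "(\<lambda>k. (real (Suc k))\<^sup>2 * (exp (l / Suc k) + exp (- (l / Suc k)) - 2)) \<longlonglongrightarrow> l * l"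
        by real_asymp
      then show ?thesis by (simp add: power2_eq_square)
    qed simp
    then show ?thesis unfolding s_def .
  qed
  have bound: "\<bar>s k x\<bar> \<le> w x" for k x
  proof -
    define u where "u = \<bar>bil h x\<bar> / Suc k"
    have u: "0 \<le> u" "u \<le> \<bar>bil h x\<bar>" by (auto simp: u_def divide_le_eq mult_le_cancel_left1)
    have e: "exp (bil h x / Suc k) + exp (- (bil h x / Suc k)) = exp u + exp (- u)"
      by (auto simp: u_def abs_if)
    have pos: "exp u + exp (- u) - 2 \<ge> 0"
      using sum_squares_bound[of "exp (u / 2)" "exp (- u / 2)"]
      by (simp add: exp_add[symmetric] power2_eq_square mult.assoc)
    have "exp u + exp (- u) - 2 = (exp u - 1)\<^sup>2 * exp (- u)"
      by (simp add: power2_eq_square algebra_simps exp_add[symmetric])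
    also have "\<dots> \<le> (u * exp u)\<^sup>2 * exp (- u)"
    proof (intro mult_right_mono power_mono)
      have "exp (- u) \<ge> 1 - u" using exp_ge_add_one_self[of "- u"] by simp
      then have "exp u * (1 - u) \<le> exp u * exp (- u)" by (intro mult_left_mono) auto
      then show "exp u - 1 \<le> u * exp u" by (simp add: exp_add[symmetric] algebra_simps)
    qed (use u in auto)
    also have "\<dots> = u\<^sup>2 * exp u" by (simp add: power2_eq_square exp_add[symmetric] mult_ac)
    also have "\<dots> \<le> u\<^sup>2 * exp \<bar>bil h x\<bar>" using u by (intro mult_left_mono) auto
    finally have "\<bar>s k x\<bar> \<le> (real (Suc k))\<^sup>2 * (u\<^sup>2 * exp \<bar>bil h x\<bar>)"
      unfolding s_def e using pos by (simp only: abs_mult abs_of_nonneg zero_le_power2) (intro mult_left_mono, auto)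
    also have "\<dots> = (bil h x)\<^sup>2 * exp \<bar>bil h x\<bar>" by (simp add: u_def power_divide)
    also have "\<dots> \<le> (4 * exp \<bar>bil h x\<bar>) * exp \<bar>bil h x\<bar>"
      using power_le_exp[of "\<bar>bil h x\<bar>" 2] by (intro mult_right_mono) auto
    also have "\<dots> = 4 * exp (2 * \<bar>bil h x\<bar>)" by (simp flip: exp_add)
    also have "\<dots> \<le> w x" by (auto simp: w_def abs_if)
    finally show ?thesis .
  qed
  have m: "(\<lambda>x. (bil h x)\<^sup>2) \<in> borel_measurable G" by measurable
  have AEl: "AE x in G. (\<lambda>k. s k x) \<longlonglongrightarrow> (bil h x)\<^sup>2" using lim by simp
  have AEb: "AE x in G. norm (s k x) \<le> w x" for k using bound by simp
  show "integrable G (\<lambda>x. (bil h x)\<^sup>2)"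
    by (rule integrable_dominated_convergence[OF m _ iw AEl AEb]) (use si in auto)
  have "(\<lambda>k. \<integral>x. s k x \<partial>G) \<longlonglongrightarrow> (\<integral>x. (bil h x)\<^sup>2 \<partial>G)"
    by (rule integral_dominated_convergence[OF m _ iw AEl AEb]) (use si in auto)
  moreover have "(\<lambda>k. (real (Suc k))\<^sup>2 * (2 * exp (c / (2 * (real (Suc k))\<^sup>2)) - 2)) \<longlonglongrightarrow> c" for c :: real
    by real_asymp
  ultimately show "(\<integral>x. (bil h x)\<^sup>2 \<partial>G) = q h"
    unfolding si using LIMSEQ_unique by blast
qed

end

subsection \<open>Exponential moments of cubic forms\<close>

definition cubic :: "nat \<Rightarrow> (nat \<Rightarrow> nat \<Rightarrow> nat \<Rightarrow> real) \<Rightarrow> point \<Rightarrow> real" where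
  "cubic d c x = (\<Sum>i<d. \<Sum>j<d. \<Sum>k<d. c i j k * x i * x j * x k)"

text \<open>The derivative of the cubic form at \<open>y\<close> in direction \<open>z\<close>. The
  coefficients are not assumed symmetric, hence the three placements of \<open>z\<close>.\<close>

definition cubic_polar :: "nat \<Rightarrow> (nat \<Rightarrow> nat \<Rightarrow> nat \<Rightarrow> real) \<Rightarrow> point \<Rightarrow> point \<Rightarrow> real" where
  "cubic_polar d c y z = (\<Sum>i<d. \<Sum>j<d. \<Sum>k<d. c i j k * (y i * y j * z k + y i * z j * y k + z i * y j * y k))"

lemma cubic_restrict [simp]: "cubic d c (restrict x {..<d}) = cubic d c x"
  unfolding cubic_def by (auto intro!: sum.cong)

lemma cubic_scale: "cubic d c (\<lambda>i. a * x i) = a ^ 3 * cubic d c x"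
  unfolding cubic_def sum_distrib_left
  by (intro sum.cong refl) (simp add: power3_eq_cube)

lemma cubic_uminus: "cubic d c (\<lambda>i. - x i) = - cubic d c x"
  using cubic_scale[of d c "-1" x] by simp

lemma cubic_add_diff:
  "cubic d c (\<lambda>i. y i + z i) - cubic d c (\<lambda>i. y i - z i) = 2 * cubic_polar d c y z + 2 * cubic d c z"
  unfolding cubic_def cubic_polar_def sum_distrib_left sum_subtractf[symmetric] sum.distrib[symmetric]
  by (intro sum.cong refl) (simp add: algebra_simps)

text \<open>Collects the coefficients of \<open>z\<close>, so that \<open>riesz\<close> can
  represent the derivative at \<open>y\<close> by a vector.\<close>

lemma cubic_polar_linear:
  "cubic_polar d c y z = (\<Sum>k<d. (\<Sum>i<d. \<Sum>j<d. (c i j k + c i k j + c k i j) * y i * y j) * z k)"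
proof -
  have 1: "(\<Sum>i<d. \<Sum>j<d. \<Sum>k<d. c i j k * y i * y j * z k) = (\<Sum>k<d. \<Sum>i<d. \<Sum>j<d. c i j k * y i * y j * z k)"
    by (rule trans[OF sum.cong[OF refl sum.swap] sum.swap])
  have 2: "(\<Sum>i<d. \<Sum>k<d. \<Sum>j<d. c i k j * y i * z k * y j) = (\<Sum>k<d. \<Sum>i<d. \<Sum>j<d. c i k j * y i * z k * y j)"
    by (rule sum.swap)
  have "cubic_polar d c y z = (\<Sum>i<d. \<Sum>j<d. \<Sum>k<d. c i j k * y i * y j * z k)
      + (\<Sum>i<d. \<Sum>k<d. \<Sum>j<d. c i k j * y i * z k * y j) + (\<Sum>k<d. \<Sum>i<d. \<Sum>j<d. c k i j * z k * y i * y j)"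
    unfolding cubic_polar_def sum.distrib[symmetric] by (intro sum.cong refl) (simp add: algebra_simps)
  also have "\<dots> = (\<Sum>k<d. \<Sum>i<d. \<Sum>j<d. (c i j k + c i k j + c k i j) * y i * y j * z k)"
    unfolding 1 2 sum.distrib[symmetric] by (intro sum.cong refl) (simp add: algebra_simps)
  finally show ?thesis by (simp add: sum_distrib_right)
qed

lemma measurable_cubic [measurable]: "cubic d c \<in> borel_measurable (lborel_dim d)"
  unfolding cubic_def by (intro borel_measurable_sum borel_measurable_times measurable_coord) auto

text \<open>Young's inequality with exponents 4 and 4/3. With X = exp a and Y = exp (b / 3) it is a
  polynomial inequality, and the difference of the two sides has the factor (X - Y)^2.\<close>

lemma exp_add_le_Young: "exp (a + b) \<le> 1 / 4 * exp (4 * a) + 3 / 4 * exp (4 / 3 * b)" for a b :: real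
proof -
  define X Y where "X = exp a" and "Y = exp (b / 3)"
  have "X ^ 4 + 3 * Y ^ 4 - 4 * (X * Y ^ 3) = (X - Y)\<^sup>2 * (X\<^sup>2 + 2 * (X * Y) + 3 * Y\<^sup>2)"
    by (simp add: power2_eq_square power3_eq_cube power4_eq_xxxx algebra_simps)
  also have "\<dots> \<ge> 0" by (auto simp: X_def Y_def intro!: mult_nonneg_nonneg add_nonneg_nonneg)
  finally have "X * Y ^ 3 \<le> 1 / 4 * X ^ 4 + 3 / 4 * Y ^ 4" by simp
  then show ?thesis by (simp add: X_def Y_def exp_add exp_of_nat_mult[symmetric])
qed

context pos_def_form begin

lemma cubic_rot: "cubic d c (rot_p d y z) - cubic d c (rot_m d y z)
    = (1 / sqrt 2) * (cubic_polar d c y z + cubic d c z)"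
proof -
  have p: "cubic d c (rot_p d y z) = (1 / sqrt 2) ^ 3 * cubic d c (\<lambda>i. y i + z i)"
    unfolding rot_p_def cubic_restrict cubic_scale[symmetric] by (simp add: add_divide_distrib)
  have m: "cubic d c (rot_m d y z) = (1 / sqrt 2) ^ 3 * cubic d c (\<lambda>i. y i - z i)"
    unfolding rot_m_def cubic_restrict cubic_scale[symmetric] by (simp add: diff_divide_distrib)
  have "(1 / sqrt 2 :: real) ^ 3 * 2 = 1 / sqrt 2" by (simp add: power3_eq_cube field_simps)
  then have "(1 / sqrt 2) * (cubic_polar d c y z + cubic d c z) = (1 / sqrt 2) ^ 3 * 2 * (cubic_polar d c y z + cubic d c z)"
    by (simp only:)
  also have "\<dots> = (1 / sqrt 2) ^ 3 * (2 * cubic_polar d c y z + 2 * cubic d c z)"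
    by (simp only: distrib_left mult.assoc)
  finally show ?thesis
    unfolding p m right_diff_distrib[symmetric] cubic_add_diff by (rule sym)
qed

text \<open>The size \<open>t\<close> of the form relative to q ^ (3/2) is at most 1 / d, the scale
  at which its exponential moments stay bounded in \<open>d\<close>. The facts below are later
  applied to \<open>g\<close> and its negative with t = 1 / (6 * d).\<close>

context
  fixes c :: "nat \<Rightarrow> nat \<Rightarrow> nat \<Rightarrow> real" and t :: real
  assumes cubic_le: "\<And>x. \<bar>cubic d c x\<bar> \<le> t * (q x * sqrt (q x))"
    and t_nonneg: "t \<ge> 0" and t_d: "t * d \<le> 1"
begin

text \<open>Polarisation: the derivative is tested on the multiple \<open>z\<close> of
  \<open>h\<close> with q z = q y. Then y + z and y - z have \<open>q\<close> at most 4 * q y, where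
  the form is at most 8 * t * q y ^ (3/2). By \<open>cubic_add_diff\<close>, twice the derivative is
  at most (8 + 8 + 2) * t * q y ^ (3/2), and 81 is the square of 18 / 2.\<close>

lemma cubic_polar_riesz:
  obtains h where "\<And>z. cubic_polar d c y z = bil h z" "q h \<le> 81 * t\<^sup>2 * (q y)\<^sup>2"
proof -
  obtain h where h: "\<And>z. bil h z = cubic_polar d c y z"
    using riesz[of "\<lambda>k. \<Sum>i<d. \<Sum>j<d. (c i j k + c i k j + c k i j) * y i * y j"]
    unfolding cubic_polar_linear by blast
  have "q h \<le> 81 * t\<^sup>2 * (q y)\<^sup>2"
  proof (cases "q h = 0 \<or> q y = 0")
    case True
    then show ?thesis
    proof
      assume "q y = 0"
      then have "cubic_polar d c y h = 0" by (simp add: q_eq_0_iff cubic_polar_linear)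
      then show ?thesis using h[of h] by simp
    qed simp
  next
    case False
    then have pos: "q h > 0" "q y > 0" using q_nonneg by (auto simp: less_le)
    define a where "a = sqrt (q y / q h)"
    have a: "a > 0" "a\<^sup>2 * q h = q y" using pos by (auto simp: a_def)
    define z where "z = (\<lambda>i. a * h i)"
    have qz: "q z = q y" unfolding z_def q_scale by (rule a)
    have bz: "cubic_polar d c y z = a * q h"
      unfolding z_def h[symmetric] using bil_lincomb_right[of h a h 0 h] by simp
    have le4: "q (\<lambda>i. y i + z i) \<le> 4 * q y" "q (\<lambda>i. y i - z i) \<le> 4 * q y"
    proof -
      have "2 * \<bar>bil y z\<bar> \<le> 2 * q y" using abs_bil_le[of y z] qz by simp
      then show "q (\<lambda>i. y i + z i) \<le> 4 * q y" "q (\<lambda>i. y i - z i) \<le> 4 * q y"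
        using q_lincomb[of 1 y 1 z] q_lincomb[of 1 y "-1" z] qz by simp_all
    qed
    have c8: "\<bar>cubic d c w\<bar> \<le> 8 * t * (q y * sqrt (q y))" if "q w \<le> 4 * q y" for w
    proof -
      have "\<bar>cubic d c w\<bar> \<le> t * (q w * sqrt (q w))" by (rule cubic_le)
      also have "\<dots> \<le> t * ((4 * q y) * sqrt (4 * q y))"
        using that t_nonneg by (intro mult_left_mono mult_mono) auto
      finally show ?thesis by (simp add: real_sqrt_mult)
    qed
    have "2 * (a * q h) = cubic d c (\<lambda>i. y i + z i) - cubic d c (\<lambda>i. y i - z i) - 2 * cubic d c z"
      using cubic_add_diff[of d c y z] bz by simp
    also have "\<dots> \<le> 18 * t * (q y * sqrt (q y))"
      using c8[OF le4(1)] c8[OF le4(2)] cubic_le[of z] unfolding qz by (simp add: abs_le_iff)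
    finally have "a * q h \<le> 9 * t * (q y * sqrt (q y))" by simp
    moreover have "a * q h = sqrt (q y) * sqrt (q h)"
    proof -
      have "sqrt (q h) * sqrt (q h) = q h" by simp
      then show ?thesis using pos by (simp add: a_def real_sqrt_divide divide_simps mult.assoc)
    qed
    ultimately have "sqrt (q y) * sqrt (q h) \<le> sqrt (q y) * (9 * t * q y)" by (simp add: mult_ac)
    then have "sqrt (q h) \<le> 9 * t * q y" using pos by (simp only: mult_le_cancel_left_pos real_sqrt_gt_0_iff)
    then have "(sqrt (q h))\<^sup>2 \<le> (9 * t * q y)\<^sup>2" by (intro power_mono) auto
    then show ?thesis by (simp add: power_mult_distrib)
  qed
  then show ?thesis by (rule that[OF h[symmetric]])
qed

lemma integrable_ball_exp_cubic: "integrable G (\<lambda>x. indicator {x. q x \<le> r} x * exp (a * cubic d c x))"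
proof (rule integrable_const_bound)
  show "AE x in G. norm (indicator {x. q x \<le> r} x * exp (a * cubic d c x)) \<le> exp (\<bar>a\<bar> * (t * (\<bar>r\<bar> * sqrt \<bar>r\<bar>)))"
  proof (rule AE_I2)
    fix x
    have "a * cubic d c x \<le> \<bar>a\<bar> * (t * (\<bar>r\<bar> * sqrt \<bar>r\<bar>))" if "q x \<le> r"
    proof -
      have "a * cubic d c x \<le> \<bar>a\<bar> * \<bar>cubic d c x\<bar>" by (simp flip: abs_mult)
      also have "\<dots> \<le> \<bar>a\<bar> * (t * (\<bar>r\<bar> * sqrt \<bar>r\<bar>))"
      proof (rule mult_left_mono)
        have "\<bar>cubic d c x\<bar> \<le> t * (q x * sqrt (q x))" by (rule cubic_le)
        also have "\<dots> \<le> t * (\<bar>r\<bar> * sqrt \<bar>r\<bar>)" using that t_nonneg by (intro mult_left_mono mult_mono) auto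
        finally show "\<bar>cubic d c x\<bar> \<le> t * (\<bar>r\<bar> * sqrt \<bar>r\<bar>)" .
      qed simp
      finally show ?thesis .
    qed
    then show "norm (indicator {x. q x \<le> r} x * exp (a * cubic d c x)) \<le> exp (\<bar>a\<bar> * (t * (\<bar>r\<bar> * sqrt \<bar>r\<bar>)))"
      by (auto simp: indicator_def)
  qed
  show "(\<lambda>x. indicator {x. q x \<le> r} x * exp (a * cubic d c x)) \<in> borel_measurable G" by measurable
qed

text \<open>One factor sqrt (q x) is traded for the radius. The cubic form becomes a small multiple
  of \<open>q\<close> when \<open>d\<close> is large, so that exp of it can be compared with
  chi-square moments.\<close>

lemma cubic_le_linear:
  fixes r :: real
  assumes "q x \<le> r * d" "r \<ge> 0"
  shows "\<bar>cubic d c x\<bar> \<le> sqrt r / sqrt d * q x"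
proof -
  have d: "real d > 0" using d_ge_1 by simp
  have "\<bar>cubic d c x\<bar> \<le> t * (q x * sqrt (q x))" by (rule cubic_le)
  also have "\<dots> \<le> (1 / d) * (q x * sqrt (r * d))"
    using t_d d assms t_nonneg by (intro mult_mono mult_left_mono) (auto simp: field_simps)
  also have "\<dots> = sqrt r / sqrt d * q x"
    using d by (simp add: real_sqrt_mult field_simps)
  finally show ?thesis .
qed

lemma integral_ball_cubic: "(\<integral>x. indicator {x. q x \<le> r} x * cubic d c x \<partial>G) = 0"
proof -
  let ?f = "\<lambda>x. indicator {x. q x \<le> r} x * cubic d c x"
  have "(\<integral>x. ?f x \<partial>G) = (\<integral>x. ?f (\<lambda>i\<in>{..<d}. - x i) \<partial>G)"
    by (rule integral_G_reflect[symmetric]) measurable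
  also have "\<dots> = (\<integral>x. - ?f x \<partial>G)"
  proof (rule Bochner_Integration.integral_cong[OF refl])
    fix x
    have "q (\<lambda>i. - x i) = q x" using q_scale[of "-1" x] by simp
    then show "?f (\<lambda>i\<in>{..<d}. - x i) = - ?f x" by (simp add: cubic_uminus indicator_def)
  qed
  finally show ?thesis by simp
qed

lemma integrable_ball_cubic: "integrable G (\<lambda>x. indicator {x. q x \<le> r} x * cubic d c x)"
proof (rule Bochner_Integration.integrable_bound)
  show "integrable G (\<lambda>x. indicator {x. q x \<le> r} x * exp (1 * cubic d c x) + indicator {x. q x \<le> r} x * exp ((-1) * cubic d c x))"
    by (intro Bochner_Integration.integrable_add integrable_ball_exp_cubic)
  show "(\<lambda>x. indicator {x. q x \<le> r} x * cubic d c x) \<in> borel_measurable G" by measurable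
  have "\<bar>u\<bar> \<le> exp u + exp (- u)" for u :: real
    using exp_ge_add_one_self[of u] exp_ge_add_one_self[of "-u"] exp_gt_zero[of u] exp_gt_zero[of "-u"] by linarith
  then show "AE x in G. norm (indicator {x. q x \<le> r} x * cubic d c x)
     \<le> norm (indicator {x. q x \<le> r} x * exp (1 * cubic d c x) + indicator {x. q x \<le> r} x * exp ((-1) * cubic d c x))"
    by (auto simp: indicator_def)
qed

text \<open>
  Let \<open>F\<close> be the truncated moment and rotate the independent pair \<open>(x, x')\<close> to \<open>(y, z)\<close> by 45 degrees in
  \<open>F * \<integral> exp (- l * cubic x')\<close>. By \<open>cubic_rot\<close> the exponent becomes a term linear in \<open>z\<close>, integrated
  exactly, plus \<open>l / sqrt 2\<close> times the cubic form of \<open>z\<close>. Young's inequality separates the two, and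
  since \<open>4 / 3 / sqrt 2 < 1\<close> the second one is again at most \<open>F\<close> up to a shell: \<open>F\<close> is bounded by a
  constant plus a fraction of itself. The constant is \<open>331776 = 4 * 81 * 32\<^sup>2\<close>.
\<close>

lemma cubic_concentration:
  assumes lam: "l \<ge> 0"
  shows "(\<integral>x. indicator {x. q x \<le> 16 * d} x * exp (l * cubic d c x) \<partial>G) \<le> 14 * exp (331776 * l\<^sup>2)"
    (is "?F \<le> _")
\<comment> \<open>If \<open>d\<close> is small compared with l^2, the supremum 64 * sqrt d on the
  ball is good enough. The shell estimate of the other case asks for d >= 64 * 256 / 9 * l^2, and
  2048 exceeds this factor.\<close>
proof (cases "real d < 2048 * l\<^sup>2")
  case True
  have d: "real d > 0" using d_ge_1 by simp
  have "l * cubic d c x \<le> 331776 * l\<^sup>2" if "q x \<le> 16 * d" for x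
  proof -
    have "\<bar>cubic d c x\<bar> \<le> sqrt 16 / sqrt d * q x" by (rule cubic_le_linear) (use that in auto)
    also have "\<dots> \<le> sqrt 16 / sqrt d * (16 * d)" by (rule mult_left_mono) (use that in auto)
    also have "\<dots> = 64 * sqrt d" using d by (simp add: field_simps)
    \<comment> \<open>46 is the least integer whose square exceeds 2048.\<close>
    also have "\<dots> \<le> 64 * sqrt (46\<^sup>2 * l\<^sup>2)" using True by (intro mult_left_mono real_sqrt_le_mono) auto
    also have "\<dots> = 2944 * l" using lam by (simp add: real_sqrt_mult)
    finally have "l * cubic d c x \<le> l * (2944 * l)" using lam by (intro mult_left_mono) auto
    also have "\<dots> \<le> 331776 * l\<^sup>2" by (simp add: power2_eq_square)
    finally show ?thesis .
  qed
  then have "?F \<le> (\<integral>x. exp (331776 * l\<^sup>2) \<partial>G)"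
    by (intro integral_mono integrable_ball_exp_cubic) (auto simp: indicator_def)
  also have "\<dots> \<le> 14 * exp (331776 * l\<^sup>2)" by simp
  finally show ?thesis .
next
  case False
  define K where "K = exp (331776 * l\<^sup>2)"
  define A where "A = {x. q x \<le> 16 * d}"
  define e where "e x = indicator A x * exp (l * cubic d c x)" for x
  define em where "em x = indicator A x * exp (- l * cubic d c x)" for x
  have ie: "integrable G e" unfolding e_def A_def by (rule integrable_ball_exp_cubic)
  have iem: "integrable G em" unfolding em_def A_def by (rule integrable_ball_exp_cubic)
  have [measurable]: "A \<inter> space (lborel_dim d) \<in> sets (lborel_dim d)" unfolding A_def by measurable
  have e_m [measurable]: "e \<in> borel_measurable (lborel_dim d)" using ie by (auto dest: borel_measurable_integrable)
  have em_m [measurable]: "em \<in> borel_measurable (lborel_dim d)" using iem by (auto dest: borel_measurable_integrable)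
  have pos: "0 \<le> e x" "0 \<le> em x" for x by (auto simp: e_def em_def)
  define F where "F = (\<integral>x. e x \<partial>G)"
  define Fm where "Fm = (\<integral>x. em x \<partial>G)"
  have F0: "F \<ge> 0" unfolding F_def by (rule Bochner_Integration.integral_nonneg) (rule pos)
  have iA: "integrable G (\<lambda>x. indicat_real A x)"
    using integrable_ball_exp_cubic[of "16 * d" 0] by (simp add: A_def)
  have ig: "integrable G (\<lambda>x. indicator A x * cubic d c x)" unfolding A_def by (rule integrable_ball_cubic)
  \<comment> \<open>The second factor is bounded below: exp u >= 1 + u, and the linear term
    integrates to 0 by oddness.\<close>
  have "7 / 8 \<le> (\<integral>x. indicat_real A x \<partial>G) - l * (\<integral>x. indicator A x * cubic d c x \<partial>G)"
    using measure_ball_ge integral_ball_cubic[of "16 * d"] unfolding A_def by simp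
  also have "\<dots> = (\<integral>x. indicat_real A x - l * (indicator A x * cubic d c x) \<partial>G)" using iA ig by simp
  also have "\<dots> \<le> Fm"
    unfolding Fm_def
  proof (rule integral_mono[OF _ iem])
    show "integrable G (\<lambda>x. indicat_real A x - l * (indicator A x * cubic d c x))" using iA ig by simp
    show "indicat_real A x - l * (indicator A x * cubic d c x) \<le> em x" for x
      using exp_ge_add_one_self[of "- l * cubic d c x"] by (auto simp: em_def indicator_def)
  qed
  finally have Fm: "7 / 8 \<le> Fm" .
  define l' where "l' = 4 / 3 * (l / sqrt 2)"
  have l': "0 \<le> l'" "l' \<le> l" "l'\<^sup>2 = 8 / 9 * l\<^sup>2"
  proof -
    show "0 \<le> l'" using lam by (simp add: l'_def)
    show sq: "l'\<^sup>2 = 8 / 9 * l\<^sup>2" by (simp add: l'_def power_mult_distrib power_divide)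
    show "l' \<le> l" by (rule power2_le_imp_le[OF _ lam]) (use sq zero_le_power2[of l] in linarith)
  qed
  \<comment> \<open>If both rotated points lie in \<open>A\<close>, then q y + q z <= 16 * d + 16 *
    d, hence \<open>y\<close> and \<open>z\<close> lie in \<open>B\<close>.\<close>
  define B where "B = {x. q x \<le> 32 * d}"
  define P where "P = (\<integral>x. indicator B x * exp (l' * cubic d c x) \<partial>G)"
  have iP: "integrable G (\<lambda>x. indicator B x * exp (l' * cubic d c x))"
    unfolding B_def by (rule integrable_ball_exp_cubic)
  \<comment> \<open>The larger ball is paid for by l' <= l: inside \<open>A\<close> the integrand is
    at most that of \<open>F\<close> plus 1, and between the two radii it is at most exp (q / 8),
    which \<open>shell_bound\<close> integrates to at most 1.\<close>
  have PF: "P \<le> F + 2"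
  proof -
    have "P \<le> (\<integral>x. e x + 1 + indicator {x. q x \<ge> 16 * d} x * exp (q x / 8) \<partial>G)"
      unfolding P_def
    proof (rule integral_mono[OF iP])
      show "integrable G (\<lambda>x. e x + 1 + indicator {x. q x \<ge> 16 * d} x * exp (q x / 8))"
        using ie shell_integrable by simp
      fix x
      have "l' * cubic d c x \<le> q x / 8" if "q x \<le> 32 * d"
      proof -
        have d: "real d > 0" using d_ge_1 by simp
        have "l' * sqrt 32 \<le> sqrt d / 8"
        proof (rule power2_le_imp_le)
          have "(l' * sqrt 32)\<^sup>2 = 256 / 9 * l\<^sup>2" by (simp add: power_mult_distrib l')
          also have "\<dots> \<le> d / 64" using False by (simp add: field_simps)
          finally show "(l' * sqrt 32)\<^sup>2 \<le> (sqrt d / 8)\<^sup>2" by (simp add: power_divide)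
        qed simp
        then have k: "l' * (sqrt 32 / sqrt d) \<le> 1 / 8" using d by (simp add: field_simps)
        have "\<bar>cubic d c x\<bar> \<le> sqrt 32 / sqrt d * q x" by (rule cubic_le_linear) (use that in auto)
        then have "l' * cubic d c x \<le> l' * (sqrt 32 / sqrt d * q x)" using l' by (intro mult_left_mono) auto
        also have "\<dots> = (l' * (sqrt 32 / sqrt d)) * q x" by simp
        also have "\<dots> \<le> 1 / 8 * q x" by (rule mult_right_mono[OF k]) simp
        finally show ?thesis by simp
      qed
      moreover have "exp (l' * cubic d c x) \<le> exp (l * cubic d c x) + 1"
      proof (cases "cubic d c x \<ge> 0")
        case True
        then have "l' * cubic d c x \<le> l * cubic d c x" using l' by (intro mult_right_mono) auto
        then have "exp (l' * cubic d c x) \<le> exp (l * cubic d c x)" by simp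
        then show ?thesis by linarith
      next
        case False
        then have "exp (l' * cubic d c x) \<le> 1" using l' by (simp add: mult_nonneg_nonpos)
        then show ?thesis using exp_gt_zero[of "l * cubic d c x"] by linarith
      qed
      ultimately have *: "q x \<le> 32 * d \<Longrightarrow> exp (l' * cubic d c x) \<le> exp (q x / 8)"
        "exp (l' * cubic d c x) \<le> exp (l * cubic d c x) + 1" by auto
      have nn: "0 \<le> indicator {x. q x \<ge> 16 * d} x * exp (q x / 8)" by simp
      show "indicator B x * exp (l' * cubic d c x) \<le> e x + 1 + indicator {x. q x \<ge> 16 * d} x * exp (q x / 8)"
      proof (cases "x \<in> B")
        case B: True
        show ?thesis
        proof (cases "x \<in> A")
          case True
          then have "e x = exp (l * cubic d c x)" by (simp add: e_def)
          moreover have "indicator B x * exp (l' * cubic d c x) = exp (l' * cubic d c x)" using B by simp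
          ultimately show ?thesis using *(2) nn by linarith
        next
          case False
          then have "indicator {x. q x \<ge> 16 * d} x * exp (q x / 8) = exp (q x / 8)" by (simp add: A_def)
          moreover have "indicator B x * exp (l' * cubic d c x) = exp (l' * cubic d c x)" using B by simp
          moreover have "exp (l' * cubic d c x) \<le> exp (q x / 8)" using B *(1) by (simp add: B_def)
          ultimately show ?thesis using pos(1)[of x] by linarith
        qed
      next
        case False
        then show ?thesis using pos(1)[of x] nn by simp
      qed
    qed
    also have "\<dots> = F + 1 + (\<integral>x. indicator {x. q x \<ge> 16 * d} x * exp (q x / 8) \<partial>G)"
      using ie shell_integrable by (simp add: F_def)
    also have "\<dots> \<le> F + 2" using shell_bound by simp
    finally show ?thesis .
  qed
  have inner: "(\<integral>\<^sup>+z. ennreal (e (rot_p d y z) * em (rot_m d y z)) \<partial>G) \<le> ennreal (1 / 4 * K + 3 / 4 * P)" for y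
  proof -
    obtain h where h: "\<And>z. cubic_polar d c y z = bil h z" "q h \<le> 81 * t\<^sup>2 * (q y)\<^sup>2"
      by (rule cubic_polar_riesz[of y]) blast
    \<comment> \<open>The 4 is Young's exponent on the linear part; its Laplace transform is then
      exp (4 * l^2 * q h).\<close>
    define a where "a = 4 * l / sqrt 2"
    have i1: "integrable G (\<lambda>z. exp (bil (\<lambda>i. a * h i) z))" by (rule integrable_G_exp_bil)
    define J where "J z = 1 / 4 * (indicator B y * exp (bil (\<lambda>i. a * h i) z)) + 3 / 4 * (indicator B z * exp (l' * cubic d c z))" for z
    have iJ: "integrable G J" unfolding J_def using i1 iP by simp
    have J0: "0 \<le> J z" for z by (auto simp: J_def)
    have "e (rot_p d y z) * em (rot_m d y z) \<le> J z" for z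
    proof (cases "rot_p d y z \<in> A \<and> rot_m d y z \<in> A")
      case True
      then have "q y + q z \<le> 32 * d" using q_rot[of y z] by (simp add: A_def)
      then have "q y \<le> 32 * d" "q z \<le> 32 * d" using q_nonneg[of y] q_nonneg[of z] by linarith+
      then have B: "y \<in> B" "z \<in> B" by (simp_all add: B_def)
      have "e (rot_p d y z) * em (rot_m d y z) = exp (l * (cubic d c (rot_p d y z) - cubic d c (rot_m d y z)))"
        using True by (simp add: e_def em_def exp_add[symmetric] algebra_simps)
      also have "\<dots> = exp (l / sqrt 2 * bil h z + l / sqrt 2 * cubic d c z)"
        unfolding cubic_rot h by (simp add: algebra_simps)
      also have "\<dots> \<le> 1 / 4 * exp (4 * (l / sqrt 2 * bil h z)) + 3 / 4 * exp (4 / 3 * (l / sqrt 2 * cubic d c z))"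
        by (rule exp_add_le_Young)
      also have "\<dots> = J z"
        using B bil_lincomb[of a h 0 h z] by (simp add: J_def l'_def a_def mult_ac)
      finally show ?thesis .
    next
      case False
      then have "e (rot_p d y z) * em (rot_m d y z) = 0" by (auto simp: e_def em_def)
      then show ?thesis using J0[of z] by linarith
    qed
    then have "(\<integral>\<^sup>+z. ennreal (e (rot_p d y z) * em (rot_m d y z)) \<partial>G) \<le> (\<integral>\<^sup>+z. ennreal (J z) \<partial>G)"
      by (intro nn_integral_mono ennreal_leI)
    also have "\<dots> = ennreal (\<integral>z. J z \<partial>G)" by (rule nn_integral_eq_integral[OF iJ]) (use J0 in auto)
    also have "\<dots> \<le> ennreal (1 / 4 * K + 3 / 4 * P)"
    proof (rule ennreal_leI)
      have "indicator B y * exp (q (\<lambda>i. a * h i) / 2) \<le> K"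
      proof (cases "y \<in> B")
        case True
        have "q h \<le> 81 * (t * q y)\<^sup>2" using h by (simp add: power_mult_distrib)
        also have "t * q y \<le> 32"
        proof -
          have "t * q y \<le> t * (32 * d)" using True t_nonneg by (intro mult_left_mono) (auto simp: B_def)
          then show ?thesis using t_d by simp
        qed
        then have "81 * (t * q y)\<^sup>2 \<le> 81 * 32\<^sup>2" using t_nonneg by (intro mult_left_mono power_mono) auto
        finally have "q h \<le> 82944" by simp
        moreover have "q (\<lambda>i. a * h i) = 8 * l\<^sup>2 * q h"
        proof -
          have "a\<^sup>2 = 8 * l\<^sup>2" by (simp add: a_def power_divide power_mult_distrib)
          then show ?thesis by (simp only: q_scale)
        qed
        ultimately have "q (\<lambda>i. a * h i) / 2 \<le> 331776 * l\<^sup>2"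
          using mult_left_mono[of "q h" 82944 "4 * l\<^sup>2"] by simp
        then show ?thesis using True by (simp add: K_def)
      qed (simp add: K_def)
      moreover have "(\<integral>z. J z \<partial>G) = 1 / 4 * (indicator B y * exp (q (\<lambda>i. a * h i) / 2)) + 3 / 4 * P"
        unfolding J_def P_def using i1 iP by (simp add: integral_G_exp_bil)
      ultimately show "(\<integral>z. J z \<partial>G) \<le> 1 / 4 * K + 3 / 4 * P" by simp
    qed
    finally show ?thesis .
  qed
  have meas: "case_prod (\<lambda>x x'. ennreal (e x * em x')) \<in> borel_measurable (lborel_dim d \<Otimes>\<^sub>M lborel_dim d)"
    unfolding case_prod_beta
    by (intro measurable_compose[OF _ measurable_ennreal] borel_measurable_times
        measurable_compose[OF measurable_fst e_m] measurable_compose[OF measurable_snd em_m])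
  have "ennreal (F * Fm) = ennreal F * ennreal Fm" using F0 Fm by (simp add: ennreal_mult)
  also have "\<dots> = (\<integral>\<^sup>+x. ennreal (e x) \<partial>G) * (\<integral>\<^sup>+x. ennreal (em x) \<partial>G)"
    unfolding F_def Fm_def by (simp add: nn_integral_eq_integral[OF ie] nn_integral_eq_integral[OF iem] pos)
  also have "\<dots> = (\<integral>\<^sup>+x. \<integral>\<^sup>+x'. ennreal (e x * em x') \<partial>G \<partial>G)"
    using ie iem pos by (simp add: ennreal_mult nn_integral_cmult nn_integral_multc)
  also have "\<dots> = (\<integral>\<^sup>+y. \<integral>\<^sup>+z. ennreal (e (rot_p d y z) * em (rot_m d y z)) \<partial>G \<partial>G)"
    by (rule nn_integral_G_rotate[OF meas, symmetric])
  also have "\<dots> \<le> (\<integral>\<^sup>+y. ennreal (1 / 4 * K + 3 / 4 * P) \<partial>G)"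
    by (rule nn_integral_mono) (rule inner)
  also have "\<dots> = ennreal (1 / 4 * K + 3 / 4 * P)" by (simp add: emeasure_space_1[unfolded space_G])
  finally have "F * Fm \<le> 1 / 4 * K + 3 / 4 * P"
  proof (rule iffD1[OF ennreal_le_iff, rotated])
    have "0 \<le> P" unfolding P_def by (rule Bochner_Integration.integral_nonneg) simp
    then show "0 \<le> 1 / 4 * K + 3 / 4 * P" by (simp add: K_def)
  qed
  moreover have "F * (7 / 8) \<le> F * Fm" using Fm F0 by (intro mult_left_mono) auto
  \<comment> \<open>From 7/8 * F <= K / 4 + 3/4 * (F + 2). The term 3/4 * F may be absorbed on the
    left because the truncation to \<open>A\<close> makes \<open>F\<close> a genuine finite
    integral.\<close>
  ultimately have "F \<le> 2 * K + 12" using PF by linarith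
  moreover have "1 \<le> K" by (simp add: K_def)
  ultimately have "F \<le> 14 * K" by linarith
  then show ?thesis by (simp add: F_def e_def A_def K_def)
qed

end
end

subsection \<open>Tails\<close>

text \<open>This and the next remainder estimate carry the factor 1 + exp u, which serves both signs
  of \<open>u\<close> and reappears in \<open>weight\<close> with u = - r.\<close>

lemma abs_exp_minus_1_le: "\<bar>exp u - 1\<bar> \<le> \<bar>u\<bar> * (1 + exp u)" for u :: real
proof -
  have "1 + - u \<le> exp (- u)" by (rule exp_ge_add_one_self)
  then have "exp u * (1 + - u) \<le> exp u * exp (- u)" by (rule mult_left_mono) simp
  then have 1: "exp u - 1 \<le> u * exp u" by (simp add: exp_add[symmetric] algebra_simps)
  have 2: "1 + u \<le> exp u" by (rule exp_ge_add_one_self)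
  show ?thesis
  proof (cases "u \<ge> 0")
    case True
    then show ?thesis using 1 2 by (simp add: algebra_simps)
  next
    case False
    then have "exp u \<le> 1" "0 \<le> - u * exp u" by (auto simp: mult_nonpos_nonneg)
    moreover have "\<bar>u\<bar> * (1 + exp u) = - u + - u * exp u" using False by (simp add: algebra_simps)
    ultimately show ?thesis using False 2 by linarith
  qed
qed

lemma abs_exp_minus_1_minus_le: "\<bar>exp u - 1 - u\<bar> \<le> u\<^sup>2 * (1 + exp u)" for u :: real
proof -
  have "1 + - u \<le> exp (- u)" by (rule exp_ge_add_one_self)
  then have "exp u * (1 + - u) \<le> exp u * exp (- u)" by (rule mult_left_mono) simp
  then have "exp u - 1 - u \<le> u * (exp u - 1)" by (simp add: exp_add[symmetric] algebra_simps)
  also have "\<dots> \<le> \<bar>u\<bar> * \<bar>exp u - 1\<bar>" by (simp flip: abs_mult)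
  also have "\<dots> \<le> \<bar>u\<bar> * (\<bar>u\<bar> * (1 + exp u))" by (intro mult_left_mono abs_exp_minus_1_le) simp
  also have "\<dots> = u\<^sup>2 * (1 + exp u)" by (simp add: power2_eq_square)
  finally have "exp u - 1 - u \<le> u\<^sup>2 * (1 + exp u)" .
  moreover have "0 \<le> exp u - 1 - u" using exp_ge_add_one_self[of u] by linarith
  ultimately show ?thesis by (simp only: abs_of_nonneg)
qed

text \<open>80 is 5 * 16, from the fifth power against an exponent divided by 16; the 2 absorbs exp
  (1 / 16).\<close>

lemma one_plus_power5_le_exp: "(1 + u) ^ 5 \<le> 2 * 80 ^ 5 * exp (u / 16)" if "u \<ge> 0" for u :: real
proof -
  have "((1 + u) / 16) ^ 5 \<le> real 5 ^ 5 * exp ((1 + u) / 16)" by (rule power_le_exp) (use that in auto)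
  then have "(1 + u) ^ 5 \<le> 80 ^ 5 * exp ((1 + u) / 16)" by (simp add: power_divide)
  also have "exp ((1 + u) / 16) = exp (1 / 16) * exp (u / 16)" by (simp add: exp_add[symmetric] add_divide_distrib)
  also have "exp (1 / 16) \<le> (2::real)"
    using real_exp_bound_lemma[of "1/16"] by simp
  finally show ?thesis by (simp add: mult_ac)
qed

context pos_def_form begin

lemma q_uminus [simp]: "q (\<lambda>i. - x i) = q x"
  using q_scale[of "-1" x] by simp

lemma bil_uminus [simp]: "bil h (\<lambda>i. - x i) = - bil h x"
  using bil_lincomb_right[of h "-1" x 0 x] by simp

lemma integral_G_odd:
  fixes f :: "point \<Rightarrow> real"
  assumes "f \<in> borel_measurable (lborel_dim d)" "\<And>x. f (\<lambda>i\<in>{..<d}. - x i) = - f x"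
  shows "(\<integral>x. f x \<partial>G) = 0"
  using integral_G_reflect[OF assms(1)] unfolding assms(2) by simp

lemma bil_sq_le: "q h = 1 \<Longrightarrow> (bil h x)\<^sup>2 \<le> q x"
  using bil_Cauchy_Schwarz[of h x] by simp

definition qball :: "real \<Rightarrow> point set" where
  "qball s = {x. q x \<le> s\<^sup>2 * d}"

lemma measurable_indicator_qball [measurable]: "(\<lambda>x. indicator (qball s) x :: real) \<in> borel_measurable (lborel_dim d)"
  unfolding qball_def by measurable

text \<open>Outside the region q / 8 <= q / 4 - s^2 * d / 8, and the moment at 1/4 costs sqrt 2 ^ d
  <= exp (d / 2). For s >= 4 and c0 <= 1 the rate s^2 - 4 still beats c0 * s.\<close>

lemma gaussian_tail:
  assumes s: "s \<ge> 4" and c0: "c0 \<le> 1"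
  shows "integrable G (\<lambda>x. (1 - indicator (qball s) x) * (1 + q x))"
    and "(\<integral>x. (1 - indicator (qball s) x) * (1 + q x) \<partial>G) \<le> 8 * exp (- c0 * s * d / 8)"
proof -
  let ?f = "\<lambda>x. (1 - indicator (qball s) x) * (1 + q x)"
  let ?g = "\<lambda>x. 8 * exp (- s\<^sup>2 * d / 8) * exp (1 / 4 * q x)"
  have ig: "integrable G ?g" using integrable_G_exp_q[of "1/4"] by simp
  have le: "?f x \<le> ?g x" for x
  proof (cases "x \<in> qball s")
    case False
    have "1 + q x \<le> 8 * exp (q x / 8)" using exp_ge_add_one_self[of "q x / 8"] q_nonneg[of x] by linarith
    also have "exp (q x / 8) \<le> exp (- s\<^sup>2 * d / 8 + 1 / 4 * q x)" using False by (simp add: qball_def)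
    also have "exp (- s\<^sup>2 * d / 8 + 1 / 4 * q x) = exp (- s\<^sup>2 * d / 8) * exp (1 / 4 * q x)" by (rule exp_add)
    finally show ?thesis using False by simp
  qed simp
  have f0: "0 \<le> ?f x" for x by (auto simp: indicator_def)
  show i: "integrable G ?f"
  proof (rule Bochner_Integration.integrable_bound[OF ig])
    show "AE x in G. norm (?f x) \<le> norm (?g x)" using le f0 by (intro AE_I2) (simp only: real_norm_def abs_of_nonneg, simp)
  qed measurable
  have "(\<integral>x. ?f x \<partial>G) \<le> (\<integral>x. ?g x \<partial>G)" by (rule integral_mono[OF i ig le])
  also have "\<dots> = 8 * exp (- s\<^sup>2 * d / 8) * sqrt 2 ^ d"
    using integral_G_exp_q[of "1/4"] by (simp add: real_sqrt_divide)
  also have "sqrt 2 ^ d \<le> exp (d / 2)"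
  proof -
    have "sqrt 2 \<le> exp (1 / 2)"
    proof (rule power2_le_imp_le)
      show "(sqrt 2)\<^sup>2 \<le> (exp (1 / 2 :: real))\<^sup>2"
        using exp_ge_add_one_self[of 1] by (simp add: exp_of_nat_mult[symmetric] power2_eq_square exp_add[symmetric])
    qed simp
    then have "sqrt 2 ^ d \<le> exp (1 / 2) ^ d" by (intro power_mono) auto
    then show ?thesis by (simp flip: exp_of_nat_mult)
  qed
  also have "8 * exp (- s\<^sup>2 * d / 8) * exp (d / 2) = 8 * exp (- s\<^sup>2 * d / 8 + d / 2)" by (simp only: exp_add mult.assoc)
  also have "\<dots> \<le> 8 * exp (- c0 * s * d / 8)"
  proof -
    have "c0 * s + 4 \<le> s\<^sup>2"
    proof -
      have "c0 * s \<le> 1 * s" using c0 s by (intro mult_right_mono) auto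
      moreover have "4 * s \<le> s * s" using s by (intro mult_right_mono) auto
      ultimately show ?thesis unfolding power2_eq_square using s by linarith
    qed
    then have "(c0 * s + 4) * d \<le> s\<^sup>2 * d" by (intro mult_right_mono) auto
    then show ?thesis by (simp add: algebra_simps)
  qed
  finally show "(\<integral>x. ?f x \<partial>G) \<le> 8 * exp (- c0 * s * d / 8)" by simp
qed

lemma dyadic_shell:
  fixes \<rho> s :: real
  assumes "0 < s" "s \<le> \<rho>"
  obtains k :: nat where "2 ^ k * s \<le> \<rho>" "\<rho> \<le> 2 ^ Suc k * s"
proof -
  obtain n where "\<rho> / s < 2 ^ n" using real_arch_pow[of 2 "\<rho> / s"] by auto
  then have ex: "\<exists>n. \<rho> \<le> 2 ^ Suc n * s" using assms by (intro exI[of _ n]) (simp add: field_simps)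
  define k where "k = (LEAST n. \<rho> \<le> 2 ^ Suc n * s)"
  have "\<rho> \<le> 2 ^ Suc k * s" unfolding k_def by (rule LeastI_ex[OF ex])
  moreover have "2 ^ k * s \<le> \<rho>"
  proof (cases k)
    case (Suc m)
    then have "\<not> \<rho> \<le> 2 ^ Suc m * s" using not_less_Least[of m "\<lambda>n. \<rho> \<le> 2 ^ Suc n * s"] by (simp add: k_def)
    then show ?thesis using Suc by simp
  qed (use assms in simp)
  ultimately show ?thesis using that by blast
qed

text \<open>On the shell 2 ^ k * s <= sqrt (q x / d) <= 2 ^ (k + 1) * s the exponential is frozen at
  the inner radius, and the indicator is dominated by exp (d / 2) times a Gaussian of width 2 ^ (k +
  1) * s, whose integral follows from scaling. This takes the place of polar coordinates.\<close>

lemma exponential_tail: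
  assumes a: "a > 0" "a / sqrt d < c0" "c0 \<le> 1" and s: "s \<ge> 8 / c0 * ln (2 * exp 1 / c0)"
  shows "integrable (lborel_dim d) (\<lambda>x. (1 - indicator (qball s) x) * ((1 + q x) * exp (- c0 * sqrt d * sqrt (q x))))"
      (is "integrable _ ?f")
    and "(\<integral>x. (1 - indicator (qball s) x) * ((1 + q x) * exp (- c0 * sqrt d * sqrt (q x))) \<partial>lborel_dim d) / Z
      \<le> 65 * (1 + 1 / a\<^sup>2) * exp (- c0 * s * d / 8)"
proof -
  have d: "real d \<ge> 1" using d_ge_1 by simp
  have "0 < a / sqrt d" using a d by simp
  then have c0: "c0 > 0" using a by linarith
  have c0d: "a\<^sup>2 \<le> c0\<^sup>2 * d"
  proof -
    have "a \<le> c0 * sqrt d" using a d by (simp add: field_simps)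
    then have "a\<^sup>2 \<le> (c0 * sqrt d)\<^sup>2" using a by (intro power_mono) auto
    then show ?thesis by (simp add: power_mult_distrib)
  qed
  define L where "L = ln (2 * exp 1 / c0)"
  have expL: "exp L = 2 * exp 1 / c0" unfolding L_def using c0 by simp
  have L1: "L \<ge> 1"
  proof -
    have "exp 1 \<le> 2 * exp 1 / c0" using c0 a(3) by (simp add: field_simps)
    then show ?thesis unfolding L_def using c0 by (simp add: ln_ge_iff)
  qed
  have sL: "c0 * s / 8 \<ge> L" using s c0 unfolding L_def[symmetric] by (simp add: field_simps)
  have s0: "s > 0"
  proof (rule ccontr)
    assume "\<not> s > 0"
    then have "c0 * s \<le> 0" using c0 by (simp add: mult_le_0_iff)
    then show False using sL L1 by simp
  qed
  define \<theta> where "\<theta> = exp (- c0 * s * d / 8)"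
  define C where "C = 65 * (1 + 1 / a\<^sup>2)"
  have C0: "C > 0" using a by (simp add: C_def add_pos_nonneg)
  \<comment> \<open>Frozen exponential times the Gaussian substitute for the indicator of shell
    \<open>k\<close>.\<close>
  define T where "T k x = exp (- (5 * c0 / 8) * d * (2 ^ k * s)) * exp (d / 2) * exp (- (1 / (2 ^ Suc k * s))\<^sup>2 * q x / 2)"
    for k :: nat and x
  have T0: "0 \<le> T k x" for k x by (simp add: T_def)
  have T_meas [measurable]: "T k \<in> borel_measurable (lborel_dim d)" for k unfolding T_def by measurable
  have T_int: "(\<integral>\<^sup>+x. ennreal (T k x) \<partial>lborel_dim d) \<le> ennreal (Z * (1 / 2) ^ Suc k)" for k
  proof -
    define t where "t = 2 ^ k * s"
    have t: "t > 0" using s0 by (simp add: t_def)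
    have cc: "1 / (2 ^ Suc k * s) > 0" using s0 by simp
    have "(\<integral>\<^sup>+x. ennreal (T k x) \<partial>lborel_dim d) = ennreal (\<integral>x. T k x \<partial>lborel_dim d)"
      by (rule nn_integral_eq_integral) (use integrable_exp_q_scaled[OF cc] T0 in \<open>simp_all add: T_def\<close>)
    also have "(\<integral>x. T k x \<partial>lborel_dim d) = exp (- (5 * c0 / 8) * d * t) * exp (d / 2) * (Z / (1 / (2 ^ Suc k * s)) ^ d)"
      unfolding T_def t_def[symmetric] using integral_exp_q_scaled[OF cc] by simp
    also have "\<dots> = Z * (exp (- (5 * c0 / 8) * t) * exp (1 / 2) * (2 * t)) ^ d"
    proof -
      have "exp (- (5 * c0 / 8) * d * t) = exp (- (5 * c0 / 8) * t) ^ d" by (simp add: exp_of_nat_mult[symmetric] mult_ac)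
      moreover have "exp (d / 2) = exp (1 / 2 :: real) ^ d" by (simp add: exp_of_nat_mult[symmetric])
      moreover have "Z / (1 / (2 ^ Suc k * s)) ^ d = Z * (2 * t) ^ d"
      proof -
        have "2 ^ Suc k * s = 2 * t" by (simp add: t_def)
        then show ?thesis by (simp only: power_one_over) simp
      qed
      ultimately show ?thesis by (simp only: power_mult_distrib mult_ac)
    qed
    also have "\<dots> \<le> Z * (1 / 2) ^ Suc k"
    proof (rule mult_left_mono)
      \<comment> \<open>In terms of \<open>w\<close> the base of the power is 16 * exp (1 / 2) / c0
        * w * exp (- 5 * w). One factor exp (- w) is at most c0 / (2 * exp 1), by the logarithm in
        the lower bound for \<open>s\<close>, and cancels 1 / c0; another one absorbs
        \<open>w\<close>; the remaining three decay geometrically because w >= k + 1.\<close>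
      define w where "w = c0 * t / 8"
      have wL: "w \<ge> 2 ^ k * L"
      proof -
        have "2 ^ k * L \<le> 2 ^ k * (c0 * s / 8)" using sL by (intro mult_left_mono) auto
        then show ?thesis by (simp add: w_def t_def mult_ac)
      qed
      have "real (Suc k) \<le> 2 ^ k" by (induction k) auto
      also have "2 ^ k \<le> 2 ^ k * L" using L1 by simp
      finally have wk: "w \<ge> Suc k" using wL by linarith
      have "1 * L \<le> 2 ^ k * L" using L1 by (intro mult_right_mono) auto
      then have "exp (- w) \<le> exp (- L)" using wL by simp
      also have "\<dots> = c0 / (2 * exp 1)" by (simp add: exp_minus expL)
      finally have ew: "exp (- w) \<le> c0 / (2 * exp 1)" .
      have w2: "2 * w \<le> exp w"
      proof -
        have "1 + w + w\<^sup>2 / 2 \<le> exp w" by (rule exp_lower_Taylor_quadratic) (use wk in linarith)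
        moreover have "2 * w \<le> 1 + w + w\<^sup>2 / 2" using zero_le_power2[of "w - 1"] by (simp add: power2_eq_square algebra_simps)
        ultimately show ?thesis by linarith
      qed
      have "exp (- (5 * c0 / 8) * t) * exp (1 / 2) * (2 * t) = (16 * exp (1 / 2) / c0) * (w * exp (- (5 * w)))"
        using c0 by (simp add: w_def field_simps)
      also have "w * exp (- (5 * w)) = (w * exp (- (4 * w))) * exp (- w)" by (simp add: exp_add[symmetric])
      also have "(16 * exp (1 / 2) / c0) * (w * exp (- (4 * w)) * exp (- w)) \<le> (16 * exp (1 / 2) / c0) * (exp (- (3 * w)) / 2 * exp (- w))"
      proof (intro mult_left_mono mult_right_mono)
        have "w * exp (- (4 * w)) \<le> (exp w / 2) * exp (- (4 * w))" using w2 by (intro mult_right_mono) auto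
        also have "\<dots> = exp (- (3 * w)) / 2" by (simp add: exp_add[symmetric])
        finally show "w * exp (- (4 * w)) \<le> exp (- (3 * w)) / 2" .
      qed (use c0 in auto)
      also have "\<dots> \<le> (16 * exp (1 / 2) / c0) * (exp (- (3 * w)) / 2 * (c0 / (2 * exp 1)))"
        using c0 ew by (intro mult_left_mono) auto
      also have "\<dots> = 4 * (exp (1 / 2) / exp 1) * exp (- (3 * w))" using c0 by (simp add: field_simps)
      also have "\<dots> \<le> 4 * 1 * exp (- (3 * w))" by (intro mult_right_mono mult_left_mono) auto
      also have "\<dots> \<le> 4 * exp (- (3 * real (Suc k)))" using wk by simp
      also have "exp (- (3 * real (Suc k))) = (1 / exp 3) ^ Suc k"
      proof -
        have "exp (3 * real (Suc k)) = exp 3 ^ Suc k"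
          using exp_of_nat_mult[of "Suc k" "3::real"] by (simp only: mult.commute)
        then show ?thesis by (simp only: exp_minus power_one_over inverse_eq_divide)
      qed
      also have "(1 / exp 3) ^ Suc k \<le> (1 / 8 :: real) ^ Suc k"
      proof (rule power_mono)
        have "(2::real) ^ 3 \<le> exp 1 ^ 3" by (intro power_mono) (use exp_ge_add_one_self[of 1] in auto)
        then have "(8::real) \<le> exp 3" by (simp flip: exp_of_nat_mult)
        then show "1 / exp 3 \<le> (1 / 8 :: real)" by (simp add: field_simps)
      qed simp
      also have "4 * (1 / 8 :: real) ^ Suc k = (1 / 2) ^ Suc k * (1 / 4) ^ k"
        by (simp add: power_mult_distrib[symmetric])
      also have "\<dots> \<le> (1 / 2) ^ Suc k * 1" by (intro mult_left_mono power_le_one) auto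
      finally have base: "exp (- (5 * c0 / 8) * t) * exp (1 / 2) * (2 * t) \<le> (1 / 2) ^ Suc k" by simp
      have "(exp (- (5 * c0 / 8) * t) * exp (1 / 2) * (2 * t)) ^ d \<le> ((1 / 2) ^ Suc k) ^ d"
        by (rule power_mono[OF base]) (use t in simp)
      also have "\<dots> \<le> ((1 / 2) ^ Suc k) ^ 1"
        by (rule power_decreasing[OF d_ge_1]) (simp, rule power_le_one, simp_all)
      finally show "(exp (- (5 * c0 / 8) * t) * exp (1 / 2) * (2 * t)) ^ d \<le> (1 / 2) ^ Suc k" by simp
    qed (use Z_pos in simp)
    finally show ?thesis by (simp add: ennreal_leI)
  qed
  have f0: "0 \<le> ?f x" for x by (auto simp: indicator_def)
  have f_meas: "?f \<in> borel_measurable (lborel_dim d)" by measurable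
  have pw: "ennreal (?f x) \<le> ennreal (C * \<theta>) * (\<Sum>k. ennreal (T k x))" for x
  proof (cases "x \<in> qball s")
    case False
    define \<rho> where "\<rho> = sqrt (q x) / sqrt d"
    have qx: "q x = \<rho>\<^sup>2 * d" "sqrt (q x) = \<rho> * sqrt d" using d by (simp_all add: \<rho>_def power_divide)
    have \<rho>0: "\<rho> \<ge> 0" by (simp add: \<rho>_def)
    have "s\<^sup>2 * d < \<rho>\<^sup>2 * d" using False qx by (simp add: qball_def)
    then have "s\<^sup>2 < \<rho>\<^sup>2" using d by simp
    then have s\<rho>: "s \<le> \<rho>" using \<rho>0 by (meson less_imp_le power_less_imp_less_base)
    obtain k where k: "2 ^ k * s \<le> \<rho>" "\<rho> \<le> 2 ^ Suc k * s" by (rule dyadic_shell[OF s0 s\<rho>])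
    define X where "X = c0 * d * \<rho>"
    have X: "c0 * sqrt d * sqrt (q x) = X" unfolding X_def qx(2) by simp
    have X0: "X \<ge> 0" using c0 \<rho>0 by (simp add: X_def)
    \<comment> \<open>The lower bound on \<open>c0\<close> enters here: a^2 * q x <= X^2, whence the
      1 / a^2 in the constant.\<close>
    have "1 + q x \<le> C * exp (X / 4)"
    proof -
      have "a\<^sup>2 * q x \<le> (c0\<^sup>2 * d) * q x" using c0d by (rule mult_right_mono) simp
      also have "\<dots> = X\<^sup>2" by (simp add: X_def qx power2_eq_square)
      also have "X\<^sup>2 \<le> 64 * exp (X / 4)" using power_le_exp[of "X / 4" 2] X0 by (simp add: power_divide)
      finally have "q x \<le> 64 * exp (X / 4) / a\<^sup>2" using a by (simp add: field_simps)
      moreover have "1 \<le> exp (X / 4)" using X0 by simp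
      moreover have "C * exp (X / 4) = 65 * exp (X / 4) + 65 * exp (X / 4) / a\<^sup>2" by (simp add: C_def algebra_simps)
      moreover have "64 * exp (X / 4) / a\<^sup>2 \<le> 65 * exp (X / 4) / a\<^sup>2" by (intro divide_right_mono) auto
      ultimately show ?thesis by linarith
    qed
    then have "(1 + q x) * exp (- X) \<le> C * exp (X / 4) * exp (- X)" by (rule mult_right_mono) simp
    \<comment> \<open>The exponent \<open>X\<close> is spent in three parts: 1/4 on the polynomial
      factor, 1/8 on the claimed decay, 5/8 on the growing volume of the shells.\<close>
    also have "\<dots> = C * (exp (- X / 8) * exp (- (5 * X / 8)))"
      unfolding mult.assoc exp_add[symmetric] by simp
    also have "\<dots> \<le> C * (\<theta> * T k x)"
    proof (intro mult_left_mono mult_mono)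
      show "exp (- X / 8) \<le> \<theta>"       proof -
        have "s * (c0 * d) \<le> \<rho> * (c0 * d)" using s\<rho> c0 by (intro mult_right_mono) auto
        then show ?thesis unfolding \<theta>_def X_def by (simp add: mult_ac)
      qed
      have "exp (- (5 * X / 8)) \<le> exp (- (5 * c0 / 8) * d * (2 ^ k * s))"
      proof -
        have "(5 * c0 / 8) * d * (2 ^ k * s) \<le> (5 * c0 / 8) * d * \<rho>" using k c0 by (intro mult_left_mono) auto
        then show ?thesis by (simp add: X_def)
      qed
      moreover have "1 \<le> exp (d / 2) * exp (- (1 / (2 ^ Suc k * s))\<^sup>2 * q x / 2)"
      proof -
        have "\<rho>\<^sup>2 \<le> (2 ^ Suc k * s)\<^sup>2" using k \<rho>0 by (intro power_mono) auto
        then have "(1 / (2 ^ Suc k * s))\<^sup>2 * \<rho>\<^sup>2 \<le> 1" using s0 by (simp add: power_divide field_simps)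
        then have "(1 / (2 ^ Suc k * s))\<^sup>2 * \<rho>\<^sup>2 * d \<le> 1 * real d" by (rule mult_right_mono) simp
        then have "0 \<le> d / 2 + - (1 / (2 ^ Suc k * s))\<^sup>2 * q x / 2" by (simp add: qx mult.assoc)
        then show ?thesis by (simp only: exp_add[symmetric] one_le_exp_iff)
      qed
      ultimately have "exp (- (5 * X / 8)) * 1 \<le> exp (- (5 * c0 / 8) * d * (2 ^ k * s)) * (exp (d / 2) * exp (- (1 / (2 ^ Suc k * s))\<^sup>2 * q x / 2))"
        by (intro mult_mono) auto
      then show "exp (- (5 * X / 8)) \<le> T k x" unfolding T_def by (simp only: mult.assoc mult_1_right)
    qed (use C0 in \<open>auto simp: \<theta>_def\<close>)
    finally have "?f x \<le> C * \<theta> * T k x" using False X by (simp add: mult.assoc)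
    then have "ennreal (?f x) \<le> ennreal (C * \<theta>) * ennreal (T k x)"
      using C0 T0[of k x] by (subst ennreal_mult[symmetric]) (auto simp: \<theta>_def intro!: ennreal_leI)
    also have "\<dots> \<le> ennreal (C * \<theta>) * (\<Sum>k. ennreal (T k x))"
      using sum_le_suminf[of "\<lambda>k. ennreal (T k x)" "{k}"] by (intro mult_left_mono) auto
    finally show ?thesis .
  qed simp
  have "(\<integral>\<^sup>+x. ennreal (?f x) \<partial>lborel_dim d) \<le> (\<integral>\<^sup>+x. ennreal (C * \<theta>) * (\<Sum>k. ennreal (T k x)) \<partial>lborel_dim d)"
    by (rule nn_integral_mono) (rule pw)
  also have "\<dots> = ennreal (C * \<theta>) * (\<integral>\<^sup>+x. (\<Sum>k. ennreal (T k x)) \<partial>lborel_dim d)"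
    by (rule nn_integral_cmult) measurable
  also have "(\<integral>\<^sup>+x. (\<Sum>k. ennreal (T k x)) \<partial>lborel_dim d) = (\<Sum>k. \<integral>\<^sup>+x. ennreal (T k x) \<partial>lborel_dim d)"
    by (rule nn_integral_suminf) measurable
  also have "\<dots> \<le> (\<Sum>k. ennreal (Z * (1 / 2) ^ Suc k))"
    by (intro suminf_le T_int) auto
  also have "\<dots> = ennreal Z"
  proof -
    have "(\<lambda>k. Z * (1 / 2) ^ Suc k) sums (Z * 1)" by (intro sums_mult power_half_series)
    then show ?thesis using Z_pos by (subst suminf_ennreal2) (auto simp: sums_iff)
  qed
  finally have fin: "(\<integral>\<^sup>+x. ennreal (?f x) \<partial>lborel_dim d) \<le> ennreal (C * \<theta> * Z)"
    using C0 Z_pos by (simp add: ennreal_mult \<theta>_def mult_left_mono)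
  show i: "integrable (lborel_dim d) ?f"
  proof (rule integrableI_bounded[OF f_meas])
    have "(\<integral>\<^sup>+x. ennreal (norm (?f x)) \<partial>lborel_dim d) = (\<integral>\<^sup>+x. ennreal (?f x) \<partial>lborel_dim d)"
      using f0 by (simp only: real_norm_def abs_of_nonneg)
    then show "(\<integral>\<^sup>+x. ennreal (norm (?f x)) \<partial>lborel_dim d) < \<infinity>"
      using fin by (simp add: le_less_trans[OF _ ennreal_less_top])
  qed
  have "ennreal (\<integral>x. ?f x \<partial>lborel_dim d) \<le> ennreal (C * \<theta> * Z)"
    using fin nn_integral_eq_integral[OF i] f0 by simp
  then have "(\<integral>x. ?f x \<partial>lborel_dim d) \<le> C * \<theta> * Z"
    by (rule iffD1[OF ennreal_le_iff, rotated]) (use C0 Z_pos in \<open>simp add: \<theta>_def\<close>)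
  then show "(\<integral>x. ?f x \<partial>lborel_dim d) / Z \<le> 65 * (1 + 1 / a\<^sup>2) * exp (- c0 * s * d / 8)"
    using Z_pos by (simp add: C_def \<theta>_def divide_le_eq)
qed

end

subsection \<open>Perturbed Gaussian densities\<close>

text \<open>The first summand integrates \<open>central_weight_le\<close>: the two linear
  exponentials give 1024 = 2 * 512 times exp (1 / 2), the cubic ones 56 = 2 * (14 + 14) times the
  bound of \<open>cubic_concentration\<close> at 2 * (1 + N). The second summand is the constant of
  \<open>outer_weight_le\<close>.\<close>

definition conc_const :: "real \<Rightarrow> real" where
  "conc_const N = 40 * (257 + 242 * N\<^sup>2) * exp (11 * N\<^sup>2)
      * (2 + 1024 * exp (1 / 2) + 56 * exp (331776 * (2 * (1 + N))\<^sup>2)) + 12 * 80 ^ 5 * (1 + N)\<^sup>2"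

text \<open>With u = q x / d <= 16 the quartic remainder is bounded, and everything except the
  factor in \<open>l\<close> is at most a constant times exp ((1 + N) * |g|). The inequality x * y
  <= x^2 + y^2 then separates \<open>l\<close> from \<open>g\<close>, so the marginal exponential
  moments suffice; the squaring doubles 1 + N.\<close>

lemma central_weight_le:
  fixes l g v \<epsilon> N u :: real
  assumes N: "0 \<le> \<epsilon>" "\<epsilon> \<le> N" and v: "\<bar>v\<bar> \<le> \<epsilon>\<^sup>2 * u\<^sup>2 / 24" and u: "0 \<le> u" "u \<le> 16"
    and Q: "\<bar>Q\<bar> \<le> \<bar>g\<bar> + \<epsilon> * u\<^sup>2 / 24"
  shows "(1 + l\<^sup>2) * (1 + Q\<^sup>2 + u\<^sup>2) * (1 + exp (- (\<epsilon> * g + v)))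
    \<le> 40 * (257 + 242 * N\<^sup>2) * exp (11 * N\<^sup>2) * (2 + 512 * (exp l + exp (- l))
        + 2 * (exp (2 * (1 + N) * g) + exp (2 * (1 + N) * (- g))))"
proof -
  have N0: "0 \<le> N" using N by linarith
  have u2: "u\<^sup>2 \<le> 256" using u power_mono[of u 16 2] by simp
  have \<epsilon>2: "\<epsilon>\<^sup>2 \<le> N\<^sup>2" using N by (intro power_mono) auto
  have "\<epsilon>\<^sup>2 * u\<^sup>2 \<le> N\<^sup>2 * 256" using \<epsilon>2 u2 by (intro mult_mono) auto
  \<comment> \<open>256 / 24 < 11.\<close>
  then have v11: "\<bar>v\<bar> \<le> 11 * N\<^sup>2" using v zero_le_power2[of N] by linarith
  have "\<epsilon> * u\<^sup>2 \<le> N * 256" using N u2 by (intro mult_mono) auto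
  then have "\<bar>Q\<bar> \<le> \<bar>g\<bar> + 11 * N" using Q N0 by linarith
  then have "\<bar>Q\<bar>\<^sup>2 \<le> (\<bar>g\<bar> + 11 * N)\<^sup>2" by (intro power_mono) auto
  also have "\<dots> \<le> 2 * g\<^sup>2 + 242 * N\<^sup>2"
    using sum_squares_bound[of "\<bar>g\<bar>" "11 * N"] by (simp add: power2_sum power_mult_distrib)
  finally have Q2: "Q\<^sup>2 \<le> 2 * g\<^sup>2 + 242 * N\<^sup>2" by simp
  define c where "c = exp ((1 + N) * g) + exp ((1 + N) * (- g))"
  have c_abs: "exp ((1 + N) * \<bar>g\<bar>) \<le> c" unfolding c_def by (simp add: abs_if)
  have A: "1 + Q\<^sup>2 + u\<^sup>2 \<le> (257 + 242 * N\<^sup>2) * (1 + g\<^sup>2)"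
  proof -
    have "1 + Q\<^sup>2 + u\<^sup>2 \<le> 257 + 242 * N\<^sup>2 + 2 * g\<^sup>2" using Q2 u2 by linarith
    also have "\<dots> \<le> (257 + 242 * N\<^sup>2) + (257 + 242 * N\<^sup>2) * g\<^sup>2"
      by (intro add_left_mono mult_right_mono) auto
    finally show ?thesis by (simp add: algebra_simps)
  qed
  have g2: "1 + g\<^sup>2 \<le> 5 * exp \<bar>g\<bar>"
  proof -
    have "g\<^sup>2 \<le> 4 * exp \<bar>g\<bar>" using power_le_exp[of "\<bar>g\<bar>" 2] by simp
    moreover have "1 \<le> exp \<bar>g\<bar>" by simp
    ultimately show ?thesis by linarith
  qed
  have E: "1 + exp (- (\<epsilon> * g + v)) \<le> 2 * exp (11 * N\<^sup>2) * exp (N * \<bar>g\<bar>)"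
  proof -
    have "- (\<epsilon> * g) \<le> \<epsilon> * \<bar>g\<bar>" using N by (simp add: abs_if mult_nonneg_nonpos2)
    also have "\<dots> \<le> N * \<bar>g\<bar>" using N by (intro mult_right_mono) auto
    finally have "- (\<epsilon> * g + v) \<le> 11 * N\<^sup>2 + N * \<bar>g\<bar>" using v11 by linarith
    then have 1: "exp (- (\<epsilon> * g + v)) \<le> exp (11 * N\<^sup>2 + N * \<bar>g\<bar>)" by simp
    have "1 \<le> exp (11 * N\<^sup>2 + N * \<bar>g\<bar>)" using N0 by simp
    with 1 have "1 + exp (- (\<epsilon> * g + v)) \<le> 2 * exp (11 * N\<^sup>2 + N * \<bar>g\<bar>)" by linarith
    then show ?thesis by (simp only: exp_add mult.assoc)
  qed
  have "(1 + Q\<^sup>2 + u\<^sup>2) * (1 + exp (- (\<epsilon> * g + v)))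
      \<le> ((257 + 242 * N\<^sup>2) * (5 * exp \<bar>g\<bar>)) * (2 * exp (11 * N\<^sup>2) * exp (N * \<bar>g\<bar>))"
  proof (rule mult_mono[OF _ E])
    have "(257 + 242 * N\<^sup>2) * (1 + g\<^sup>2) \<le> (257 + 242 * N\<^sup>2) * (5 * exp \<bar>g\<bar>)"
      using g2 by (intro mult_left_mono) auto
    with A show "1 + Q\<^sup>2 + u\<^sup>2 \<le> (257 + 242 * N\<^sup>2) * (5 * exp \<bar>g\<bar>)" by linarith
  qed (auto intro!: add_nonneg_nonneg mult_nonneg_nonneg)
  also have "\<dots> = 10 * (257 + 242 * N\<^sup>2) * exp (11 * N\<^sup>2) * exp ((1 + N) * \<bar>g\<bar>)"
    by (simp add: exp_add distrib_right)
  also have "\<dots> \<le> 10 * (257 + 242 * N\<^sup>2) * exp (11 * N\<^sup>2) * c"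
    by (rule mult_left_mono[OF c_abs]) auto
  finally have B: "(1 + Q\<^sup>2 + u\<^sup>2) * (1 + exp (- (\<epsilon> * g + v))) \<le> 10 * (257 + 242 * N\<^sup>2) * exp (11 * N\<^sup>2) * c" .
  have "(1 + l\<^sup>2) * c \<le> (1 + l\<^sup>2)\<^sup>2 + c\<^sup>2"
    using sum_squares_bound[of "1 + l\<^sup>2" c] zero_le_power2[of "1 + l\<^sup>2"] zero_le_power2[of c] by linarith
  moreover have "(1 + l\<^sup>2)\<^sup>2 \<le> 2 + 512 * (exp l + exp (- l))"
  proof -
    have "(1 + l\<^sup>2)\<^sup>2 \<le> 2 + 2 * l ^ 4"
      using sum_squares_bound[of 1 "l\<^sup>2"] by (simp add: power2_sum power_mult[symmetric])
    moreover have "l ^ 4 \<le> 256 * (exp l + exp (- l))" using even_power_le_exp[of 4 l] by simp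
    ultimately show ?thesis by linarith
  qed
  moreover have "c\<^sup>2 \<le> 2 * (exp (2 * (1 + N) * g) + exp (2 * (1 + N) * (- g)))"
  proof -
    have "c\<^sup>2 \<le> 2 * ((exp ((1 + N) * g))\<^sup>2 + (exp ((1 + N) * (- g)))\<^sup>2)"
      unfolding c_def using sum_squares_bound[of "exp ((1 + N) * g)" "exp ((1 + N) * (- g))"] by (simp add: power2_sum)
    also have "(exp ((1 + N) * g))\<^sup>2 = exp (2 * (1 + N) * g)" by (simp add: power2_eq_square exp_add[symmetric])
    also have "(exp ((1 + N) * (- g)))\<^sup>2 = exp (2 * (1 + N) * (- g))" by (simp add: power2_eq_square exp_add[symmetric])
    finally show ?thesis .
  qed
  ultimately have D: "(1 + l\<^sup>2) * c \<le> 2 + 512 * (exp l + exp (- l)) + 2 * (exp (2 * (1 + N) * g) + exp (2 * (1 + N) * (- g)))"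
    by linarith
  define R where "R = 2 + 512 * (exp l + exp (- l)) + 2 * (exp (2 * (1 + N) * g) + exp (2 * (1 + N) * (- g)))"
  define k where "k = (257 + 242 * N\<^sup>2) * exp (11 * N\<^sup>2)"
  have k0: "0 \<le> k" by (simp add: k_def)
  have R0: "0 \<le> R" unfolding R_def by (intro add_nonneg_nonneg mult_nonneg_nonneg) auto
  have "(1 + l\<^sup>2) * (1 + Q\<^sup>2 + u\<^sup>2) * (1 + exp (- (\<epsilon> * g + v))) \<le> (1 + l\<^sup>2) * (10 * k * c)"
    using B unfolding mult.assoc k_def by (intro mult_left_mono) auto
  also have "\<dots> = 10 * k * ((1 + l\<^sup>2) * c)" by simp
  also have "\<dots> \<le> 10 * k * R" using D k0 unfolding R_def[symmetric] by (intro mult_left_mono) auto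
  also have "\<dots> \<le> 40 * k * R" using k0 R0 by (intro mult_right_mono) auto
  finally show ?thesis unfolding k_def R_def by (simp only: mult.assoc)
qed

text \<open>Here p = q x and D = d. The arithmetic-geometric mean inequality applied to (\<epsilon>
  * p / D) * (sqrt p / 6) bounds the cubic term by \<epsilon>^2 * s ^ 4 / 2 + p / 72. The first part
  is the origin of \<open>E_factor\<close>; the second, together with the polynomial factors, fits
  into exp (p / 8), which is integrable over the shell.\<close>

lemma outer_weight_le:
  fixes l p \<epsilon> N s v D Q g :: real
  assumes N: "0 \<le> \<epsilon>" "\<epsilon> \<le> N" and D: "1 \<le> D" and p: "0 \<le> p" "p / D \<le> s\<^sup>2" and l: "l\<^sup>2 \<le> p"
    and g: "\<bar>g\<bar> \<le> p * sqrt p / (6 * D)" and v: "\<bar>v\<bar> \<le> \<epsilon>\<^sup>2 * (p / D)\<^sup>2 / 24"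
    and Q: "\<bar>Q\<bar> \<le> \<bar>g\<bar> + \<epsilon> * (p / D)\<^sup>2 / 24"
  shows "(1 + l\<^sup>2) * (1 + Q\<^sup>2 + (p / D)\<^sup>2) * (1 + exp (- (\<epsilon> * g + v)))
      \<le> 12 * 80 ^ 5 * (1 + N)\<^sup>2 * exp (\<epsilon>\<^sup>2 * s ^ 4) * exp (p / 8)"
proof -
  have pD: "0 \<le> p / D" "p / D \<le> p" using D p by (auto simp: divide_le_eq mult_le_cancel_left1)
  have s4: "(p / D)\<^sup>2 \<le> s ^ 4"
    using power_mono[OF p(2) pD(1), of 2] by (simp add: power_mult[symmetric])
  have N0: "0 \<le> N" using N by linarith
  have r: "\<bar>\<epsilon> * g + v\<bar> \<le> \<epsilon>\<^sup>2 * s ^ 4 + p / 72"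
  proof -
    have "\<bar>\<epsilon> * g\<bar> = \<epsilon> * \<bar>g\<bar>" using N by (simp add: abs_mult)
    also have "\<dots> \<le> \<epsilon> * (p * sqrt p / (6 * D))" by (rule mult_left_mono[OF g N(1)])
    also have "\<dots> = (\<epsilon> * (p / D)) * (sqrt p / 6)" by simp
    also have "\<dots> \<le> (\<epsilon> * (p / D))\<^sup>2 / 2 + (sqrt p / 6)\<^sup>2 / 2"
      using sum_squares_bound[of "\<epsilon> * (p / D)" "sqrt p / 6"] by simp
    also have "\<dots> = \<epsilon>\<^sup>2 * (p / D)\<^sup>2 / 2 + p / 72" using p by (simp add: power_mult_distrib power_divide)
    finally have "\<bar>\<epsilon> * g + v\<bar> \<le> \<epsilon>\<^sup>2 * (p / D)\<^sup>2 / 2 + \<epsilon>\<^sup>2 * (p / D)\<^sup>2 / 24 + p / 72"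
      using v by linarith
    moreover have "\<epsilon>\<^sup>2 * (p / D)\<^sup>2 \<le> \<epsilon>\<^sup>2 * s ^ 4" by (rule mult_left_mono[OF s4]) simp
    moreover have "0 \<le> \<epsilon>\<^sup>2 * (p / D)\<^sup>2" by simp
    ultimately show ?thesis by linarith
  qed
  have E: "1 + exp (- (\<epsilon> * g + v)) \<le> 2 * exp (\<epsilon>\<^sup>2 * s ^ 4) * exp (p / 72)"
  proof -
    have "- (\<epsilon> * g + v) \<le> \<epsilon>\<^sup>2 * s ^ 4 + p / 72" using r by linarith
    then have "exp (- (\<epsilon> * g + v)) \<le> exp (\<epsilon>\<^sup>2 * s ^ 4 + p / 72)" by simp
    moreover have "0 \<le> \<epsilon>\<^sup>2 * s ^ 4 + p / 72" using p by simp
    then have "1 \<le> exp (\<epsilon>\<^sup>2 * s ^ 4 + p / 72)" by simp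
    ultimately have "1 + exp (- (\<epsilon> * g + v)) \<le> 2 * exp (\<epsilon>\<^sup>2 * s ^ 4 + p / 72)" by linarith
    then show ?thesis by (simp only: exp_add mult.assoc)
  qed
  have Q1: "\<bar>Q\<bar> \<le> (1 + N) * (1 + p)\<^sup>2"
  proof -
    have "sqrt p \<le> 1 + p" using p by (intro real_le_lsqrt) (auto simp: power2_eq_square algebra_simps)
    then have 1: "p * sqrt p \<le> (1 + p) * (1 + p)" using p by (intro mult_mono) auto
    have "p * sqrt p / (6 * D) \<le> p * sqrt p / 1" using D p by (intro divide_left_mono) auto
    then have 2: "\<bar>g\<bar> \<le> (1 + p)\<^sup>2" using g 1 by (simp add: power2_eq_square)
    have "(p / D)\<^sup>2 \<le> (1 + p)\<^sup>2" using pD p by (intro power_mono) auto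
    then have "\<epsilon> * (p / D)\<^sup>2 \<le> N * (1 + p)\<^sup>2" using N N0 by (intro mult_mono) auto
    moreover have "0 \<le> N * (1 + p)\<^sup>2" using N0 by simp
    ultimately have "\<bar>Q\<bar> \<le> (1 + p)\<^sup>2 + N * (1 + p)\<^sup>2" using 2 Q by linarith
    then show ?thesis by (simp add: distrib_right)
  qed
  have W: "1 + Q\<^sup>2 + (p / D)\<^sup>2 \<le> 3 * (1 + N)\<^sup>2 * (1 + p) ^ 4"
  proof -
    have "\<bar>Q\<bar>\<^sup>2 \<le> ((1 + N) * (1 + p)\<^sup>2)\<^sup>2" using Q1 by (intro power_mono) auto
    then have a: "Q\<^sup>2 \<le> (1 + N)\<^sup>2 * (1 + p) ^ 4" by (simp add: power_mult_distrib power_mult[symmetric])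
    have b: "1 \<le> (1 + N)\<^sup>2 * (1 + p) ^ 4"
      using mult_mono[of 1 "(1 + N)\<^sup>2" 1 "(1 + p) ^ 4"] N0 p by (simp add: one_le_power)
    have "(p / D)\<^sup>2 \<le> (1 + p)\<^sup>2" using pD p by (intro power_mono) auto
    also have "\<dots> \<le> (1 + p) ^ 4" using p by (intro power_increasing) auto
    also have "\<dots> \<le> (1 + N)\<^sup>2 * (1 + p) ^ 4"
      using mult_right_mono[of 1 "(1 + N)\<^sup>2" "(1 + p) ^ 4"] N0 p by (simp add: one_le_power)
    finally show ?thesis using a b by linarith
  qed
  have "(1 + l\<^sup>2) * (1 + Q\<^sup>2 + (p / D)\<^sup>2) * (1 + exp (- (\<epsilon> * g + v)))
     \<le> (1 + p) * (3 * (1 + N)\<^sup>2 * (1 + p) ^ 4) * (2 * exp (\<epsilon>\<^sup>2 * s ^ 4) * exp (p / 72))"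
    using W E l p by (intro mult_mono) (auto intro!: add_nonneg_nonneg mult_nonneg_nonneg)
  also have "\<dots> = 6 * (1 + N)\<^sup>2 * exp (\<epsilon>\<^sup>2 * s ^ 4) * ((1 + p) ^ 5 * exp (p / 72))"
    by (simp add: power_numeral_reduce mult_ac)
  also have "\<dots> \<le> 6 * (1 + N)\<^sup>2 * exp (\<epsilon>\<^sup>2 * s ^ 4) * (2 * 80 ^ 5 * exp (p / 8))"
  proof (rule mult_left_mono)
    \<comment> \<open>The polynomial costs p / 16, and 1/16 + 1/72 <= 1/8.\<close>
    have "(1 + p) ^ 5 * exp (p / 72) \<le> 2 * 80 ^ 5 * exp (p / 16) * exp (p / 72)"
      by (rule mult_right_mono[OF one_plus_power5_le_exp[OF p(1)]]) simp
    also have "\<dots> = 2 * 80 ^ 5 * exp (p / 16 + p / 72)" by (simp only: exp_add mult.assoc)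
    also have "\<dots> \<le> 2 * 80 ^ 5 * exp (p / 8)" using p by simp
    finally show "(1 + p) ^ 5 * exp (p / 72) \<le> 2 * 80 ^ 5 * exp (p / 8)" .
  qed simp
  finally show ?thesis by (simp add: mult_ac)
qed

text \<open>The 6 and the 24 are Taylor's factorials. \<open>N\<close> is an upper bound for
  \<epsilon> and the only quantity on which the local constants depend.\<close>

locale laplace_expansion = pos_def_form +
  fixes c :: "nat \<Rightarrow> nat \<Rightarrow> nat \<Rightarrow> real" and r4 :: "point \<Rightarrow> real" and e3 e4 s N :: real
  assumes e3: "0 \<le> e3" "\<And>x. \<bar>cubic d c x\<bar> \<le> e3 * (q x * sqrt (q x)) / (6 * real d)"
    and e4: "0 \<le> e4" "\<And>x. \<bar>r4 x\<bar> \<le> e4\<^sup>2 * (q x / d)\<^sup>2 / 24"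
    and r4_meas [measurable]: "r4 \<in> borel_measurable (lborel_dim d)"
    and s4: "4 \<le> s" and N: "sqrt (e3\<^sup>2 + e4\<^sup>2) \<le> N"
begin

text \<open>
  Dividing \<open>r\<close> by \<open>\<epsilon>\<close> keeps the remainders linear and quadratic in \<open>\<epsilon>\<close>. If \<open>\<epsilon> = 0\<close>, then \<open>r = 0\<close> and the
  junk quotient \<open>0\<close> is the right one.
\<close>

definition \<epsilon> where "\<epsilon> = sqrt (e3\<^sup>2 + e4\<^sup>2)"
definition g where "g = cubic d (\<lambda>i j k. c i j k / \<epsilon>)"
definition r where "r x = cubic d c x + r4 x"
definition Q where "Q x = r x / \<epsilon>"
text \<open>A common majorant: the first factor serves the test functions 1, \<open>bil h\<close>
  and (bil h)^2 - 1, the other two serve the Taylor remainders of exp (- r) after division by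
  \<epsilon> or \<epsilon>^2.\<close>

definition weight where "weight h x = (1 + (bil h x)\<^sup>2) * (1 + (Q x)\<^sup>2 + (q x / d)\<^sup>2) * (1 + exp (- r x))"

lemma eps: "0 \<le> \<epsilon>" "\<epsilon> \<le> N" "e3 \<le> \<epsilon>" "e4 \<le> \<epsilon>" "\<epsilon>\<^sup>2 = e3\<^sup>2 + e4\<^sup>2"
  using e3(1) e4(1) N by (auto simp: \<epsilon>_def real_le_rsqrt)

lemma d_pos: "real d \<ge> 1" using d_ge_1 by simp

lemma r_meas [measurable]: "r \<in> borel_measurable (lborel_dim d)"
  unfolding r_def by measurable

lemma weight_meas [measurable]: "weight h \<in> borel_measurable (lborel_dim d)"
  unfolding weight_def Q_def by measurable

lemma weight_nonneg: "0 \<le> weight h x"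
  unfolding weight_def by (intro mult_nonneg_nonneg add_nonneg_nonneg) auto

lemma cubic_eq: "cubic d c x = \<epsilon> * g x"
proof (cases "\<epsilon> = 0")
  case True
  then have "e3 = 0" using eps e3(1) by simp
  then show ?thesis using e3(2)[of x] True by simp
next
  case False
  then show ?thesis unfolding g_def cubic_def by (simp add: sum_distrib_left)
qed

lemma g_eq: "g x = cubic d c x / \<epsilon>"
  unfolding g_def cubic_def by (simp add: sum_divide_distrib)

lemma g_le: "\<bar>g x\<bar> \<le> q x * sqrt (q x) / (6 * real d)"
proof (cases "\<epsilon> = 0")
  case True
  then show ?thesis by (simp add: g_eq)
next
  case False
  then have e: "\<epsilon> > 0" using eps by simp
  have "\<bar>cubic d c x\<bar> \<le> e3 * (q x * sqrt (q x)) / (6 * real d)" by (rule e3)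
  also have "\<dots> \<le> \<epsilon> * (q x * sqrt (q x)) / (6 * real d)"
    using eps by (intro divide_right_mono mult_right_mono) auto
  finally show ?thesis using e by (simp add: g_eq field_simps)
qed

lemma r4_le: "\<bar>r4 x\<bar> \<le> \<epsilon>\<^sup>2 * (q x / d)\<^sup>2 / 24"
proof -
  have "e4\<^sup>2 * (q x / d)\<^sup>2 / 24 \<le> \<epsilon>\<^sup>2 * (q x / d)\<^sup>2 / 24"
    using eps e4(1) by (intro divide_right_mono mult_right_mono) auto
  with e4(2)[of x] show ?thesis by linarith
qed

lemma r_eq: "r x = \<epsilon> * g x + r4 x" "r x = \<epsilon> * Q x"
proof -
  show 1: "r x = \<epsilon> * g x + r4 x" by (simp add: r_def cubic_eq)
  show "r x = \<epsilon> * Q x"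
    using 1 r4_le[of x] by (cases "\<epsilon> = 0") (auto simp: Q_def)
qed

lemma Q_le: "\<bar>Q x\<bar> \<le> \<bar>g x\<bar> + \<epsilon> * (q x / d)\<^sup>2 / 24"
proof (cases "\<epsilon> = 0")
  case False
  then have e: "\<epsilon> > 0" using eps by simp
  have "Q x = g x + r4 x / \<epsilon>" using e by (simp add: Q_def r_eq(1) field_simps)
  moreover have "\<bar>r4 x / \<epsilon>\<bar> \<le> \<epsilon> * (q x / d)\<^sup>2 / 24"
    using r4_le[of x] e by (simp add: abs_divide field_simps power2_eq_square)
  ultimately show ?thesis by linarith
qed (simp add: Q_def)

text \<open>\<open>g\<close> obeys the bound with t = 1 / (6 * d) whatever the value of \<epsilon>,
  so its moments are bounded by absolute constants; - g is again a cubic form.\<close>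

lemma concentration_g:
  assumes "L \<ge> 0"
  shows "integrable G (\<lambda>x. indicator {x. q x \<le> 16 * d} x * exp (L * g x))" (is ?A)
    and "(\<integral>x. indicator {x. q x \<le> 16 * d} x * exp (L * g x) \<partial>G) \<le> 14 * exp (331776 * L\<^sup>2)" (is ?B)
    and "integrable G (\<lambda>x. indicator {x. q x \<le> 16 * d} x * exp (L * (- g x)))" (is ?C)
    and "(\<integral>x. indicator {x. q x \<le> 16 * d} x * exp (L * (- g x)) \<partial>G) \<le> 14 * exp (331776 * L\<^sup>2)" (is ?D)
proof -
  define t where "t = 1 / (6 * real d)"
  have t: "t \<ge> 0" "t * d \<le> 1" using d_pos by (auto simp: t_def)
  have 1: "\<bar>cubic d (\<lambda>i j k. c i j k / \<epsilon>) x\<bar> \<le> t * (q x * sqrt (q x))" for x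
    using g_le[of x] by (simp add: g_def t_def)
  have neg: "cubic d (\<lambda>i j k. - (c i j k / \<epsilon>)) x = - g x" for x
    unfolding g_def cubic_def by (simp add: sum_negf)
  have 2: "\<bar>cubic d (\<lambda>i j k. - (c i j k / \<epsilon>)) x\<bar> \<le> t * (q x * sqrt (q x))" for x
    using g_le[of x] by (simp add: neg t_def)
  show ?A unfolding g_def by (rule integrable_ball_exp_cubic[OF 1 t])
  show ?B unfolding g_def by (rule cubic_concentration[OF 1 t assms])
  show ?C using integrable_ball_exp_cubic[OF 2 t] unfolding neg .
  show ?D using cubic_concentration[OF 2 t assms] unfolding neg .
qed

lemma qball_sub: "q x \<le> 16 * d \<Longrightarrow> x \<in> qball s"
proof -
  assume "q x \<le> 16 * d"
  moreover have "16 * real d \<le> s\<^sup>2 * d"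
    using power_mono[OF s4, of 2] by (intro mult_right_mono) auto
  ultimately show ?thesis by (simp add: qball_def)
qed

text \<open>The two pointwise bounds are integrated over the ball q <= 16 * d, which lies in the
  local region since s >= 4, and over the rest of the region. Only the latter part produces the
  factor exp (\<epsilon>^2 * s ^ 4).\<close>

lemma weight_bound:
  assumes h: "q h = 1"
  shows "integrable G (\<lambda>x. indicator (qball s) x * weight h x)"
    and "(\<integral>x. indicator (qball s) x * weight h x \<partial>G) \<le> conc_const N * exp (\<epsilon>\<^sup>2 * s ^ 4)"
proof -
  have N0: "N \<ge> 0" using eps by linarith
  define L where "L = 2 * (1 + N)"
  have L0: "L \<ge> 0" using N0 by (simp add: L_def)
  define A where "A = {x. q x \<le> 16 * d}"
  define B where "B = {x. q x \<ge> 16 * d}"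
  define k1 where "k1 = 40 * (257 + 242 * N\<^sup>2) * exp (11 * N\<^sup>2)"
  define k2 where "k2 = 12 * 80 ^ 5 * (1 + N)\<^sup>2 * exp (\<epsilon>\<^sup>2 * s ^ 4)"
  have k0: "0 \<le> k1" "0 \<le> k2" by (auto simp: k1_def k2_def)
  define m where "m x = k1 * (2 + 512 * (exp (bil h x) + exp (bil (\<lambda>i. - h i) x))
      + 2 * (indicator A x * exp (L * g x) + indicator A x * exp (L * (- g x))))
      + k2 * (indicator B x * exp (q x / 8))" for x
  note conc = concentration_g[OF L0, folded A_def]
  note shell = shell_integrable[folded B_def] shell_bound[folded B_def]
  have mi: "integrable G m" unfolding m_def
    by (intro Bochner_Integration.integrable_add integrable_mult_right conc shell integrable_G_exp_bil integrable_const)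
  have qm: "q (\<lambda>i. - h i) = 1" using h by simp
  have bm: "bil (\<lambda>i. - h i) x = - bil h x" for x using bil_lincomb[of "-1" h 0 h x] by simp
  have "(\<integral>x. m x \<partial>G) = k1 * (2 + 512 * (exp (1 / 2) + exp (1 / 2))
      + 2 * ((\<integral>x. indicator A x * exp (L * g x) \<partial>G) + (\<integral>x. indicator A x * exp (L * (- g x)) \<partial>G)))
      + k2 * (\<integral>x. indicator B x * exp (q x / 8) \<partial>G)"
    unfolding m_def using conc(1,3) shell integrable_G_exp_bil[of h] integrable_G_exp_bil[of "\<lambda>i. - h i"]
    by (simp add: integral_G_exp_bil h)
  also have "\<dots> \<le> k1 * (2 + 512 * (exp (1 / 2) + exp (1 / 2)) + 2 * (14 * exp (331776 * L\<^sup>2) + 14 * exp (331776 * L\<^sup>2))) + k2 * 1"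
    using conc(2,4) shell(2) k0 by (intro add_mono mult_left_mono order_refl) auto
  also have "\<dots> = k1 * (2 + 1024 * exp (1 / 2) + 56 * exp (331776 * L\<^sup>2)) * 1 + k2" by simp
  also have "\<dots> \<le> k1 * (2 + 1024 * exp (1 / 2) + 56 * exp (331776 * L\<^sup>2)) * exp (\<epsilon>\<^sup>2 * s ^ 4) + k2"
    using k0 by (intro add_right_mono mult_left_mono mult_nonneg_nonneg add_nonneg_nonneg) auto
  also have "\<dots> = conc_const N * exp (\<epsilon>\<^sup>2 * s ^ 4)"
    by (simp add: conc_const_def k1_def k2_def L_def distrib_right)
  finally have mI: "(\<integral>x. m x \<partial>G) \<le> conc_const N * exp (\<epsilon>\<^sup>2 * s ^ 4)" .
  have le: "indicator (qball s) x * weight h x \<le> m x" for x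
  proof (cases "x \<in> A")
    case True
    have qd: "0 \<le> q x / d" "q x / d \<le> 16" using True d_pos by (auto simp: A_def field_simps)
    have "weight h x \<le> k1 * (2 + 512 * (exp (bil h x) + exp (- bil h x)) + 2 * (exp (L * g x) + exp (L * (- g x))))"
      unfolding weight_def r_eq(1) k1_def L_def
      by (rule central_weight_le[OF eps(1,2) r4_le qd Q_le])
    also have "\<dots> \<le> m x" using True k0 by (auto simp: m_def bm indicator_def)
    finally have "weight h x \<le> m x" .
    then show ?thesis using True qball_sub[of x] by (simp add: A_def)
  next
    case False
    then have B: "x \<in> B" by (simp add: A_def B_def)
    show ?thesis
    proof (cases "x \<in> qball s")
      case True
      have "q x / d \<le> s\<^sup>2" using True d_pos by (simp add: qball_def field_simps)
      then have "weight h x \<le> k2 * exp (q x / 8)"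
        unfolding weight_def r_eq(1) k2_def
        by (intro outer_weight_le[OF eps(1,2) d_pos q_nonneg _ bil_sq_le[OF h] g_le r4_le Q_le])
      also have "\<dots> \<le> m x"
      proof -
        have "0 \<le> 2 + 512 * (exp (bil h x) + exp (bil (\<lambda>i. - h i) x))" by (intro add_nonneg_nonneg mult_nonneg_nonneg) auto
        then show ?thesis using False B k0 by (simp add: m_def)
      qed
      finally show ?thesis using True by simp
    next
      case out: False
      have "0 \<le> m x" unfolding m_def using k0 by (intro add_nonneg_nonneg mult_nonneg_nonneg) auto
      then show ?thesis using out by simp
    qed
  qed
  show i: "integrable G (\<lambda>x. indicator (qball s) x * weight h x)"
  proof (rule Bochner_Integration.integrable_bound[OF mi])
    show "(\<lambda>x. indicator (qball s) x * weight h x) \<in> borel_measurable G" by measurable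
    show "AE x in G. norm (indicator (qball s) x * weight h x) \<le> norm (m x)"
    proof (rule AE_I2)
      fix x
      have "norm (indicator (qball s) x * weight h x) = indicator (qball s) x * weight h x"
        using weight_nonneg by simp
      also have "\<dots> \<le> norm (m x)" using le[of x] by simp
      finally show "norm (indicator (qball s) x * weight h x) \<le> norm (m x)" .
    qed
  qed
  have "(\<integral>x. indicator (qball s) x * weight h x \<partial>G) \<le> (\<integral>x. m x \<partial>G)"
    by (rule integral_mono[OF i mi le])
  with mI show "(\<integral>x. indicator (qball s) x * weight h x \<partial>G) \<le> conc_const N * exp (\<epsilon>\<^sup>2 * s ^ 4)" by linarith
qed

end

text \<open>\<kappa> is the lower bound on the normalisation from \<open>local_den\<close>,
  \<open>C\<close> belongs to the local integrals and \<open>T\<close> to the tail; the value is the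
  factor in \<open>variance_ratio_le\<close>.\<close>

definition laplace_const :: "real \<Rightarrow> real \<Rightarrow> real" where
  "laplace_const N a = (let \<kappa> = 7 / 8 * exp (- 11 * N\<^sup>2); C = conc_const N; T = 65 * (1 + 1 / a\<^sup>2)
     in (8 + T + C) / \<kappa> + 2 * (C\<^sup>2 + T\<^sup>2) / \<kappa>\<^sup>2)"

lemma conc_const_nonneg: "0 \<le> conc_const N"
  unfolding conc_const_def by (intro add_nonneg_nonneg mult_nonneg_nonneg) auto

lemma laplace_const_pos: "a > 0 \<Longrightarrow> 0 < laplace_const N a"
  unfolding laplace_const_def Let_def using conc_const_nonneg[of N]
  by (intro add_pos_nonneg divide_pos_pos divide_nonneg_pos add_pos_nonneg mult_pos_pos mult_nonneg_nonneg) auto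

text \<open>\<open>n1\<close> is already quadratic in \<epsilon> and carries one \<open>E\<close>.
  The mean \<open>n0\<close> is linear in \<epsilon>, so its square has the right order in
  \<epsilon> but carries E^2. The square of \<theta> is at most \<theta>.\<close>

lemma variance_ratio_le:
  fixes D n1 n0 \<kappa> C T E \<epsilon> \<theta> :: real
  assumes D: "0 < \<kappa>" "\<kappa> \<le> D" and C: "0 \<le> C" "0 \<le> T" and E: "1 \<le> E" and \<theta>: "0 \<le> \<theta>" "\<theta> \<le> 1" and e: "0 \<le> \<epsilon>"
    and n1: "\<bar>n1\<bar> \<le> 8 * \<theta> + \<epsilon>\<^sup>2 * (C * E) + T * \<theta>" and n0: "\<bar>n0\<bar> \<le> \<epsilon> * (C * E) + T * \<theta>"
  shows "\<bar>n1 / D - (n0 / D)\<^sup>2\<bar> \<le> ((8 + T + C) / \<kappa> + 2 * (C\<^sup>2 + T\<^sup>2) / \<kappa>\<^sup>2) * (E\<^sup>2 * \<epsilon>\<^sup>2 + \<theta>)"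
proof -
  define X where "X = E\<^sup>2 * \<epsilon>\<^sup>2 + \<theta>"
  have E2: "E \<le> E\<^sup>2" using E by (simp add: power2_eq_square)
  have X: "\<epsilon>\<^sup>2 * E \<le> X" "\<theta> \<le> X" "E\<^sup>2 * \<epsilon>\<^sup>2 \<le> X"
    using \<theta> mult_left_mono[OF E2, of "\<epsilon>\<^sup>2"] by (auto simp: X_def mult.commute)
  have X0: "0 \<le> X" using X(2) \<theta> by linarith
  have "\<bar>n1\<bar> \<le> (8 + T) * \<theta> + C * (\<epsilon>\<^sup>2 * E)" using n1 by (simp add: algebra_simps)
  also have "\<dots> \<le> (8 + T) * X + C * X" using X C by (intro add_mono mult_left_mono) auto
  finally have n1': "\<bar>n1\<bar> \<le> (8 + T + C) * X" by (simp add: algebra_simps)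
  have "\<bar>n1 / D\<bar> = \<bar>n1\<bar> / D" using D by simp
  also have "\<dots> \<le> (8 + T + C) * X / \<kappa>" using n1' D C X0 by (intro frac_le) auto
  finally have A: "\<bar>n1 / D\<bar> \<le> (8 + T + C) / \<kappa> * X" by simp
  have "n0\<^sup>2 \<le> (\<epsilon> * (C * E) + T * \<theta>)\<^sup>2" using n0 by (simp add: abs_le_square_iff[symmetric])
  also have "\<dots> \<le> 2 * (\<epsilon> * (C * E))\<^sup>2 + 2 * (T * \<theta>)\<^sup>2"
    using sum_squares_bound[of "\<epsilon> * (C * E)" "T * \<theta>"] by (simp add: power2_sum)
  also have "\<dots> = 2 * C\<^sup>2 * (E\<^sup>2 * \<epsilon>\<^sup>2) + 2 * T\<^sup>2 * \<theta>\<^sup>2" by (simp add: power_mult_distrib)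
  also have "\<dots> \<le> 2 * C\<^sup>2 * X + 2 * T\<^sup>2 * X"
  proof -
    have "\<theta>\<^sup>2 \<le> X" using \<theta> X(2) mult_right_mono[of \<theta> 1 \<theta>] by (simp add: power2_eq_square)
    then show ?thesis using X(3) by (intro add_mono mult_left_mono) auto
  qed
  finally have n0': "n0\<^sup>2 \<le> 2 * (C\<^sup>2 + T\<^sup>2) * X" by (simp add: algebra_simps)
  have "(n0 / D)\<^sup>2 = n0\<^sup>2 / D\<^sup>2" by (simp add: power_divide)
  also have "\<dots> \<le> 2 * (C\<^sup>2 + T\<^sup>2) * X / \<kappa>\<^sup>2" using n0' D X0 by (intro frac_le power_mono) auto
  finally have B: "(n0 / D)\<^sup>2 \<le> 2 * (C\<^sup>2 + T\<^sup>2) / \<kappa>\<^sup>2 * X" by simp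
  have "0 \<le> (n0 / D)\<^sup>2" by simp
  then have "\<bar>n1 / D - (n0 / D)\<^sup>2\<bar> \<le> (8 + T + C) / \<kappa> * X + 2 * (C\<^sup>2 + T\<^sup>2) / \<kappa>\<^sup>2 * X"
    using A B by linarith
  then show ?thesis by (simp add: X_def distrib_right)
qed

section \<open>Moments of the density cut off to the local region\<close>

context laplace_expansion begin

text \<open>The unnormalised density of the localised target with respect to
  \<open>G\<close>.\<close>

definition \<rho> where "\<rho> x = indicator (qball s) x * exp (- r x)"

lemma rho_meas [measurable]: "\<rho> \<in> borel_measurable (lborel_dim d)"
  unfolding \<rho>_def by measurable

lemma rho_nonneg: "0 \<le> \<rho> x" by (simp add: \<rho>_def)

lemma weight_ge:
  assumes "\<bar>f\<bar> \<le> 1 + (bil h x)\<^sup>2" "\<bar>y\<bar> \<le> (1 + (Q x)\<^sup>2 + (q x / d)\<^sup>2) * (1 + exp (- r x))"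
  shows "\<bar>f * y\<bar> \<le> weight h x"
  unfolding weight_def abs_mult mult.assoc using assms by (intro mult_mono) auto

lemma abs_le_one_plus_sq: "\<bar>u\<bar> \<le> 1 + u\<^sup>2" for u :: real
  using zero_le_power2[of "\<bar>u\<bar> - 1 / 2"] by (simp add: power2_eq_square algebra_simps)

lemma rho_weight:
  assumes "\<bar>f\<bar> \<le> 1 + (bil h x)\<^sup>2"
  shows "\<bar>f * \<rho> x\<bar> \<le> indicator (qball s) x * weight h x"
proof (cases "x \<in> qball s")
  case True
  have "1 * exp (- r x) \<le> (1 + (Q x)\<^sup>2 + (q x / d)\<^sup>2) * (1 + exp (- r x))"
    by (intro mult_mono) auto
  then have "\<bar>f * exp (- r x)\<bar> \<le> weight h x"
    by (intro weight_ge[OF assms]) simp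
  then show ?thesis using True by (simp add: \<rho>_def)
qed (simp add: \<rho>_def)

lemma integrable_weight_bound:
  fixes f :: "point \<Rightarrow> real"
  assumes h: "q h = 1" and f: "f \<in> borel_measurable (lborel_dim d)"
    and le: "\<And>x. \<bar>f x\<bar> \<le> K * (indicator (qball s) x * weight h x)"
  shows "integrable G f" "\<bar>\<integral>x. f x \<partial>G\<bar> \<le> K * (\<integral>x. indicator (qball s) x * weight h x \<partial>G)"
proof -
  have i: "integrable G (\<lambda>x. K * (indicator (qball s) x * weight h x))"
    using weight_bound(1)[OF h] by simp
  show fi: "integrable G f"
  proof (rule Bochner_Integration.integrable_bound[OF i])
    show "f \<in> borel_measurable G" using f by simp
    show "AE x in G. norm (f x) \<le> norm (K * (indicator (qball s) x * weight h x))"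
    proof (rule AE_I2)
      fix x
      show "norm (f x) \<le> norm (K * (indicator (qball s) x * weight h x))"
        using le[of x] unfolding real_norm_def by linarith
    qed
  qed
  have "\<bar>\<integral>x. f x \<partial>G\<bar> \<le> (\<integral>x. \<bar>f x\<bar> \<partial>G)" by (rule integral_abs_bound)
  also have "\<dots> \<le> (\<integral>x. K * (indicator (qball s) x * weight h x) \<partial>G)"
    using fi by (intro integral_mono i le) auto
  finally show "\<bar>\<integral>x. f x \<partial>G\<bar> \<le> K * (\<integral>x. indicator (qball s) x * weight h x \<partial>G)" by simp
qed

lemma g_odd: "g (\<lambda>i. - x i) = - g x"
  unfolding g_def by (rule cubic_uminus)

lemma g_restrict [simp]: "g (restrict x {..<d}) = g x"
  unfolding g_def by (rule cubic_restrict)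

lemma g_meas [measurable]: "g \<in> borel_measurable (lborel_dim d)"
  unfolding g_def by measurable

lemma qball_reflect [simp]: "indicator (qball s) (\<lambda>i\<in>{..<d}. - x i) = indicator (qball s) x"
proof -
  have "q (\<lambda>i\<in>{..<d}. - x i) = q x" by (simp only: bil_restrict q_uminus)
  then show ?thesis by (simp add: indicator_def qball_def del: bil_restrict)
qed

text \<open>On the central ball |r4| <= 11 * N^2 and exp (- \<epsilon> * g) >= 1 - \<epsilon> * g,
  whose linear term has integral 0. This gives a lower bound uniform in \<open>d\<close> and
  \<open>s\<close>.\<close>

lemma local_den:
  assumes h: "q h = 1"
  shows "integrable G \<rho>" and "7 / 8 * exp (- 11 * N\<^sup>2) \<le> (\<integral>x. \<rho> x \<partial>G)"
proof -
  have "\<bar>1 * \<rho> x\<bar> \<le> indicator (qball s) x * weight h x" for x by (rule rho_weight) simp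
  then show i: "integrable G \<rho>" by (intro integrable_weight_bound(1)[OF h, of _ 1]) auto
  define A where "A = {x. q x \<le> 16 * d}"
  define t where "t = 1 / (6 * real d)"
  have t: "t \<ge> 0" "t * d \<le> 1" using d_pos by (auto simp: t_def)
  have 1: "\<bar>cubic d (\<lambda>i j k. c i j k / \<epsilon>) x\<bar> \<le> t * (q x * sqrt (q x))" for x
    using g_le[of x] by (simp add: g_def t_def)
  have g0: "(\<integral>x. indicator A x * g x \<partial>G) = 0" "integrable G (\<lambda>x. indicator A x * g x)"
    using integral_ball_cubic[OF 1 t, of "16 * d"] integrable_ball_cubic[OF 1 t, of "16 * d"]
    by (simp_all add: g_def A_def)
  have iA: "integrable G (\<lambda>x. indicat_real A x)"
    using concentration_g(1)[of 0] by (simp add: A_def)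
  define \<kappa> where "\<kappa> = exp (- 11 * N\<^sup>2)"
  have "7 / 8 * \<kappa> \<le> \<kappa> * ((\<integral>x. indicat_real A x \<partial>G) - \<epsilon> * (\<integral>x. indicator A x * g x \<partial>G))"
    using measure_ball_ge[folded A_def] g0(1) by (simp add: \<kappa>_def)
  also have "\<dots> = (\<integral>x. \<kappa> * (indicat_real A x - \<epsilon> * (indicator A x * g x)) \<partial>G)" using iA g0 by simp
  also have "\<dots> \<le> (\<integral>x. \<rho> x \<partial>G)"
  proof (rule integral_mono[OF _ i])
    show "integrable G (\<lambda>x. \<kappa> * (indicat_real A x - \<epsilon> * (indicator A x * g x)))" using iA g0 by simp
    fix x
    show "\<kappa> * (indicat_real A x - \<epsilon> * (indicator A x * g x)) \<le> \<rho> x"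
    proof (cases "x \<in> A")
      case True
      have "0 \<le> q x / d" "q x / d \<le> 16" using True d_pos by (auto simp: A_def field_simps)
      then have "(q x / d)\<^sup>2 \<le> 256" using power_mono[of "q x / d" 16 2] by simp
      then have "\<epsilon>\<^sup>2 * (q x / d)\<^sup>2 \<le> N\<^sup>2 * 256" using eps by (intro mult_mono power_mono) auto
      then have "\<bar>r4 x\<bar> \<le> 11 * N\<^sup>2" using r4_le[of x] zero_le_power2[of N] by linarith
      then have "- 11 * N\<^sup>2 + - (\<epsilon> * g x) \<le> - r x" by (simp add: r_eq(1))
      then have "\<kappa> * exp (- (\<epsilon> * g x)) \<le> exp (- r x)" unfolding \<kappa>_def exp_add[symmetric] by simp
      moreover have "\<kappa> * (1 - \<epsilon> * g x) \<le> \<kappa> * exp (- (\<epsilon> * g x))"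
        using exp_ge_add_one_self[of "- (\<epsilon> * g x)"] by (intro mult_left_mono) (auto simp: \<kappa>_def)
      ultimately show ?thesis using True qball_sub[of x] by (simp add: A_def \<rho>_def)
    qed (simp add: rho_nonneg)
  qed
  finally show "7 / 8 * exp (- 11 * N\<^sup>2) \<le> (\<integral>x. \<rho> x \<partial>G)" by (simp add: \<kappa>_def)
qed

text \<open>Replacing exp (- r) by 1 leaves the odd function \<open>bil h\<close>, which integrates
  to 0; the difference exp (- r) - 1 is of order \<epsilon>.\<close>

lemma local_mean:
  assumes h: "q h = 1"
  shows "integrable G (\<lambda>x. bil h x * \<rho> x)"
    and "\<bar>\<integral>x. bil h x * \<rho> x \<partial>G\<bar> \<le> \<epsilon> * (conc_const N * exp (\<epsilon>\<^sup>2 * s ^ 4))"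
proof -
  have "\<bar>bil h x * \<rho> x\<bar> \<le> indicator (qball s) x * weight h x" for x
    by (rule rho_weight) (rule abs_le_one_plus_sq)
  then show i: "integrable G (\<lambda>x. bil h x * \<rho> x)"
    by (intro integrable_weight_bound(1)[OF h, of _ 1]) auto
  define R where "R x = indicator (qball s) x * (bil h x * (exp (- r x) - 1))" for x
  have R_meas [measurable]: "R \<in> borel_measurable (lborel_dim d)" unfolding R_def by measurable
  have Rle: "\<bar>R x\<bar> \<le> \<epsilon> * (indicator (qball s) x * weight h x)" for x
  proof -
    have "\<bar>Q x\<bar> * (1 + exp (- r x)) \<le> (1 + (Q x)\<^sup>2 + (q x / d)\<^sup>2) * (1 + exp (- r x))"
      using abs_le_one_plus_sq[of "Q x"] zero_le_power2[of "q x / d"] by (intro mult_right_mono add_nonneg_nonneg) (linarith | simp)+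
    then have w: "\<bar>bil h x * (\<bar>Q x\<bar> * (1 + exp (- r x)))\<bar> \<le> weight h x"
      by (intro weight_ge abs_le_one_plus_sq) (simp add: abs_mult)
    have "\<bar>exp (- r x) - 1\<bar> \<le> \<bar>- r x\<bar> * (1 + exp (- r x))" by (rule abs_exp_minus_1_le)
    also have "\<dots> = \<epsilon> * (\<bar>Q x\<bar> * (1 + exp (- r x)))" using eps(1) r_eq(2)[of x] by (simp add: abs_mult)
    finally have "\<bar>bil h x * (exp (- r x) - 1)\<bar> \<le> \<bar>bil h x\<bar> * (\<epsilon> * (\<bar>Q x\<bar> * (1 + exp (- r x))))"
      unfolding abs_mult by (rule mult_left_mono) simp
    also have "\<dots> = \<epsilon> * \<bar>bil h x * (\<bar>Q x\<bar> * (1 + exp (- r x)))\<bar>" by (simp add: abs_mult)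
    also have "\<dots> \<le> \<epsilon> * weight h x" by (rule mult_left_mono[OF w eps(1)])
    finally show ?thesis by (auto simp: R_def indicator_def)
  qed
  note Ri = integrable_weight_bound[OF h R_meas Rle]
  have eq: "bil h x * \<rho> x - R x = indicator (qball s) x * bil h x" for x
    by (simp add: R_def \<rho>_def algebra_simps)
  have "(\<integral>x. bil h x * \<rho> x - R x \<partial>G) = 0"
    unfolding eq by (rule integral_G_odd) simp_all
  then have "(\<integral>x. bil h x * \<rho> x \<partial>G) = (\<integral>x. R x \<partial>G)" using i Ri(1) by simp
  then have "\<bar>\<integral>x. bil h x * \<rho> x \<partial>G\<bar> \<le> \<epsilon> * (\<integral>x. indicator (qball s) x * weight h x \<partial>G)" using Ri(2) by simp
  also have "\<dots> \<le> \<epsilon> * (conc_const N * exp (\<epsilon>\<^sup>2 * s ^ 4))"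
    by (rule mult_left_mono[OF weight_bound(2)[OF h] eps(1)])
  finally show "\<bar>\<integral>x. bil h x * \<rho> x \<partial>G\<bar> \<le> \<epsilon> * (conc_const N * exp (\<epsilon>\<^sup>2 * s ^ 4))" .
qed

text \<open>The test function is even with Gaussian mean 0. The term of order 0 is therefore minus a
  Gaussian tail, the cubic term of order 1 vanishes by oddness, and \<open>r4\<close> together with
  the second order remainder is of order \<epsilon>^2.\<close>

lemma local_second_moment:
  assumes h: "q h = 1" and c0: "c0 \<le> 1"
  shows "integrable G (\<lambda>x. ((bil h x)\<^sup>2 - 1) * \<rho> x)"
    and "\<bar>\<integral>x. ((bil h x)\<^sup>2 - 1) * \<rho> x \<partial>G\<bar>
       \<le> 8 * exp (- c0 * s * d / 8) + \<epsilon>\<^sup>2 * (conc_const N * exp (\<epsilon>\<^sup>2 * s ^ 4))"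
proof -
  define f where "f x = (bil h x)\<^sup>2 - 1" for x
  have f_meas [measurable]: "f \<in> borel_measurable (lborel_dim d)" unfolding f_def by measurable
  have f_le: "\<bar>f x\<bar> \<le> 1 + (bil h x)\<^sup>2" for x
    using zero_le_power2[of "bil h x"] unfolding f_def by linarith
  have f_odd: "f (\<lambda>i\<in>{..<d}. - x i) = f x" for x by (simp add: f_def)
  have "\<bar>f x * \<rho> x\<bar> \<le> indicator (qball s) x * weight h x" for x by (rule rho_weight) (rule f_le)
  then have i: "integrable G (\<lambda>x. f x * \<rho> x)"
    by (intro integrable_weight_bound(1)[OF h, of _ 1]) auto
  then show "integrable G (\<lambda>x. ((bil h x)\<^sup>2 - 1) * \<rho> x)" by (simp add: f_def)
  \<comment> \<open>\<open>r - r4\<close> is the cubic term; only it is removed from exp (- r) - 1,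
    since \<open>r4\<close> is quadratic in \<epsilon> and may stay in the remainder.\<close>
  define R where "R x = indicator (qball s) x * (f x * (exp (- r x) - 1 + r x - r4 x))" for x
  have R_meas [measurable]: "R \<in> borel_measurable (lborel_dim d)" unfolding R_def by measurable
  have Rle: "\<bar>R x\<bar> \<le> \<epsilon>\<^sup>2 * (indicator (qball s) x * weight h x)" for x
  proof -
    define y where "y = (Q x)\<^sup>2 * (1 + exp (- r x)) + (q x / d)\<^sup>2"
    have y0: "0 \<le> y" unfolding y_def by (intro add_nonneg_nonneg mult_nonneg_nonneg) auto
    have "y \<le> (1 + (Q x)\<^sup>2 + (q x / d)\<^sup>2) * (1 + exp (- r x))"
      unfolding y_def by (simp add: algebra_simps add_nonneg_nonneg)
    then have w: "\<bar>f x * y\<bar> \<le> weight h x" using y0 by (intro weight_ge f_le) simp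
    have "\<bar>exp (- r x) - 1 - (- r x)\<bar> \<le> (- r x)\<^sup>2 * (1 + exp (- r x))" by (rule abs_exp_minus_1_minus_le)
    also have "\<dots> = \<epsilon>\<^sup>2 * ((Q x)\<^sup>2 * (1 + exp (- r x)))" using r_eq(2)[of x] by (simp add: power_mult_distrib)
    finally have a: "\<bar>exp (- r x) - 1 + r x\<bar> \<le> \<epsilon>\<^sup>2 * ((Q x)\<^sup>2 * (1 + exp (- r x)))" by simp
    have "0 \<le> \<epsilon>\<^sup>2 * (q x / d)\<^sup>2" by simp
    then have b: "\<bar>r4 x\<bar> \<le> \<epsilon>\<^sup>2 * (q x / d)\<^sup>2" using r4_le[of x] by linarith
    have "\<bar>exp (- r x) - 1 + r x - r4 x\<bar> \<le> \<epsilon>\<^sup>2 * y"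
      using a b unfolding y_def distrib_left by linarith
    then have "\<bar>f x * (exp (- r x) - 1 + r x - r4 x)\<bar> \<le> \<bar>f x\<bar> * (\<epsilon>\<^sup>2 * y)"
      unfolding abs_mult by (rule mult_left_mono) simp
    also have "\<dots> = \<epsilon>\<^sup>2 * \<bar>f x * y\<bar>" using y0 by (simp add: abs_mult)
    also have "\<dots> \<le> \<epsilon>\<^sup>2 * weight h x" by (rule mult_left_mono[OF w]) simp
    finally show ?thesis by (auto simp: R_def indicator_def)
  qed
  note Ri = integrable_weight_bound[OF h R_meas Rle]
  define T where "T x = (1 - indicator (qball s) x) * f x" for x
  have T_meas: "T \<in> borel_measurable (lborel_dim d)" unfolding T_def by measurable
  have Tle: "\<bar>T x\<bar> \<le> (1 - indicator (qball s) x) * (1 + q x)" for x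
    using f_le[of x] bil_sq_le[OF h, of x] by (auto simp: T_def indicator_def)
  have iT: "integrable G T"
  proof (rule Bochner_Integration.integrable_bound[OF gaussian_tail(1)[OF s4 c0]])
    show "T \<in> borel_measurable G" using T_meas by simp
    show "AE x in G. norm (T x) \<le> norm ((1 - indicator (qball s) x) * (1 + q x))"
    proof (rule AE_I2)
      fix x
      show "norm (T x) \<le> norm ((1 - indicator (qball s) x) * (1 + q x))"
        using Tle[of x] unfolding real_norm_def by linarith
    qed
  qed
  have "\<bar>\<integral>x. T x \<partial>G\<bar> \<le> (\<integral>x. \<bar>T x\<bar> \<partial>G)" by (rule integral_abs_bound)
  also have "\<dots> \<le> (\<integral>x. (1 - indicator (qball s) x) * (1 + q x) \<partial>G)"
    using iT by (intro integral_mono gaussian_tail(1)[OF s4 c0] Tle) auto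
  also have "\<dots> \<le> 8 * exp (- c0 * s * d / 8)" by (rule gaussian_tail(2)[OF s4 c0])
  finally have Tb: "\<bar>\<integral>x. T x \<partial>G\<bar> \<le> 8 * exp (- c0 * s * d / 8)" .
  have fi: "integrable G f" "(\<integral>x. f x \<partial>G) = 0"
    unfolding f_def using integrable_bil_sq[of h] integral_bil_sq[of h] h by simp_all
  have eq: "f x - T x + R x - f x * \<rho> x = indicator (qball s) x * (f x * (\<epsilon> * g x))" for x
    by (simp add: R_def \<rho>_def T_def r_eq(1) algebra_simps)
  have "(\<integral>x. f x - T x + R x - f x * \<rho> x \<partial>G) = 0"
    unfolding eq
    by (rule integral_G_odd) (measurable, simp_all add: f_odd g_odd)
  then have "(\<integral>x. f x * \<rho> x \<partial>G) = (\<integral>x. R x \<partial>G) - (\<integral>x. T x \<partial>G)" using i Ri(1) iT fi by simp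
  then have "\<bar>\<integral>x. f x * \<rho> x \<partial>G\<bar> \<le> 8 * exp (- c0 * s * d / 8) + \<epsilon>\<^sup>2 * (\<integral>x. indicator (qball s) x * weight h x \<partial>G)"
    using Ri(2) Tb by linarith
  also have "\<dots> \<le> 8 * exp (- c0 * s * d / 8) + \<epsilon>\<^sup>2 * (conc_const N * exp (\<epsilon>\<^sup>2 * s ^ 4))"
    by (intro add_left_mono mult_left_mono[OF weight_bound(2)[OF h]]) simp
  finally show "\<bar>\<integral>x. ((bil h x)\<^sup>2 - 1) * \<rho> x \<partial>G\<bar>
       \<le> 8 * exp (- c0 * s * d / 8) + \<epsilon>\<^sup>2 * (conc_const N * exp (\<epsilon>\<^sup>2 * s ^ 4))" by (simp add: f_def)
qed

section \<open>Moments of the full density, tails included\<close>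

context
  fixes p :: "point \<Rightarrow> real" and a c0 :: real
  assumes p_meas [measurable]: "p \<in> borel_measurable (lborel_dim d)"
    and p_in: "\<And>x. x \<in> space (lborel_dim d) \<Longrightarrow> x \<in> qball s \<Longrightarrow> p x = exp (- q x / 2 - r x)"
    and p_out: "\<And>x. x \<in> space (lborel_dim d) \<Longrightarrow> x \<notin> qball s \<Longrightarrow> 0 \<le> p x \<and> p x \<le> exp (- c0 * sqrt d * sqrt (q x))"
    and a: "a > 0" "a / sqrt d < c0" "c0 \<le> 1" and s_ge: "s \<ge> 8 / c0 * ln (2 * exp 1 / c0)"
begin

text \<open>The part outside the local region costs one \<open>exponential_tail\<close>. The
  one-sided last claim is meant for \<open>f = 1\<close>: a nonnegative tail can only increase the
  normalising constant, so its lower bound holds however large the tail is.\<close>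

lemma split_integral:
  fixes f :: "point \<Rightarrow> real"
  assumes f [measurable]: "f \<in> borel_measurable (lborel_dim d)" and le: "\<And>x. \<bar>f x\<bar> \<le> 1 + q x"
    and h: "q h = 1"
  shows "integrable (lborel_dim d) (\<lambda>x. f x * p x)"
    and "integrable G (\<lambda>x. f x * \<rho> x)"
    and "\<bar>(\<integral>x. f x * p x \<partial>lborel_dim d) / Z - (\<integral>x. f x * \<rho> x \<partial>G)\<bar>
      \<le> 65 * (1 + 1 / a\<^sup>2) * exp (- c0 * s * d / 8)"
    and "(\<And>x. 0 \<le> f x) \<Longrightarrow> (\<integral>x. f x * \<rho> x \<partial>G) \<le> (\<integral>x. f x * p x \<partial>lborel_dim d) / Z"
proof -
  define T where "T x = (1 - indicator (qball s) x) * (f x * p x)" for x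
  have T_meas: "T \<in> borel_measurable (lborel_dim d)" unfolding T_def by measurable
  note tail = exponential_tail[OF a s_ge]
  have Tle: "\<bar>T x\<bar> \<le> (1 - indicator (qball s) x) * ((1 + q x) * exp (- c0 * sqrt d * sqrt (q x)))"
    if "x \<in> space (lborel_dim d)" for x
  proof (cases "x \<in> qball s")
    case False
    then have "\<bar>f x * p x\<bar> \<le> (1 + q x) * exp (- c0 * sqrt d * sqrt (q x))"
      unfolding abs_mult using p_out[OF that False] le[of x] by (intro mult_mono) auto
    then show ?thesis using False by (simp add: T_def)
  qed (simp add: T_def)
  have iT: "integrable (lborel_dim d) T"
  proof (rule Bochner_Integration.integrable_bound[OF tail(1) T_meas])
    show "AE x in lborel_dim d. norm (T x) \<le> norm ((1 - indicator (qball s) x) * ((1 + q x) * exp (- c0 * sqrt d * sqrt (q x))))"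
    proof (rule AE_I2)
      fix x assume "x \<in> space (lborel_dim d)"
      then show "norm (T x) \<le> norm ((1 - indicator (qball s) x) * ((1 + q x) * exp (- c0 * sqrt d * sqrt (q x))))"
        using Tle[of x] unfolding real_norm_def by linarith
    qed
  qed
  have "\<bar>\<integral>x. T x \<partial>lborel_dim d\<bar> \<le> (\<integral>x. \<bar>T x\<bar> \<partial>lborel_dim d)" by (rule integral_abs_bound)
  also have "\<dots> \<le> (\<integral>x. (1 - indicator (qball s) x) * ((1 + q x) * exp (- c0 * sqrt d * sqrt (q x))) \<partial>lborel_dim d)"
    using iT by (intro integral_mono tail(1) Tle) auto
  finally have "\<bar>\<integral>x. T x \<partial>lborel_dim d\<bar> / Z \<le> (\<integral>x. (1 - indicator (qball s) x) * ((1 + q x) * exp (- c0 * sqrt d * sqrt (q x))) \<partial>lborel_dim d) / Z"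
    using Z_pos by (intro divide_right_mono) auto
  with tail(2) have Tb: "\<bar>\<integral>x. T x \<partial>lborel_dim d\<bar> / Z \<le> 65 * (1 + 1 / a\<^sup>2) * exp (- c0 * s * d / 8)" by linarith
  have "\<bar>f x * \<rho> x\<bar> \<le> (1 + s\<^sup>2 * d) * (indicator (qball s) x * weight h x)" for x
  proof (cases "x \<in> qball s")
    case True
    have "\<bar>1 * \<rho> x\<bar> \<le> indicator (qball s) x * weight h x" by (rule rho_weight) simp
    then have "\<rho> x \<le> indicator (qball s) x * weight h x" using rho_nonneg[of x] by simp
    moreover have "\<bar>f x\<bar> \<le> 1 + s\<^sup>2 * d" using le[of x] True by (simp add: qball_def)
    ultimately show ?thesis unfolding abs_mult using rho_nonneg[of x] by (intro mult_mono) auto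
  qed (simp add: \<rho>_def)
  then show i\<rho>: "integrable G (\<lambda>x. f x * \<rho> x)"
    by (intro integrable_weight_bound(1)[OF h, of _ "1 + s\<^sup>2 * d"]) auto
  have m\<rho>: "(\<lambda>x. f x * \<rho> x) \<in> borel_measurable (lborel_dim d)" by measurable
  have i2: "integrable (lborel_dim d) (\<lambda>x. f x * \<rho> x * exp (- q x / 2))"
    using i\<rho> unfolding integrable_G[OF m\<rho>] .
  have eq: "f x * p x = f x * \<rho> x * exp (- q x / 2) + T x" if "x \<in> space (lborel_dim d)" for x
  proof (cases "x \<in> qball s")
    case True
    have "exp (- q x / 2 - r x) = exp (- r x) * exp (- q x / 2)" by (simp add: exp_add[symmetric])
    then show ?thesis using p_in[OF that True] True by (simp add: T_def \<rho>_def)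
  qed (simp add: T_def \<rho>_def)
  have "integrable (lborel_dim d) (\<lambda>x. f x * \<rho> x * exp (- q x / 2) + T x)"
    using i2 iT by (rule Bochner_Integration.integrable_add)
  then show "integrable (lborel_dim d) (\<lambda>x. f x * p x)"
    by (subst Bochner_Integration.integrable_cong[OF refl eq]) auto
  have "(\<integral>x. f x * p x \<partial>lborel_dim d) = (\<integral>x. f x * \<rho> x * exp (- q x / 2) + T x \<partial>lborel_dim d)"
    by (rule Bochner_Integration.integral_cong[OF refl eq])
  also have "\<dots> = (\<integral>x. f x * \<rho> x * exp (- q x / 2) \<partial>lborel_dim d) + (\<integral>x. T x \<partial>lborel_dim d)"
    by (rule Bochner_Integration.integral_add[OF i2 iT])
  finally have *: "(\<integral>x. f x * p x \<partial>lborel_dim d) / Z = (\<integral>x. f x * \<rho> x \<partial>G) + (\<integral>x. T x \<partial>lborel_dim d) / Z"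
    unfolding integral_G[OF m\<rho>] by (simp add: add_divide_distrib)
  then show "\<bar>(\<integral>x. f x * p x \<partial>lborel_dim d) / Z - (\<integral>x. f x * \<rho> x \<partial>G)\<bar>
      \<le> 65 * (1 + 1 / a\<^sup>2) * exp (- c0 * s * d / 8)"
    using Tb Z_pos by simp
  show "(\<integral>x. f x * \<rho> x \<partial>G) \<le> (\<integral>x. f x * p x \<partial>lborel_dim d) / Z" if f0: "\<And>x. 0 \<le> f x"
  proof -
    have "0 \<le> (\<integral>x. T x \<partial>lborel_dim d)"
    proof (rule integral_nonneg_AE, rule AE_I2)
      fix x assume x: "x \<in> space (lborel_dim d)"
      show "0 \<le> T x" using p_out[OF x] f0[of x] by (cases "x \<in> qball s") (auto simp: T_def)
    qed
    then show ?thesis unfolding * using Z_pos by simp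
  qed
qed

text \<open>The 1 is subtracted inside the integral: the second moment minus 1 is the mean of (bil
  h)^2 - 1, a quotient with small numerator, and for the denominator \<open>D\<close> a lower bound
  is enough.\<close>

lemma laplace_variance:
  assumes h: "q h = 1"
    and D_def: "D = (\<integral>x. p x \<partial>lborel_dim d)"
  shows "0 < D"
    and "\<bar>(\<integral>x. (bil h x)\<^sup>2 * p x \<partial>lborel_dim d) / D - ((\<integral>x. bil h x * p x \<partial>lborel_dim d) / D)\<^sup>2 - 1\<bar>
      \<le> laplace_const N a * ((exp (\<epsilon>\<^sup>2 * s ^ 4))\<^sup>2 * \<epsilon>\<^sup>2 + exp (- c0 * s * d / 8))"
proof -
  define \<theta> where "\<theta> = exp (- c0 * s * d / 8)"
  define E where "E = exp (\<epsilon>\<^sup>2 * s ^ 4)"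
  define T where "T = 65 * (1 + 1 / a\<^sup>2)"
  define \<kappa> where "\<kappa> = 7 / 8 * exp (- 11 * N\<^sup>2)"
  have sq: "(bil h x)\<^sup>2 \<le> q x" for x by (rule bil_sq_le[OF h])
  have m1: "(\<lambda>x. (bil h x)\<^sup>2) \<in> borel_measurable (lborel_dim d)" "(\<lambda>x. 1 :: real) \<in> borel_measurable (lborel_dim d)"
    "(\<lambda>x. (bil h x)\<^sup>2 - 1) \<in> borel_measurable (lborel_dim d)" "(\<lambda>x. bil h x) \<in> borel_measurable (lborel_dim d)"
    by measurable
  have b1: "\<bar>(bil h x)\<^sup>2\<bar> \<le> 1 + q x" "\<bar>1 :: real\<bar> \<le> 1 + q x" "\<bar>(bil h x)\<^sup>2 - 1\<bar> \<le> 1 + q x" "\<bar>bil h x\<bar> \<le> 1 + q x" for x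
    using sq[of x] zero_le_power2[of "bil h x"] abs_le_one_plus_sq[of "bil h x"] q_nonneg[of x]
    by (linarith | simp)+
  note S2 = split_integral[OF m1(1) b1(1) h] and S0 = split_integral[OF m1(2) b1(2) h]
    and Sf = split_integral[OF m1(3) b1(3) h] and S1 = split_integral[OF m1(4) b1(4) h]
  have den: "\<kappa> \<le> D / Z"
  proof -
    have "(\<integral>x. \<rho> x \<partial>G) \<le> D / Z" using S0(4) by (simp add: D_def)
    with local_den(2)[OF h] show ?thesis unfolding \<kappa>_def by linarith
  qed
  have \<kappa>0: "\<kappa> > 0" by (simp add: \<kappa>_def)
  have "D / Z > 0" using den \<kappa>0 by linarith
  then show D0: "D > 0" using Z_pos by (simp add: zero_less_divide_iff)
  define n1 where "n1 = (\<integral>x. ((bil h x)\<^sup>2 - 1) * p x \<partial>lborel_dim d) / Z"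
  define n0 where "n0 = (\<integral>x. bil h x * p x \<partial>lborel_dim d) / Z"
  have n1: "\<bar>n1\<bar> \<le> 8 * \<theta> + \<epsilon>\<^sup>2 * (conc_const N * E) + T * \<theta>"
    using Sf(3) local_second_moment(2)[OF h a(3)] unfolding n1_def \<theta>_def E_def T_def by linarith
  have n0: "\<bar>n0\<bar> \<le> \<epsilon> * (conc_const N * E) + T * \<theta>"
    using S1(3) local_mean(2)[OF h] unfolding n0_def \<theta>_def E_def T_def by linarith
  have "0 < a / sqrt d" using a d_pos by simp
  then have "c0 > 0" using a by linarith
  then have \<theta>: "0 \<le> \<theta>" "\<theta> \<le> 1" using s4 by (simp_all add: \<theta>_def)
  have E1: "1 \<le> E" by (simp add: E_def)
  have T0: "0 \<le> T" by (simp add: T_def)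
  have main: "\<bar>n1 / (D / Z) - (n0 / (D / Z))\<^sup>2\<bar> \<le> laplace_const N a * (E\<^sup>2 * \<epsilon>\<^sup>2 + \<theta>)"
    unfolding laplace_const_def Let_def \<kappa>_def[symmetric] T_def[symmetric]
    by (rule variance_ratio_le[OF \<kappa>0 den conc_const_nonneg T0 E1 \<theta> eps(1) n1 n0])
  have comm: "A - B - 1 = A - 1 - B" for A B :: real by simp
  have "n0 / (D / Z) = (\<integral>x. bil h x * p x \<partial>lborel_dim d) / D"
    using Z_pos by (simp add: n0_def)
  moreover have "n1 / (D / Z) = (\<integral>x. (bil h x)\<^sup>2 * p x \<partial>lborel_dim d) / D - 1"
  proof -
    have "(\<integral>x. ((bil h x)\<^sup>2 - 1) * p x \<partial>lborel_dim d) = (\<integral>x. (bil h x)\<^sup>2 * p x - 1 * p x \<partial>lborel_dim d)"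
      by (simp add: left_diff_distrib)
    also have "\<dots> = (\<integral>x. (bil h x)\<^sup>2 * p x \<partial>lborel_dim d) - D"
      using S2(1) S0(1) by (subst Bochner_Integration.integral_diff) (auto simp: D_def)
    finally have "n1 / (D / Z) = ((\<integral>x. (bil h x)\<^sup>2 * p x \<partial>lborel_dim d) - D) / D"
      using Z_pos by (simp only: n1_def) simp
    then show ?thesis using D0 by (simp add: diff_divide_distrib)
  qed
  ultimately show "\<bar>(\<integral>x. (bil h x)\<^sup>2 * p x \<partial>lborel_dim d) / D - ((\<integral>x. bil h x * p x \<partial>lborel_dim d) / D)\<^sup>2 - 1\<bar>
      \<le> laplace_const N a * ((exp (\<epsilon>\<^sup>2 * s ^ 4))\<^sup>2 * \<epsilon>\<^sup>2 + exp (- c0 * s * d / 8))"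
    using main unfolding E_def \<theta>_def comm by (simp only:)
qed

end
end

subsection \<open>Matrix square roots and the operator norm\<close>

definition mv :: "nat \<Rightarrow> (nat \<Rightarrow> nat \<Rightarrow> real) \<Rightarrow> (nat \<Rightarrow> real) \<Rightarrow> nat \<Rightarrow> real" where
  "mv d B u = (\<lambda>i. \<Sum>k<d. B i k * u k)"
definition mm :: "nat \<Rightarrow> (nat \<Rightarrow> nat \<Rightarrow> real) \<Rightarrow> (nat \<Rightarrow> nat \<Rightarrow> real) \<Rightarrow> nat \<Rightarrow> nat \<Rightarrow> real" where
  "mm d B C = (\<lambda>i j. \<Sum>k<d. B i k * C k j)"
text \<open>Operator norm bound without a supremum; it passes directly to sums, products and
  entrywise limits.\<close>

definition op_le :: "nat \<Rightarrow> (nat \<Rightarrow> nat \<Rightarrow> real) \<Rightarrow> real \<Rightarrow> bool" where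
  "op_le d B c \<longleftrightarrow> (\<forall>u. L2_set (mv d B u) {..<d} \<le> c * L2_set u {..<d})"

lemma bilf_mv: "bilf d B u w = (\<Sum>j<d. (\<Sum>i<d. B i j * u i) * w j)"
  unfolding bilf_def by (subst sum.swap) (simp add: sum_distrib_right)

lemma bilf_mv': "bilf d B u w = (\<Sum>i<d. u i * mv d B w i)"
  unfolding bilf_def mv_def by (simp add: sum_distrib_left mult_ac)

lemma L2_set_sq: "(L2_set u {..<d})\<^sup>2 = (\<Sum>i<d. (u i)\<^sup>2)"
  unfolding L2_set_def by (simp add: sum_nonneg)

lemma mv_mm: "mv d (mm d B C) u = mv d B (mv d C u)"
proof
  fix i
  have "mv d (mm d B C) u i = (\<Sum>k<d. \<Sum>l<d. B i l * C l k * u k)"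
    by (simp add: mv_def mm_def sum_distrib_right)
  also have "\<dots> = (\<Sum>l<d. \<Sum>k<d. B i l * C l k * u k)" by (rule sum.swap)
  finally show "mv d (mm d B C) u i = mv d B (mv d C u) i"
    by (simp add: mv_def sum_distrib_left mult.assoc)
qed

lemma op_le_mm:
  assumes "op_le d B b" "op_le d C c" "0 \<le> b"
  shows "op_le d (mm d B C) (b * c)"
  unfolding op_le_def mv_mm
proof
  fix u
  have "L2_set (mv d B (mv d C u)) {..<d} \<le> b * L2_set (mv d C u) {..<d}" using assms by (simp add: op_le_def)
  also have "\<dots> \<le> b * (c * L2_set u {..<d})" using assms by (intro mult_left_mono) (auto simp: op_le_def)
  finally show "L2_set (mv d B (mv d C u)) {..<d} \<le> b * c * L2_set u {..<d}" by simp
qed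

lemma op_le_lincomb:
  assumes "op_le d B b" "op_le d C c" "0 \<le> a"
  shows "op_le d (\<lambda>i j. a * (B i j + C i j)) (a * (b + c))"
  unfolding op_le_def
proof
  fix u
  have "mv d (\<lambda>i j. a * (B i j + C i j)) u = (\<lambda>i. a * (mv d B u i + mv d C u i))"
    by (simp add: mv_def sum_distrib_left distrib_left distrib_right sum.distrib mult.assoc)
  then have "L2_set (mv d (\<lambda>i j. a * (B i j + C i j)) u) {..<d} = a * L2_set (\<lambda>i. mv d B u i + mv d C u i) {..<d}"
    using L2_set_left_distrib[OF assms(3), of "\<lambda>i. mv d B u i + mv d C u i" "{..<d}"] by (simp add: L2_set_right_distrib[OF assms(3)])
  also have "\<dots> \<le> a * (L2_set (mv d B u) {..<d} + L2_set (mv d C u) {..<d})"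
    by (intro mult_left_mono L2_set_triangle_ineq assms)
  also have "\<dots> \<le> a * (b * L2_set u {..<d} + c * L2_set u {..<d})"
    using assms by (intro mult_left_mono add_mono) (auto simp: op_le_def)
  finally show "L2_set (mv d (\<lambda>i j. a * (B i j + C i j)) u) {..<d} \<le> a * (b + c) * L2_set u {..<d}"
    by (simp add: algebra_simps)
qed

lemma op_le_entry:
  assumes "op_le d B c" "i < d" "j < d"
  shows "\<bar>B i j\<bar> \<le> c"
proof -
  define e where "e = (\<lambda>k. if k = j then 1 else 0 :: real)"
  have mve: "mv d B e = (\<lambda>i. B i j)"
    using assms by (simp add: mv_def e_def if_distrib[of "\<lambda>t. _ * t"] cong: if_cong)
  have "(L2_set e {..<d})\<^sup>2 = 1" unfolding L2_set_sq using assms by (simp add: e_def if_distrib[of "\<lambda>t. t\<^sup>2"] cong: if_cong)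
  then have "L2_set e {..<d} = 1" using L2_set_nonneg[of e "{..<d}"] by (simp add: power2_eq_1_iff)
  moreover have "L2_set (mv d B e) {..<d} \<le> c * L2_set e {..<d}" using assms by (simp add: op_le_def)
  moreover have "\<bar>B i j\<bar> \<le> L2_set (\<lambda>i. \<bar>B i j\<bar>) {..<d}" by (rule member_le_L2_set) (use assms in auto)
  ultimately show ?thesis unfolding mve by (simp add: L2_set_def)
qed

text \<open>For a symmetric matrix the quadratic form controls the norm, by polarisation: the form
  is evaluated at v + c * w and v - c * w with v = B w.\<close>

lemma op_le_symmetric:
  assumes sym: "\<And>i j. i < d \<Longrightarrow> j < d \<Longrightarrow> B i j = B j i"
    and m: "\<And>u. \<bar>bilf d B u u\<bar> \<le> m * (\<Sum>i<d. (u i)\<^sup>2)"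
  shows "op_le d B m"
  unfolding op_le_def
proof
  fix w
  define v where "v = mv d B w"
  define a where "a = L2_set v {..<d}"
  define b where "b = L2_set w {..<d}"
  have ab: "a \<ge> 0" "b \<ge> 0" by (auto simp: a_def b_def)
  have a2: "a\<^sup>2 = (\<Sum>i<d. (v i)\<^sup>2)" and b2: "b\<^sup>2 = (\<Sum>i<d. (w i)\<^sup>2)" by (simp_all add: a_def b_def L2_set_sq)
  have bs: "bilf d B x y = bilf d B y x" for x y
    unfolding bilf_def by (subst sum.swap) (auto intro!: sum.cong simp: sym mult_ac)
  have lin: "bilf d B (\<lambda>i. x i + c * y i) z = bilf d B x z + c * bilf d B y z" for x y z c
    unfolding bilf_def by (simp add: sum_distrib_left sum.distrib[symmetric] algebra_simps)
  have sqs: "bilf d B (\<lambda>i. x i + c * y i) (\<lambda>i. x i + c * y i) = bilf d B x x + 2 * c * bilf d B x y + c\<^sup>2 * bilf d B y y" for x y c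
    unfolding lin bs[of x "\<lambda>i. x i + c * y i"] bs[of y "\<lambda>i. x i + c * y i"] by (simp add: lin bs[of y x] power2_eq_square algebra_simps)
  have bvw: "bilf d B v w = a\<^sup>2" unfolding bilf_mv' a2 by (simp add: v_def power2_eq_square)
  show "L2_set (mv d B w) {..<d} \<le> m * L2_set w {..<d}"
  proof (cases "a = 0 \<or> b = 0")
    case True
    then show ?thesis
    proof
      assume "a = 0"
      have "0 \<le> m * b\<^sup>2" using m[of w] unfolding b2 by linarith
      then have "0 \<le> m * b"
      proof (cases "b = 0")
        case False
        then have "0 < b\<^sup>2" by simp
        moreover have "0 * b\<^sup>2 \<le> m * b\<^sup>2" using \<open>0 \<le> m * b\<^sup>2\<close> by simp
        ultimately have "0 \<le> m" by (rule mult_right_le_imp_le[rotated])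
        then show ?thesis using ab by simp
      qed simp
      then show ?thesis using \<open>a = 0\<close> by (simp add: a_def b_def v_def)
    next
      assume "b = 0"
      then have "\<forall>i<d. w i = 0" using b2 by (simp add: sum_nonneg_eq_0_iff)
      then have "a = 0" unfolding a_def v_def L2_set_def by (simp add: mv_def)
      then show ?thesis using \<open>b = 0\<close> by (simp add: a_def b_def v_def)
    qed
  next
    case False
    then have p: "a > 0" "b > 0" using ab by auto
    \<comment> \<open>This choice makes |v| = c * |w|, so that the two contributions in the
      parallelogram identity are equal.\<close>
    define c where "c = a / b"
    have "4 * c * a\<^sup>2 = bilf d B (\<lambda>i. v i + c * w i) (\<lambda>i. v i + c * w i) - bilf d B (\<lambda>i. v i + (- c) * w i) (\<lambda>i. v i + (- c) * w i)"
      unfolding sqs bvw by simp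
    also have "\<dots> \<le> m * (\<Sum>i<d. (v i + c * w i)\<^sup>2) + m * (\<Sum>i<d. (v i + (- c) * w i)\<^sup>2)"
      using m[of "\<lambda>i. v i + c * w i"] m[of "\<lambda>i. v i + (- c) * w i"] by linarith
    also have "\<dots> = m * (2 * a\<^sup>2 + 2 * c\<^sup>2 * b\<^sup>2)"
      unfolding a2 b2 distrib_left[symmetric] sum.distrib[symmetric] sum_distrib_left
      by (intro arg_cong2[of _ _ _ _ "(*)"] refl sum.cong) (simp add: power2_eq_square algebra_simps)
    also have "\<dots> = 4 * m * a\<^sup>2" using p by (simp add: c_def power_divide)
    finally have "4 * c * a\<^sup>2 \<le> 4 * m * a\<^sup>2" .
    then have "c \<le> m" using p by simp
    then show ?thesis using p by (simp add: c_def a_def b_def v_def field_simps)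
  qed
qed

text \<open>
  If \<open>2 * Y = B + Y * Y\<close>, then \<open>I - Y\<close> is a square root of \<open>I - B\<close>.
\<close>

lemma sqrt_iteration:
  assumes sym: "\<And>i j. i < d \<Longrightarrow> j < d \<Longrightarrow> B i j = B j i"
    and B: "op_le d B \<beta>" and \<beta>: "0 \<le> \<beta>" "\<beta> < 1"
  obtains Y \<rho> where "\<And>i j. i < d \<Longrightarrow> j < d \<Longrightarrow> Y i j = Y j i" "op_le d Y \<rho>" "0 \<le> \<rho>" "\<rho> < 1"
    "\<And>i j. i < d \<Longrightarrow> j < d \<Longrightarrow> 2 * Y i j = B i j + mm d Y Y i j"
proof -
  \<comment> \<open>The smaller root of 2 * \<rho> = \<beta> + \<rho>^2: the ball of this radius is
    mapped into itself by the iteration.\<close>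
  define \<rho> where "\<rho> = 1 - sqrt (1 - \<beta>)"
  have \<rho>: "0 \<le> \<rho>" "\<rho> < 1" "1 / 2 * (\<beta> + \<rho> * \<rho>) = \<rho>"
    using \<beta> by (auto simp: \<rho>_def algebra_simps)
  define F where "F Y = (\<lambda>i j. 1 / 2 * (B i j + mm d Y Y i j))" for Y
  define Y where "Y n = (F ^^ n) (\<lambda>_ _. 0)" for n
  have YS: "Y (Suc n) = (\<lambda>i j. 1 / 2 * (B i j + mm d (Y n) (Y n) i j))" for n by (simp add: Y_def F_def)
  have op0: "op_le d (\<lambda>_ _. 0) c" if "0 \<le> c" for c
    unfolding op_le_def using that by (simp add: mv_def L2_set_def sum_nonneg)
  have opY: "op_le d (Y n) \<rho>" for n
  proof (induction n)
    case 0
    show ?case using op0[OF \<rho>(1)] by (simp add: Y_def)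
  next
    case (Suc n)
    have "op_le d (Y (Suc n)) (1 / 2 * (\<beta> + \<rho> * \<rho>))"
      unfolding YS by (intro op_le_lincomb B op_le_mm Suc \<rho>) simp
    then show ?case by (simp only: \<rho>)
  qed
  have diff: "op_le d (\<lambda>i j. Y (Suc n) i j - Y n i j) (\<rho> ^ n)" for n
  proof (induction n)
    case 0
    have "(\<lambda>i j. Y (Suc 0) i j - Y 0 i j) = (\<lambda>i j. 1 / 2 * (B i j + 0))"
      by (intro ext) (simp add: Y_def F_def mm_def)
    moreover have "op_le d (\<lambda>i j. 1 / 2 * (B i j + 0)) (1 / 2 * (\<beta> + 0))"
      using op0[of 0] by (intro op_le_lincomb B) auto
    ultimately have "op_le d (\<lambda>i j. Y (Suc 0) i j - Y 0 i j) (1 / 2 * \<beta>)" by (simp only: add_0_right)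
    then show ?case
      unfolding op_le_def
    proof (intro allI)
      fix u assume "\<forall>u. L2_set (mv d (\<lambda>i j. Y (Suc 0) i j - Y 0 i j) u) {..<d} \<le> 1 / 2 * \<beta> * L2_set u {..<d}"
      then have "L2_set (mv d (\<lambda>i j. Y (Suc 0) i j - Y 0 i j) u) {..<d} \<le> 1 / 2 * \<beta> * L2_set u {..<d}" by blast
      also have "\<dots> \<le> 1 * L2_set u {..<d}" using \<beta> by (intro mult_right_mono) auto
      finally show "L2_set (mv d (\<lambda>i j. Y (Suc 0) i j - Y 0 i j) u) {..<d} \<le> \<rho> ^ 0 * L2_set u {..<d}" by simp
    qed
  next
    case (Suc n)
    define D where "D = (\<lambda>i j. Y (Suc n) i j - Y n i j)"
    \<comment> \<open>Noncommutative difference of squares, Y' * Y' - Y * Y = Y' * D + D * Y with D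
      = Y' - Y. With both iterates of norm at most \<rho>, the iteration contracts by
      \<rho>.\<close>
    have eq: "(\<lambda>i j. Y (Suc (Suc n)) i j - Y (Suc n) i j) = (\<lambda>i j. 1 / 2 * (mm d (Y (Suc n)) D i j + mm d D (Y n) i j))"
    proof (intro ext)
      fix i j
      have "Y (Suc (Suc n)) i j - Y (Suc n) i j = 1 / 2 * (mm d (Y (Suc n)) (Y (Suc n)) i j - mm d (Y n) (Y n) i j)"
        using fun_cong[OF fun_cong[OF YS[of "Suc n"]], of i j] fun_cong[OF fun_cong[OF YS[of n]], of i j] by simp
      also have "mm d (Y (Suc n)) (Y (Suc n)) i j - mm d (Y n) (Y n) i j = mm d (Y (Suc n)) D i j + mm d D (Y n) i j"
        unfolding mm_def D_def sum.distrib[symmetric] sum_subtractf[symmetric] by (simp add: algebra_simps)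
      finally show "Y (Suc (Suc n)) i j - Y (Suc n) i j = 1 / 2 * (mm d (Y (Suc n)) D i j + mm d D (Y n) i j)" .
    qed
    have "op_le d (\<lambda>i j. Y (Suc (Suc n)) i j - Y (Suc n) i j) (1 / 2 * (\<rho> * \<rho> ^ n + \<rho> ^ n * \<rho>))"
      unfolding eq using Suc[folded D_def] \<rho>(1) by (intro op_le_lincomb op_le_mm opY) auto
    then show ?case by (simp add: mult.commute)
  qed
  have conv: "convergent (\<lambda>n. Y n i j)" if "i < d" "j < d" for i j
  proof -
    have "summable (\<lambda>n. \<rho> ^ n)" using \<rho> by (intro summable_geometric) simp
    then have "summable (\<lambda>n. Y (Suc n) i j - Y n i j)"
      by (rule summable_comparison_test'[where N = 0]) (use op_le_entry[OF diff that] in simp)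
    then have "(\<lambda>m. \<Sum>n<m. Y (Suc n) i j - Y n i j) \<longlonglongrightarrow> (\<Sum>n. Y (Suc n) i j - Y n i j)" by (rule summable_LIMSEQ)
    then have "(\<lambda>m. Y m i j - Y 0 i j) \<longlonglongrightarrow> (\<Sum>n. Y (Suc n) i j - Y n i j)"
      by (simp only: sum_lessThan_telescope[of "\<lambda>n. Y n i j"])
    then have "(\<lambda>m. (Y m i j - Y 0 i j) + Y 0 i j) \<longlonglongrightarrow> (\<Sum>n. Y (Suc n) i j - Y n i j) + Y 0 i j"
      by (intro tendsto_add tendsto_const)
    then show ?thesis by (auto simp: convergent_def)
  qed
  define L where "L i j = lim (\<lambda>n. Y n i j)" for i j
  have lim: "(\<lambda>n. Y n i j) \<longlonglongrightarrow> L i j" if "i < d" "j < d" for i j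
    unfolding L_def using conv[OF that] by (simp add: convergent_LIMSEQ_iff)
  have Ysym: "Y n i j = Y n j i" if "i < d" "j < d" for n i j
    using that
  proof (induction n arbitrary: i j)
    case (Suc n)
    have "mm d (Y n) (Y n) i j = mm d (Y n) (Y n) j i"
      unfolding mm_def by (rule sum.cong[OF refl]) (use Suc in \<open>simp add: mult.commute\<close>)
    then show ?case unfolding YS using sym Suc.prems by simp
  qed (simp add: Y_def)
  show ?thesis
  proof (rule that[of L \<rho>])
    show "L i j = L j i" if "i < d" "j < d" for i j unfolding L_def using Ysym[OF that] by simp
    show "op_le d L \<rho>" unfolding op_le_def
    proof
      fix u
      have "(\<lambda>n. L2_set (mv d (Y n) u) {..<d}) \<longlonglongrightarrow> L2_set (mv d L u) {..<d}"
        unfolding L2_set_def mv_def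
        by (intro tendsto_real_sqrt tendsto_sum tendsto_power tendsto_mult tendsto_const lim) auto
      then show "L2_set (mv d L u) {..<d} \<le> \<rho> * L2_set u {..<d}"
        by (rule LIMSEQ_le_const2) (use opY in \<open>auto simp: op_le_def\<close>)
    qed
    show "2 * L i j = B i j + mm d L L i j" if ij: "i < d" "j < d" for i j
    proof -
      have "(\<lambda>n. B i j + mm d (Y n) (Y n) i j) \<longlonglongrightarrow> B i j + mm d L L i j"
        unfolding mm_def by (intro tendsto_intros lim ij) auto
      moreover have "(\<lambda>n. 2 * Y (Suc n) i j) \<longlonglongrightarrow> 2 * L i j"
        by (intro tendsto_mult tendsto_const LIMSEQ_Suc lim ij)
      moreover have "2 * Y (Suc n) i j = B i j + mm d (Y n) (Y n) i j" for n by (simp add: YS)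
      ultimately show ?thesis using LIMSEQ_unique by (simp only:) blast
    qed
  qed (use \<rho> in auto)
qed

section \<open>Index sums, inverses and square roots of positive definite matrices\<close>

lemma indices_0: "indices d 0 = {[]}"
  by (auto simp: indices_def)

lemma indices_Suc: "indices d (Suc k) = (\<lambda>(i, is). i # is) ` ({..<d} \<times> indices d k)"
proof (rule Set.set_eqI)
  fix js :: "nat list"
  show "js \<in> indices d (Suc k) \<longleftrightarrow> js \<in> (\<lambda>(i, is). i # is) ` ({..<d} \<times> indices d k)"
    by (cases js) (auto simp: indices_def image_iff)
qed

lemma sum_indices_Suc: "(\<Sum>is\<in>indices d (Suc k). f is) = (\<Sum>i<d. \<Sum>is\<in>indices d k. f (i # is))"
  unfolding indices_Suc
  by (subst sum.reindex) (auto simp: inj_on_def sum.cartesian_product case_prod_beta)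

lemma sum_indices_2: "(\<Sum>is\<in>indices d 2. f is) = (\<Sum>i<d. \<Sum>j<d. f [i, j])"
  by (simp add: sum_indices_Suc indices_0 numeral_2_eq_2)

lemma sum_indices_3: "(\<Sum>is\<in>indices d 3. f is) = (\<Sum>i<d. \<Sum>j<d. \<Sum>k<d. f [i, j, k])"
  by (simp add: sum_indices_Suc indices_0 numeral_3_eq_3)

lemma quad_vec:
  assumes "A \<in> carrier_mat d d" "u \<in> carrier_vec d" "w \<in> carrier_vec d"
  shows "u \<bullet> (A *\<^sub>v w) = bilf d (\<lambda>i j. A $$ (i, j)) (\<lambda>i. u $ i) (\<lambda>i. w $ i)"
  using assms unfolding bilf_mv' mv_def
  by (auto simp: scalar_prod_def atLeast0LessThan intro!: sum.cong)

lemma scalar_prod_sum: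
  fixes u v :: "real vec"
  assumes "v \<in> carrier_vec d"
  shows "u \<bullet> v = (\<Sum>i<d. u $ i * v $ i)"
  using assms by (auto simp: scalar_prod_def atLeast0LessThan)

text \<open>A positive definite matrix has trivial kernel, so \<open>mat_inverse\<close> does not
  return \<open>None\<close> and the \<open>the\<close> in \<open>mat_inv\<close> is
  harmless.\<close>

lemma pos_def_inverse:
  assumes "pos_def d A"
  shows "mat_inv A \<in> carrier_mat d d" "A * mat_inv A = 1\<^sub>m d" "mat_inv A * A = 1\<^sub>m d"
proof -
  have A: "A \<in> carrier_mat d d" using assms by (simp add: pos_def_def)
  have "Determinant.det A \<noteq> 0"
  proof
    assume "Determinant.det A = 0"
    then obtain v where v: "v \<in> carrier_vec d" "v \<noteq> 0\<^sub>v d" "A *\<^sub>v v = 0\<^sub>v d"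
      using det_0_iff_vec_prod_zero_field[OF A] by blast
    then have "v \<bullet> (A *\<^sub>v v) = 0" by simp
    moreover have "v \<bullet> (A *\<^sub>v v) > 0" using assms v unfolding pos_def_def by blast
    ultimately show False by simp
  qed
  then have "A \<in> Units (ring_mat TYPE(real) d ())" by (rule det_non_zero_imp_unit[OF A])
  then obtain K where K: "mat_inverse A = Some K" using mat_inverse(1)[OF A, of "()"] by fastforce
  then have "mat_inv A = K" by (simp add: mat_inv_def)
  with mat_inverse(2)[OF A K] have "A * mat_inv A = 1\<^sub>m d \<and> mat_inv A * A = 1\<^sub>m d \<and> mat_inv A \<in> carrier_mat d d"
    by (simp only:)
  then show "mat_inv A \<in> carrier_mat d d" "A * mat_inv A = 1\<^sub>m d" "mat_inv A * A = 1\<^sub>m d"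
    by blast+
qed

lemma pos_def_sym: "pos_def d A \<Longrightarrow> i < d \<Longrightarrow> j < d \<Longrightarrow> A $$ (i, j) = A $$ (j, i)"
proof -
  assume A: "pos_def d A" and ij: "i < d" "j < d"
  then have c: "A \<in> carrier_mat d d" "transpose_mat A = A" by (auto simp: pos_def_def)
  have "A $$ (i, j) = transpose_mat A $$ (i, j)" by (simp only: c)
  also have "\<dots> = A $$ (j, i)" using c(1) ij by simp
  finally show ?thesis .
qed

lemma pos_def_form:
  assumes d: "d \<ge> 1" and A: "pos_def d A"
  shows "pos_def_form d (\<lambda>i j. A $$ (i, j))"
proof
  have Ac: "A \<in> carrier_mat d d" using A by (simp add: pos_def_def)
  show "1 \<le> d" by (rule d)
  show "A $$ (i, j) = A $$ (j, i)" if "i < d" "j < d" for i j using pos_def_sym[OF A that] .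
  show "bilf d (\<lambda>i j. A $$ (i, j)) x x > 0" if "\<exists>i<d. x i \<noteq> 0" for x
  proof -
    have "vec d x \<noteq> 0\<^sub>v d"
    proof
      assume e: "vec d x = 0\<^sub>v d"
      obtain i where i: "i < d" "x i \<noteq> 0" using \<open>\<exists>i<d. x i \<noteq> 0\<close> by blast
      then have "vec d x $ i = 0" using e by simp
      then show False using i by simp
    qed
    then have "vec d x \<bullet> (A *\<^sub>v vec d x) > 0" using A by (simp add: pos_def_def)
    then have "bilf d (\<lambda>i j. A $$ (i, j)) (\<lambda>i. vec d x $ i) (\<lambda>i. vec d x $ i) > 0"
      using quad_vec[OF Ac, of "vec d x" "vec d x"] by simp
    also have "bilf d (\<lambda>i j. A $$ (i, j)) (\<lambda>i. vec d x $ i) (\<lambda>i. vec d x $ i) = bilf d (\<lambda>i j. A $$ (i, j)) x x"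
      unfolding bilf_def by (auto intro!: sum.cong)
    finally show ?thesis .
  qed
  show "\<exists>h. \<forall>x. bilf d (\<lambda>i j. A $$ (i, j)) h x = (\<Sum>i<d. b i * x i)" for b
  proof -
    define K where "K = mat_inv A"
    note K = pos_def_inverse[OF A, folded K_def]
    define h where "h = K *\<^sub>v vec d b"
    have hc: "h \<in> carrier_vec d" using K(1) by (simp add: h_def)
    have "A *\<^sub>v h = (A * K) *\<^sub>v vec d b" unfolding h_def using Ac K(1) by (simp add: assoc_mult_mat_vec)
    then have Ah: "A *\<^sub>v h = vec d b" using K by simp
    have row: "(\<Sum>i<d. A $$ (i, j) * h $ i) = b j" if "j < d" for j
    proof -
      have "(\<Sum>i<d. A $$ (i, j) * h $ i) = (\<Sum>i<d. A $$ (j, i) * h $ i)"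
        using pos_def_sym[OF A _ that] by (intro sum.cong) auto
      also have "\<dots> = (A *\<^sub>v h) $ j" using Ac hc that by (simp add: scalar_prod_def atLeast0LessThan)
      finally show ?thesis using Ah that by simp
    qed
    have "bilf d (\<lambda>i j. A $$ (i, j)) (\<lambda>i. h $ i) x = (\<Sum>i<d. b i * x i)" for x
      unfolding bilf_mv by (rule sum.cong) (use row in auto)
    then show ?thesis by blast
  qed
qed

text \<open>The form of \<open>B = I - A / M\<close> lies between 0 and \<beta> * |u|^2 with \<beta>
  < 1, so \<open>sqrt_iteration\<close> applies to \<open>B\<close>. Then sqrt M * (I - Y) squares
  to \<open>A\<close>, and it is positive definite because the norm of \<open>Y\<close> is below
  1.\<close>

lemma pos_def_sqrt_exists:
  assumes d: "d \<ge> 1" and A: "pos_def d A"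
  obtains R where "pos_def d R" "R * R = A"
proof -
  interpret pos_def_form d "\<lambda>i j. A $$ (i, j)" by (rule pos_def_form[OF d A])
  have Ac: "A \<in> carrier_mat d d" using A by (simp add: pos_def_def)
  obtain C where C: "C > 0" "\<And>x i. i < d \<Longrightarrow> (x i)\<^sup>2 \<le> C * q x" by (rule coord_bound) blast
  define M where "M = 1 + (\<Sum>i<d. \<Sum>j<d. \<bar>A $$ (i, j)\<bar>)"
  have M: "M > 0" unfolding M_def by (intro add_pos_nonneg sum_nonneg) auto
  have sq: "(\<Sum>i<d. (u i)\<^sup>2) \<le> d * C * q u" for u
  proof -
    have "(\<Sum>i<d. (u i)\<^sup>2) \<le> (\<Sum>i<d. C * q u)" by (rule sum_mono) (use C in auto)
    then show ?thesis by simp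
  qed
  have qM: "q u \<le> M * (\<Sum>i<d. (u i)\<^sup>2)" for u
  proof -
    define t where "t = (\<Sum>i<d. (u i)\<^sup>2)"
    have t0: "t \<ge> 0" by (simp add: t_def sum_nonneg)
    have ui: "(u i)\<^sup>2 \<le> t" if "i < d" for i unfolding t_def by (rule member_le_sum) (use that in auto)
    have "q u \<le> (\<Sum>i<d. \<Sum>j<d. \<bar>A $$ (i, j)\<bar> * t)"
      unfolding bilf_def
    proof (intro sum_mono)
      fix i j assume ij: "i \<in> {..<d}" "j \<in> {..<d}"
      have "\<bar>u i * u j\<bar> \<le> t"
      proof -
        have "2 * (\<bar>u i\<bar> * \<bar>u j\<bar>) \<le> (u i)\<^sup>2 + (u j)\<^sup>2" using sum_squares_bound[of "\<bar>u i\<bar>" "\<bar>u j\<bar>"] by simp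
        then show ?thesis using ui[of i] ui[of j] ij by (simp add: abs_mult)
      qed
      then have "\<bar>A $$ (i, j)\<bar> * \<bar>u i * u j\<bar> \<le> \<bar>A $$ (i, j)\<bar> * t" by (rule mult_left_mono) simp
      moreover have "A $$ (i, j) * u i * u j \<le> \<bar>A $$ (i, j)\<bar> * \<bar>u i * u j\<bar>"
        unfolding abs_mult[symmetric] by (simp add: mult.assoc)
      ultimately show "A $$ (i, j) * u i * u j \<le> \<bar>A $$ (i, j)\<bar> * t" by linarith
    qed
    also have "\<dots> = (M - 1) * t" by (simp add: M_def sum_distrib_right)
    also have "\<dots> \<le> M * t" using t0 by (intro mult_right_mono) auto
    finally show ?thesis by (simp add: t_def)
  qed
  define B where "B i j = (if i = j then 1 else 0) - A $$ (i, j) / M" for i j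
  have bB: "bilf d B u u = (\<Sum>i<d. (u i)\<^sup>2) - q u / M" for u
  proof -
    have "bilf d B u u = (\<Sum>i<d. \<Sum>j<d. (if i = j then u i * u j else 0) - A $$ (i, j) * u i * u j / M)"
      unfolding bilf_def B_def by (intro sum.cong refl) (simp add: algebra_simps)
    also have "\<dots> = (\<Sum>i<d. (u i)\<^sup>2) - q u / M"
      unfolding bilf_def sum_subtractf sum_divide_distrib by (simp add: power2_eq_square)
    finally show ?thesis .
  qed
  \<comment> \<open>By \<open>sq\<close>, the form of A / M is at least |u|^2 / (d * C * M). The
    \<open>max\<close> supplies 0 <= \<beta> without a comparison of d * C * M with 1.\<close>
  define \<beta> where "\<beta> = max 0 (1 - 1 / (d * C * M))"
  have dCM: "d * C * M > 0" using d C M by simp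
  have \<beta>: "0 \<le> \<beta>" "\<beta> < 1" using dCM by (auto simp: \<beta>_def)
  have opB: "op_le d B \<beta>"
  proof (rule op_le_symmetric)
    show "B i j = B j i" if "i < d" "j < d" for i j using H_sym[OF that] by (simp add: B_def)
    fix u :: "nat \<Rightarrow> real"
    define t where "t = (\<Sum>i<d. (u i)\<^sup>2)"
    have t0: "t \<ge> 0" by (simp add: t_def sum_nonneg)
    have "q u / M \<le> t" using qM[of u] M by (simp add: t_def divide_le_eq mult.commute)
    moreover have "t / (d * C * M) \<le> q u / M" using sq[of u] dCM M C d by (simp add: t_def field_simps)
    moreover have "(1 - 1 / (d * C * M)) * t \<le> \<beta> * t" using t0 by (intro mult_right_mono) (auto simp: \<beta>_def)
    ultimately show "\<bar>bilf d B u u\<bar> \<le> \<beta> * (\<Sum>i<d. (u i)\<^sup>2)"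
      unfolding bB t_def[symmetric] by (simp add: left_diff_distrib)
  qed
  obtain Y \<rho> where Y: "\<And>i j. i < d \<Longrightarrow> j < d \<Longrightarrow> Y i j = Y j i" "op_le d Y \<rho>" "0 \<le> \<rho>" "\<rho> < 1"
    "\<And>i j. i < d \<Longrightarrow> j < d \<Longrightarrow> 2 * Y i j = B i j + mm d Y Y i j"
  proof (rule sqrt_iteration[OF _ opB \<beta>])
    show "B i j = B j i" if "i < d" "j < d" for i j using H_sym[OF that] by (simp add: B_def)
  qed blast
  define R where "R = mat d d (\<lambda>(i, j). sqrt M * ((if i = j then 1 else 0) - Y i j))"
  have Rc: "R \<in> carrier_mat d d" by (simp add: R_def)
  have "R * R = A"
  proof (rule eq_matI)
    fix i j assume "i < dim_row A" "j < dim_col A"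
    then have ij: "i < d" "j < d" using Ac by auto
    have "(R * R) $$ (i, j) = (\<Sum>k<d. R $$ (i, k) * R $$ (k, j))"
      using Rc ij by (simp add: scalar_prod_def atLeast0LessThan)
    also have "\<dots> = (\<Sum>k<d. M * ((if i = k then (if k = j then 1 else 0) - Y k j else 0) - (if k = j then Y i k else 0) + Y i k * Y k j))"
    proof (rule sum.cong[OF refl])
      fix k assume "k \<in> {..<d}"
      then have "R $$ (i, k) * R $$ (k, j) = (sqrt M * ((if i = k then 1 else 0) - Y i k)) * (sqrt M * ((if k = j then 1 else 0) - Y k j))"
        using ij by (simp add: R_def)
      also have "\<dots> = (sqrt M * sqrt M) * (((if i = k then 1 else 0) - Y i k) * ((if k = j then 1 else 0) - Y k j))"
        by (simp only: mult_ac)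
      also have "sqrt M * sqrt M = M" using M by simp
      also have "((if i = k then 1 else 0) - Y i k) * ((if k = j then 1 else 0) - Y k j)
          = (if i = k then (if k = j then 1 else 0) - Y k j else 0) - (if k = j then Y i k else 0) + Y i k * Y k j"
        by (simp add: algebra_simps)
      finally show "R $$ (i, k) * R $$ (k, j) = M * ((if i = k then (if k = j then 1 else 0) - Y k j else 0) - (if k = j then Y i k else 0) + Y i k * Y k j)" .
    qed
    also have "\<dots> = M * ((if i = j then 1 else 0) - Y i j - Y i j + mm d Y Y i j)"
      unfolding sum_distrib_left[symmetric] sum.distrib sum_subtractf mm_def using ij by simp
    also have "\<dots> = M * ((if i = j then 1 else 0) - B i j)" using Y(5)[OF ij] by simp
    also have "\<dots> = A $$ (i, j)" using M by (simp add: B_def)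
    finally show "(R * R) $$ (i, j) = A $$ (i, j)" .
  qed (use Rc Ac in auto)
  moreover have "pos_def d R"
    unfolding pos_def_def
  proof (intro conjI ballI impI)
    show "R \<in> carrier_mat d d" by (rule Rc)
    show "transpose_mat R = R" by (rule eq_matI) (use Y(1) in \<open>auto simp: R_def\<close>)
    fix u :: "real vec" assume u: "u \<in> carrier_vec d" "u \<noteq> 0\<^sub>v d"
    define w where "w i = u $ i" for i
    define t where "t = (\<Sum>i<d. (w i)\<^sup>2)"
    have t: "t > 0"
    proof -
      have "\<exists>i<d. w i \<noteq> 0"
      proof (rule ccontr)
        assume "\<not> (\<exists>i<d. w i \<noteq> 0)"
        then have "u = 0\<^sub>v d" using u by (intro eq_vecI) (auto simp: w_def)
        then show False using u by simp
      qed
      then obtain i where i: "i < d" "w i \<noteq> 0" by blast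
      then have "0 < (w i)\<^sup>2" by simp
      also have "\<dots> \<le> t" unfolding t_def by (rule member_le_sum) (use i in auto)
      finally show ?thesis .
    qed
    have "u \<bullet> (R *\<^sub>v u) = bilf d (\<lambda>i j. R $$ (i, j)) w w" unfolding quad_vec[OF Rc u(1) u(1)] w_def ..
    also have "\<dots> = (\<Sum>i<d. \<Sum>j<d. sqrt M * ((if i = j then w i * w j else 0) - Y i j * w i * w j))"
      unfolding bilf_def by (intro sum.cong refl) (simp add: R_def algebra_simps)
    also have "\<dots> = sqrt M * (t - bilf d Y w w)"
      unfolding sum_distrib_left[symmetric] sum_subtractf bilf_def t_def by (simp add: power2_eq_square)
    finally have 1: "u \<bullet> (R *\<^sub>v u) = sqrt M * (t - bilf d Y w w)" .
    have "bilf d Y w w \<le> (\<Sum>i<d. \<bar>w i\<bar> * \<bar>mv d Y w i\<bar>)"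
      unfolding bilf_mv' by (rule sum_mono) (simp flip: abs_mult)
    also have "\<dots> \<le> L2_set w {..<d} * L2_set (mv d Y w) {..<d}" by (rule L2_set_mult_ineq)
    also have "\<dots> \<le> L2_set w {..<d} * (\<rho> * L2_set w {..<d})"
      using Y(2) by (intro mult_left_mono) (auto simp: op_le_def)
    also have "\<dots> = \<rho> * t" using L2_set_sq[of w d] by (simp add: t_def power2_eq_square mult_ac)
    also have "\<dots> < 1 * t" using Y(4) t by (rule mult_strict_right_mono)
    finally show "u \<bullet> (R *\<^sub>v u) > 0" unfolding 1 using M by simp
  qed
  ultimately show ?thesis using that by blast
qed

text \<open>
  For \<open>D = R - S\<close> one has \<open>R * D = - D * S\<close>, so the traces of \<open>D * R * D\<close> and \<open>D * S * D\<close>, which are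
  nonnegative, add up to \<open>0\<close>.
\<close>

lemma pos_def_sqrt_unique:
  assumes R: "pos_def d R" and S: "pos_def d S" and eq: "R * R = S * S"
  shows "R = S"
proof -
  have c: "R \<in> carrier_mat d d" "S \<in> carrier_mat d d" using R S by (auto simp: pos_def_def)
  define r where "r = (\<lambda>i j. R $$ (i, j))"
  define z where "z = (\<lambda>i j. S $$ (i, j))"
  define D where "D i j = r i j - z i j" for i j
  have sym: "r i j = r j i" "z i j = z j i" "D i j = D j i" if "i < d" "j < d" for i j
    using pos_def_sym[OF R that] pos_def_sym[OF S that] by (auto simp: r_def z_def D_def)
  have RS: "(\<Sum>k<d. r i k * r k j) = (\<Sum>k<d. z i k * z k j)" if "i < d" "j < d" for i j
  proof -
    have "(R * R) $$ (i, j) = (S * S) $$ (i, j)" using eq by simp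
    then show ?thesis using c that by (simp add: scalar_prod_def atLeast0LessThan r_def z_def)
  qed
  have anti: "(\<Sum>k<d. r i k * D k j) = - (\<Sum>k<d. D i k * z k j)" if "i < d" "j < d" for i j
  proof -
    have "(\<Sum>k<d. r i k * D k j) + (\<Sum>k<d. D i k * z k j) = (\<Sum>k<d. r i k * r k j) - (\<Sum>k<d. z i k * z k j)"
      unfolding D_def sum.distrib[symmetric] sum_subtractf[symmetric] by (intro sum.cong) (auto simp: algebra_simps)
    then show ?thesis using RS[OF that] by simp
  qed
  have quad: "bilf d (\<lambda>i j. A $$ (i, j)) w w \<ge> 0" "bilf d (\<lambda>i j. A $$ (i, j)) w w = 0 \<Longrightarrow> \<forall>i<d. w i = 0"
    if A: "pos_def d A" for A w
  proof -
    have q: "vec d w \<bullet> (A *\<^sub>v vec d w) = bilf d (\<lambda>i j. A $$ (i, j)) w w"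
      using A by (subst quad_vec) (auto simp: pos_def_def bilf_def intro!: sum.cong)
    show "bilf d (\<lambda>i j. A $$ (i, j)) w w \<ge> 0"
    proof (cases "vec d w = 0\<^sub>v d")
      case True
      then have "vec d w $ i = 0\<^sub>v d $ i" for i by simp
      then have "w i = 0" if "i < d" for i using that by (metis index_vec index_zero_vec(1))
      then show ?thesis by (simp add: bilf_def)
    next
      case False
      then show ?thesis using A unfolding q[symmetric] pos_def_def by (simp add: less_imp_le)
    qed
    show "\<forall>i<d. w i = 0" if "bilf d (\<lambda>i j. A $$ (i, j)) w w = 0"
    proof (cases "vec d w = 0\<^sub>v d")
      case True
      then show ?thesis by (metis index_vec index_zero_vec(1))
    next
      case False
      then show ?thesis using A that unfolding q[symmetric] pos_def_def by fastforce
    qed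
  qed
  define T1 where "T1 = (\<Sum>j<d. bilf d r (\<lambda>i. D i j) (\<lambda>i. D i j))"
  define T2 where "T2 = (\<Sum>j<d. bilf d z (\<lambda>i. D i j) (\<lambda>i. D i j))"
  have "T1 = (\<Sum>j<d. \<Sum>i<d. D i j * (\<Sum>k<d. r i k * D k j))"
    unfolding T1_def bilf_mv' mv_def ..
  also have "\<dots> = (\<Sum>j<d. \<Sum>i<d. D i j * - (\<Sum>k<d. D i k * z k j))"
    using anti by (intro sum.cong refl) auto
  also have "\<dots> = - (\<Sum>j<d. \<Sum>i<d. D i j * (\<Sum>k<d. D i k * z k j))" by (simp add: sum_negf)
  also have "(\<Sum>j<d. \<Sum>i<d. D i j * (\<Sum>k<d. D i k * z k j)) = (\<Sum>i<d. \<Sum>j<d. D i j * (\<Sum>k<d. D i k * z k j))"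
    by (rule sum.swap)
  also have "\<dots> = (\<Sum>i<d. \<Sum>j<d. D j i * (\<Sum>k<d. z j k * D k i))"
  proof (intro sum.cong refl)
    fix i j assume "i \<in> {..<d}" "j \<in> {..<d}"
    moreover have "(\<Sum>k<d. D i k * z k j) = (\<Sum>k<d. z j k * D k i)"
      using calculation sym by (intro sum.cong) auto
    ultimately show "D i j * (\<Sum>k<d. D i k * z k j) = D j i * (\<Sum>k<d. z j k * D k i)" using sym(3)[of i j] by simp
  qed
  also have "\<dots> = T2" unfolding T2_def bilf_mv' mv_def ..
  finally have T: "T1 = - T2" .
  have nn: "bilf d r (\<lambda>i. D i j) (\<lambda>i. D i j) \<ge> 0" "bilf d z (\<lambda>i. D i j) (\<lambda>i. D i j) \<ge> 0" for j
    using quad(1)[OF R, of "\<lambda>i. D i j"] quad(1)[OF S, of "\<lambda>i. D i j"] by (simp_all add: r_def z_def)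
  have "T1 \<ge> 0" "T2 \<ge> 0" unfolding T1_def T2_def by (intro sum_nonneg nn)+
  then have "T1 = 0" using T by simp
  then have "bilf d r (\<lambda>i. D i j) (\<lambda>i. D i j) = 0" if "j < d" for j
    unfolding T1_def using that nn(1) by (subst (asm) sum_nonneg_eq_0_iff) auto
  then have D0: "D i j = 0" if "i < d" "j < d" for i j
    using quad(2)[OF R, of "\<lambda>i. D i j"] that by (simp add: r_def)
  show ?thesis
    by (rule eq_matI) (use c D0 in \<open>auto simp: D_def r_def z_def\<close>)
qed

lemma mat_sqrt:
  assumes "d \<ge> 1" "pos_def d A"
  shows "pos_def d (mat_sqrt d A)" "mat_sqrt d A * mat_sqrt d A = A"
proof -
  obtain R where R: "pos_def d R" "R * R = A" by (rule pos_def_sqrt_exists[OF assms])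
  have "\<exists>!R. pos_def d R \<and> R * R = A"
    by (rule ex1I[of _ R]) (use R pos_def_sqrt_unique in auto)
  then have "pos_def d (mat_sqrt d A) \<and> mat_sqrt d A * mat_sqrt d A = A"
    unfolding mat_sqrt_def by (rule theI')
  then show "pos_def d (mat_sqrt d A)" "mat_sqrt d A * mat_sqrt d A = A" by auto
qed

lemma tensor_inner_mat:
  assumes "S \<in> carrier_mat d d" "u \<in> carrier_vec d"
  shows "tensor_inner d 2 (mat_tensor S) (tensor_power u) = u \<bullet> (S *\<^sub>v u)"
  unfolding tensor_inner_def sum_indices_2 quad_vec[OF assms assms(2)] bilf_def
  by (simp add: mat_tensor_def tensor_power_def mult.assoc)

text \<open>One inequality is Cauchy-Schwarz, the other is \<open>op_le_symmetric\<close> for the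
  supremum of the form.\<close>

lemma op_norm_symmetric:
  assumes d: "d \<ge> 1" and B: "B \<in> carrier_mat d d" and sym: "transpose_mat B = B"
  shows "(SUP w\<in>{w \<in> carrier_vec d. w \<bullet> w = 1}. \<bar>w \<bullet> (B *\<^sub>v w)\<bar>) = op_norm d B"
proof -
  define X where "X = {w \<in> carrier_vec d. w \<bullet> w = (1::real)}"
  have X: "w \<in> carrier_vec d" "(\<Sum>i<d. (w $ i)\<^sup>2) = 1" if "w \<in> X" for w
    using that by (auto simp: X_def scalar_prod_sum power2_eq_square)
  have ne: "X \<noteq> {}"
  proof -
    have "unit_vec d 0 \<in> X" using d by (simp add: X_def)
    then show ?thesis by blast
  qed
  have symB: "B $$ (i, j) = B $$ (j, i)" if "i < d" "j < d" for i j
  proof -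
    have "B $$ (i, j) = transpose_mat B $$ (i, j)" by (simp only: sym)
    also have "\<dots> = B $$ (j, i)" using B that by simp
    finally show ?thesis .
  qed
  define f where "f = (\<lambda>i j. B $$ (i, j))"
  have Bw: "sqrt ((B *\<^sub>v w) \<bullet> (B *\<^sub>v w)) = L2_set (mv d f (\<lambda>i. w $ i)) {..<d}" if "w \<in> carrier_vec d" for w
  proof -
    have c: "B *\<^sub>v w \<in> carrier_vec d" by (rule mult_mat_vec_carrier[OF B that])
    have "(B *\<^sub>v w) $ i = mv d f (\<lambda>i. w $ i) i" if "i < d" for i
      using B \<open>w \<in> carrier_vec d\<close> that by (simp add: mv_def f_def scalar_prod_def atLeast0LessThan)
    then show ?thesis unfolding scalar_prod_sum[OF c] L2_set_def power2_eq_square by simp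
  qed
  have qw: "w \<bullet> (B *\<^sub>v w) = bilf d f (\<lambda>i. w $ i) (\<lambda>i. w $ i)" if "w \<in> carrier_vec d" for w
    unfolding f_def by (rule quad_vec[OF B that that])
  have L1: "L2_set (\<lambda>i. w $ i) {..<d} = 1" if "w \<in> X" for w using X(2)[OF that] by (simp add: L2_set_def)
  have le1: "\<bar>w \<bullet> (B *\<^sub>v w)\<bar> \<le> sqrt ((B *\<^sub>v w) \<bullet> (B *\<^sub>v w))" if w: "w \<in> X" for w
  proof -
    have "\<bar>bilf d f (\<lambda>i. w $ i) (\<lambda>i. w $ i)\<bar> \<le> (\<Sum>i<d. \<bar>w $ i\<bar> * \<bar>mv d f (\<lambda>i. w $ i) i\<bar>)"
      unfolding bilf_mv' abs_mult[symmetric] by (rule sum_abs)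
    also have "\<dots> \<le> L2_set (\<lambda>i. w $ i) {..<d} * L2_set (mv d f (\<lambda>i. w $ i)) {..<d}" by (rule L2_set_mult_ineq)
    finally show ?thesis using L1[OF w] by (simp add: qw[OF X(1)[OF w]] Bw[OF X(1)[OF w]])
  qed
  \<comment> \<open>A crude bound, which makes both sets of values bounded so that their
    \<open>SUP\<close> is an actual supremum.\<close>
  define b where "b = (\<Sum>i<d. \<Sum>j<d. \<bar>f i j\<bar>)"
  have qb: "\<bar>bilf d f u u\<bar> \<le> b * (\<Sum>i<d. (u i)\<^sup>2)" for u
  proof -
    define t where "t = (\<Sum>i<d. (u i)\<^sup>2)"
    have ui: "(u i)\<^sup>2 \<le> t" if "i < d" for i unfolding t_def by (rule member_le_sum) (use that in auto)
    have "\<bar>bilf d f u u\<bar> \<le> (\<Sum>i<d. \<Sum>j<d. \<bar>f i j\<bar> * t)"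
      unfolding bilf_def
    proof (rule order_trans[OF sum_abs], rule sum_mono, rule order_trans[OF sum_abs], rule sum_mono)
      fix i j assume ij: "i \<in> {..<d}" "j \<in> {..<d}"
      have "2 * (\<bar>u i\<bar> * \<bar>u j\<bar>) \<le> (u i)\<^sup>2 + (u j)\<^sup>2" using sum_squares_bound[of "\<bar>u i\<bar>" "\<bar>u j\<bar>"] by simp
      then have "\<bar>u i\<bar> * \<bar>u j\<bar> \<le> t" using ui[of i] ui[of j] ij by simp
      then have "\<bar>f i j\<bar> * (\<bar>u i\<bar> * \<bar>u j\<bar>) \<le> \<bar>f i j\<bar> * t" by (rule mult_left_mono) simp
      then show "\<bar>f i j * u i * u j\<bar> \<le> \<bar>f i j\<bar> * t" by (simp add: abs_mult mult.assoc)
    qed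
    then show ?thesis by (simp add: b_def t_def sum_distrib_right)
  qed
  have op_b: "op_le d f b" by (rule op_le_symmetric[OF _ qb]) (simp add: f_def symB)
  have bdd: "bdd_above ((\<lambda>w. sqrt ((B *\<^sub>v w) \<bullet> (B *\<^sub>v w))) ` X)"
  proof (rule bdd_aboveI2)
    fix w assume w: "w \<in> X"
    show "sqrt ((B *\<^sub>v w) \<bullet> (B *\<^sub>v w)) \<le> b"
      using op_b L1[OF w] unfolding Bw[OF X(1)[OF w]] op_le_def by (auto dest: spec[of _ "\<lambda>i. w $ i"])
  qed
  have bdd': "bdd_above ((\<lambda>w. \<bar>w \<bullet> (B *\<^sub>v w)\<bar>) ` X)"
  proof (rule bdd_aboveI2)
    fix w assume w: "w \<in> X"
    show "\<bar>w \<bullet> (B *\<^sub>v w)\<bar> \<le> b" using qb[of "\<lambda>i. w $ i"] X(2)[OF w] by (simp add: qw[OF X(1)[OF w]])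
  qed
  define m where "m = (SUP w\<in>X. \<bar>w \<bullet> (B *\<^sub>v w)\<bar>)"
  have m_le: "\<bar>w \<bullet> (B *\<^sub>v w)\<bar> \<le> m" if "w \<in> X" for w
    unfolding m_def by (rule cSUP_upper[OF that bdd'])
  have qm: "\<bar>bilf d f u u\<bar> \<le> m * (\<Sum>i<d. (u i)\<^sup>2)" for u
  proof -
    define t where "t = (\<Sum>i<d. (u i)\<^sup>2)"
    show ?thesis
    proof (cases "t = 0")
      case True
      then have "u i = 0" if "i < d" for i using that by (simp add: t_def sum_nonneg_eq_0_iff)
      then show ?thesis by (simp add: bilf_def)
    next
      case False
      then have t: "t > 0" by (simp add: t_def sum_nonneg less_le)
      define w where "w = vec d (\<lambda>i. u i / sqrt t)"
      have "(\<Sum>i<d. w $ i * w $ i) = (\<Sum>i<d. (u i)\<^sup>2 / t)"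
        using t by (intro sum.cong) (auto simp: w_def power2_eq_square)
      also have "\<dots> = 1" using t by (simp add: sum_divide_distrib[symmetric] t_def)
      finally have w: "w \<in> X" by (simp add: X_def scalar_prod_sum w_def)
      have "bilf d f (\<lambda>i. w $ i) (\<lambda>i. w $ i) = bilf d f u u / t"
        unfolding bilf_def sum_divide_distrib using t by (intro sum.cong refl) (simp add: w_def)
      then have "\<bar>bilf d f u u\<bar> / t \<le> m" using m_le[OF w] t by (simp add: qw[OF X(1)[OF w]])
      then show ?thesis using t by (simp add: t_def[symmetric] divide_le_eq)
    qed
  qed
  have opm: "op_le d f m" by (rule op_le_symmetric[OF _ qm]) (simp add: f_def symB)
  have "op_norm d B \<le> m"
    unfolding op_norm_def X_def[symmetric]
  proof (rule cSUP_least[OF ne])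
    fix w assume w: "w \<in> X"
    show "sqrt ((B *\<^sub>v w) \<bullet> (B *\<^sub>v w)) \<le> m"
      using opm L1[OF w] unfolding Bw[OF X(1)[OF w]] op_le_def by (auto dest: spec[of _ "\<lambda>i. w $ i"])
  qed
  moreover have "m \<le> op_norm d B"
    unfolding m_def op_norm_def X_def[symmetric] by (rule cSUP_mono[OF ne bdd]) (use le1 in blast)
  ultimately show ?thesis by (simp add: m_def X_def)
qed

lemma mat_sqrt_carrier:
  assumes "d \<ge> 1" "pos_def d H"
  shows "mat_sqrt d H \<in> carrier_mat d d" "transpose_mat (mat_sqrt d H) = mat_sqrt d H"
  using mat_sqrt[OF assms] by (auto simp: pos_def_def)

lemma mat_sqrt_conj_form:
  assumes d: "d \<ge> 1" and H: "pos_def d H" and that: "w \<in> carrier_vec d" "A \<in> carrier_mat d d"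
  shows "(mat_sqrt d H *\<^sub>v w) \<bullet> (A *\<^sub>v (mat_sqrt d H *\<^sub>v w)) = w \<bullet> ((mat_sqrt d H * A * mat_sqrt d H) *\<^sub>v w)"
proof -
  define R where "R = mat_sqrt d H"
  note Rc = mat_sqrt_carrier[OF d H, folded R_def]
  have "(R * A * R) *\<^sub>v w = (R * A) *\<^sub>v (R *\<^sub>v w)"
    by (rule assoc_mult_mat_vec[of _ d d _ d]) (use Rc that in auto)
  also have "\<dots> = R *\<^sub>v (A *\<^sub>v (R *\<^sub>v w))"
    by (rule assoc_mult_mat_vec[of _ d d _ d]) (use Rc that in auto)
  finally have "(R * A * R) *\<^sub>v w = R *\<^sub>v (A *\<^sub>v (R *\<^sub>v w))" .
  moreover have "w \<bullet> (R *\<^sub>v x) = (R *\<^sub>v w) \<bullet> x" if x: "x \<in> carrier_vec d" for x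
    using transpose_vec_mult_scalar[OF Rc(1) x \<open>w \<in> carrier_vec d\<close>] unfolding Rc(2) by (rule sym)
  moreover have "A *\<^sub>v (R *\<^sub>v w) \<in> carrier_vec d"
    by (rule mult_mat_vec_carrier[OF that(2) mult_mat_vec_carrier[OF Rc(1) that(1)]])
  ultimately show ?thesis by (simp only: R_def)
qed

text \<open>With \<open>R\<close> the square root and \<open>K\<close> the inverse of
  \<open>H\<close> one has R * K * R = I, so \<open>R\<close> carries the Euclidean unit sphere onto
  that of \<open>K\<close>.\<close>

lemma wnorm_inv_sphere:
  assumes d: "d \<ge> 1" and H: "pos_def d H"
  shows "{u \<in> carrier_vec d. wnorm (mat_inv H) u = 1} = (\<lambda>w. mat_sqrt d H *\<^sub>v w) ` {w \<in> carrier_vec d. w \<bullet> w = 1}"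
proof -
  define R where "R = mat_sqrt d H"
  define K where "K = mat_inv H"
  have R: "pos_def d R" "R * R = H" using mat_sqrt[OF d H] by (auto simp: R_def)
  have Rc: "R \<in> carrier_mat d d" "transpose_mat R = R" using R by (auto simp: pos_def_def)
  note K = pos_def_inverse[OF H, folded K_def]
  define P where "P = mat_inv R"
  note P = pos_def_inverse[OF R(1), folded P_def]
  have RKR: "R * K * R = 1\<^sub>m d"
  proof -
    have RK: "R * K \<in> carrier_mat d d" "R * K * R \<in> carrier_mat d d" using Rc K by auto
    have "R * K * R = (P * R) * (R * K * R)" unfolding P(3) by (rule left_mult_one_mat[OF RK(2), symmetric])
    also have "\<dots> = P * (R * (R * K * R))" by (rule assoc_mult_mat[OF P(1) Rc(1) RK(2)])
    also have "R * (R * K * R) = (R * (R * K)) * R" by (rule assoc_mult_mat[OF Rc(1) RK(1) Rc(1), symmetric])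
    also have "R * (R * K) = (R * R) * K" by (rule assoc_mult_mat[OF Rc(1) Rc(1) K(1), symmetric])
    also have "\<dots> = 1\<^sub>m d" unfolding R(2) by (rule K(2))
    also have "1\<^sub>m d * R = R" by (rule left_mult_one_mat[OF Rc(1)])
    also have "P * R = 1\<^sub>m d" by (rule P(3))
    finally show ?thesis .
  qed
  have adj: "(R *\<^sub>v w) \<bullet> (A *\<^sub>v (R *\<^sub>v w)) = w \<bullet> ((R * A * R) *\<^sub>v w)"
    if "w \<in> carrier_vec d" "A \<in> carrier_mat d d" for w A
    unfolding R_def by (rule mat_sqrt_conj_form[OF d H that])
  have "{u \<in> carrier_vec d. wnorm K u = 1} = (\<lambda>w. R *\<^sub>v w) ` {w \<in> carrier_vec d. w \<bullet> w = 1}"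
  proof (rule Set.set_eqI, rule iffI)
    fix u assume u: "u \<in> {u \<in> carrier_vec d. wnorm K u = 1}"
    define w where "w = P *\<^sub>v u"
    have wc: "w \<in> carrier_vec d" using P u by (simp add: w_def)
    have Rw: "R *\<^sub>v w = u"
    proof -
      have "R *\<^sub>v w = (R * P) *\<^sub>v u"
        unfolding w_def by (rule assoc_mult_mat_vec[of _ d d _ d, symmetric]) (use P Rc u in auto)
      then show ?thesis using P u by simp
    qed
    have "u \<bullet> (K *\<^sub>v u) = 1" using u by (simp add: wnorm_def)
    then have "w \<bullet> w = 1" using adj[OF wc K(1)] wc unfolding Rw RKR by simp
    then show "u \<in> (\<lambda>w. R *\<^sub>v w) ` {w \<in> carrier_vec d. w \<bullet> w = 1}" using wc Rw by blast
  next
    fix u assume "u \<in> (\<lambda>w. R *\<^sub>v w) ` {w \<in> carrier_vec d. w \<bullet> w = 1}"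
    then obtain w where w: "w \<in> carrier_vec d" "w \<bullet> w = 1" "u = R *\<^sub>v w" by blast
    have "u \<bullet> (K *\<^sub>v u) = 1" using adj[OF w(1) K(1)] w unfolding RKR by simp
    then show "u \<in> {u \<in> carrier_vec d. wnorm K u = 1}" using w Rc by (simp add: wnorm_def)
  qed
  then show ?thesis by (simp only: K_def R_def)
qed

lemma mat_wnorm_eq_op_norm:
  assumes d: "d \<ge> 1" and H: "pos_def d H" and S: "S \<in> carrier_mat d d" "transpose_mat S = S"
  shows "mat_wnorm d (mat_inv H) S = op_norm d (mat_sqrt d H * S * mat_sqrt d H)"
proof -
  define R where "R = mat_sqrt d H"
  define K where "K = mat_inv H"
  have R: "pos_def d R" "R * R = H" using mat_sqrt[OF d H] by (auto simp: R_def)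
  have Rc: "R \<in> carrier_mat d d" "transpose_mat R = R" using R by (auto simp: pos_def_def)
  have adj: "(R *\<^sub>v w) \<bullet> (A *\<^sub>v (R *\<^sub>v w)) = w \<bullet> ((R * A * R) *\<^sub>v w)"
    if "w \<in> carrier_vec d" "A \<in> carrier_mat d d" for w A
    unfolding R_def by (rule mat_sqrt_conj_form[OF d H that])
  have "mat_wnorm d K S = (SUP w\<in>{w \<in> carrier_vec d. w \<bullet> w = 1}. \<bar>w \<bullet> ((R * S * R) *\<^sub>v w)\<bar>)"
    unfolding mat_wnorm_def tensor_norm_def wnorm_inv_sphere[OF d H, folded K_def R_def] image_image
    by (rule SUP_cong[OF refl]) (use Rc S adj in \<open>simp add: tensor_inner_mat[OF S(1)]\<close>)
  also have "\<dots> = op_norm d (R * S * R)"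
  proof (rule op_norm_symmetric[OF d])
    show "R * S * R \<in> carrier_mat d d" using Rc S by simp
    have "transpose_mat (R * S * R) = transpose_mat R * (transpose_mat S * transpose_mat R)"
      using Rc(1) S(1) transpose_mult[of "R * S" d d R d] transpose_mult[of R d d S d] by simp
    also have "\<dots> = R * S * R" unfolding Rc(2) S(2) by (rule assoc_mult_mat[OF Rc(1) S(1) Rc(1), symmetric])
    finally show "transpose_mat (R * S * R) = R * S * R" .
  qed
  finally show ?thesis by (simp add: K_def R_def)
qed

subsection \<open>Derivatives along lines\<close>

text \<open>With finitely many coordinates, basic open sets of the product contain cubes of a common
  radius; topological hypotheses become \<epsilon>-\<delta> statements.\<close>

lemma openin_box:
  fixes d :: nat
  assumes S: "openin (powertop_real {..<d}) S" and x: "x \<in> S"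
  shows "\<exists>\<delta>>0. \<forall>y\<in>{..<d} \<rightarrow>\<^sub>E UNIV. (\<forall>i<d. \<bar>y i - x i\<bar> < \<delta>) \<longrightarrow> y \<in> S"
proof -
  obtain U where U: "\<And>i. i < d \<Longrightarrow> open (U i)" "x \<in> Pi\<^sub>E {..<d} U" "Pi\<^sub>E {..<d} U \<subseteq> S"
  proof -
    have "\<forall>x\<in>S. \<exists>U. finite {i \<in> {..<d}. U i \<noteq> topspace euclideanreal} \<and> (\<forall>i\<in>{..<d}. openin euclideanreal (U i)) \<and>
        x \<in> Pi\<^sub>E {..<d} U \<and> Pi\<^sub>E {..<d} U \<subseteq> S"
      using S unfolding openin_product_topology_alt .
    from bspec[OF this x] obtain U where "\<forall>i\<in>{..<d}. openin euclideanreal (U i)" "x \<in> Pi\<^sub>E {..<d} U" "Pi\<^sub>E {..<d} U \<subseteq> S"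
      by blast
    then show ?thesis by (intro that[of U]) (simp_all only: open_openin lessThan_iff Ball_def)
  qed
  have "\<exists>\<delta>. \<delta> > 0 \<and> (\<forall>t. \<bar>t - x i\<bar> < \<delta> \<longrightarrow> t \<in> U i)" if "i < d" for i
    using U(1)[OF that] U(2) that unfolding open_dist by (auto simp: dist_real_def PiE_iff)
  then have "\<forall>i\<in>{..<d}. \<exists>\<delta>. \<delta> > 0 \<and> (\<forall>t. \<bar>t - x i\<bar> < \<delta> \<longrightarrow> t \<in> U i)" by blast
  from bchoice[OF this] obtain D where D: "\<And>i. i < d \<Longrightarrow> D i > 0" "\<And>i t. i < d \<Longrightarrow> \<bar>t - x i\<bar> < D i \<Longrightarrow> t \<in> U i" by blast
  \<comment> \<open>The inserted 1 keeps the set nonempty when \<open>d = 0\<close>.\<close>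
  define \<delta> where "\<delta> = Min (insert 1 (D ` {..<d}))"
  have fin: "finite (insert 1 (D ` {..<d}))" by (intro finite.insertI finite_imageI finite_lessThan)
  have "\<delta> > 0" unfolding \<delta>_def using D fin by (subst Min_gr_iff) auto
  moreover have "y \<in> S" if "y \<in> {..<d} \<rightarrow>\<^sub>E UNIV" and close: "\<forall>i<d. \<bar>y i - x i\<bar> < \<delta>" for y
  proof -
    have "y i \<in> U i" if i: "i < d" for i
    proof (rule D(2)[OF i])
      have "\<delta> \<le> D i" unfolding \<delta>_def by (rule Min_le[OF fin]) (use i in blast)
      then show "\<bar>y i - x i\<bar> < D i" using close[rule_format, OF i] by linarith
    qed
    then have "y \<in> Pi\<^sub>E {..<d} U" using that(1) by (auto simp: PiE_iff)
    then show ?thesis using U by blast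
  qed
  ultimately show ?thesis by blast
qed

lemma continuous_map_box:
  fixes d :: nat
  assumes \<Theta>: "openin (powertop_real {..<d}) \<Theta>" and x: "x \<in> \<Theta>" and \<epsilon>: "\<epsilon> > 0"
    and f: "continuous_map (subtopology (powertop_real {..<d}) \<Theta>) euclideanreal f"
  shows "\<exists>\<delta>>0. \<forall>y\<in>{..<d} \<rightarrow>\<^sub>E UNIV. (\<forall>i<d. \<bar>y i - x i\<bar> < \<delta>) \<longrightarrow> y \<in> \<Theta> \<and> \<bar>f y - f x\<bar> < \<epsilon>"
proof -
  define W where "W = {y \<in> topspace (subtopology (powertop_real {..<d}) \<Theta>). f y \<in> {t. \<bar>t - f x\<bar> < \<epsilon>}}"
  have "{t. \<bar>t - f x\<bar> < \<epsilon>} = Elementary_Metric_Spaces.ball (f x) \<epsilon>" by (auto simp: dist_real_def abs_minus_commute)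
  then have "openin euclideanreal {t. \<bar>t - f x\<bar> < \<epsilon>}" by (simp add: open_openin[symmetric])
  then have "openin (subtopology (powertop_real {..<d}) \<Theta>) W"
    unfolding W_def by (rule openin_continuous_map_preimage[OF f])
  then have W: "openin (powertop_real {..<d}) W" using \<Theta> by (simp add: openin_open_subtopology)
  have "x \<in> W" using x \<epsilon> openin_subset[OF \<Theta>] by (auto simp: W_def)
  from openin_box[OF W this] obtain \<delta> where \<delta>: "\<delta> > 0"
    "\<forall>y\<in>{..<d} \<rightarrow>\<^sub>E UNIV. (\<forall>i<d. \<bar>y i - x i\<bar> < \<delta>) \<longrightarrow> y \<in> W" by (elim exE conjE)
  show ?thesis
  proof (intro exI[of _ \<delta>] conjI ballI impI \<delta>(1))
    fix y assume y: "y \<in> {..<d} \<rightarrow>\<^sub>E UNIV" "\<forall>i<d. \<bar>y i - x i\<bar> < \<delta>"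
    have "y \<in> W" by (rule mp[OF bspec[OF \<delta>(2) y(1)] y(2)])
    then show "y \<in> \<Theta>" "\<bar>f y - f x\<bar> < \<epsilon>" by (simp_all add: W_def)
  qed
qed

definition line :: "nat \<Rightarrow> point \<Rightarrow> point \<Rightarrow> real \<Rightarrow> point" where
  "line d x h t = (\<lambda>i\<in>{..<d}. x i + t * h i)"

lemma line_PiE [simp]: "line d x h t \<in> {..<d} \<rightarrow>\<^sub>E UNIV"
  by (simp add: line_def)

text \<open>The chain rule for continuous partial derivatives: the increment is split into moves of
  one coordinate at a time, and in each move the partial derivative differs by at most \<epsilon>
  from its value at \<open>a\<close>.\<close>

lemma deriv_along_line:
  assumes \<Theta>: "openin (powertop_real {..<d}) \<Theta>"
    and diff: "\<And>i x. i < d \<Longrightarrow> x \<in> \<Theta> \<Longrightarrow> (\<lambda>t. f (x(i := t))) field_differentiable at (x i)"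
    and cont: "\<And>i. i < d \<Longrightarrow> continuous_map (subtopology (powertop_real {..<d}) \<Theta>) euclideanreal (partial_deriv i f)"
    and t: "line d x h t \<in> \<Theta>"
  shows "((\<lambda>t. f (line d x h t)) has_real_derivative (\<Sum>i<d. partial_deriv i f (line d x h t) * h i)) (at t)"
proof -
  define a where "a = line d x h t"
  define D where "D i = partial_deriv i f a" for i
  have at: "a \<in> \<Theta>" using t by (simp add: a_def)
  have main: "\<exists>\<eta>>0. \<forall>s. \<bar>s - t\<bar> < \<eta> \<longrightarrow>
      \<bar>f (line d x h s) - f a - (s - t) * (\<Sum>i<d. D i * h i)\<bar> \<le> e * \<bar>s - t\<bar>" if e: "e > 0" for e
  proof -
    define m where "m = 1 + (\<Sum>i<d. \<bar>h i\<bar>)"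
    have m: "m > 0" unfolding m_def by (intro add_pos_nonneg sum_nonneg) auto
    have hm: "\<bar>h i\<bar> \<le> m" if "i < d" for i
    proof -
      have "\<bar>h i\<bar> \<le> (\<Sum>i<d. \<bar>h i\<bar>)" by (rule member_le_sum) (use that in auto)
      then show ?thesis by (simp add: m_def)
    qed
    define \<epsilon> where "\<epsilon> = e / m"
    have \<epsilon>: "\<epsilon> > 0" using e m by (simp add: \<epsilon>_def)
    have "\<forall>i\<in>{..<d}. \<exists>\<delta>>0. \<forall>y\<in>{..<d} \<rightarrow>\<^sub>E UNIV. (\<forall>j<d. \<bar>y j - a j\<bar> < \<delta>) \<longrightarrow> y \<in> \<Theta> \<and> \<bar>partial_deriv i f y - D i\<bar> < \<epsilon>"
      unfolding D_def using continuous_map_box[OF \<Theta> at \<epsilon> cont] by simp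
    from bchoice[OF this] obtain \<Delta> where D': "\<forall>i\<in>{..<d}. 0 < \<Delta> i \<and> (\<forall>y\<in>{..<d} \<rightarrow>\<^sub>E UNIV. (\<forall>j<d. \<bar>y j - a j\<bar> < \<Delta> i) \<longrightarrow> y \<in> \<Theta> \<and> \<bar>partial_deriv i f y - D i\<bar> < \<epsilon>)"
      by (rule exE)
    have \<Delta>: "\<Delta> i > 0" "y \<in> {..<d} \<rightarrow>\<^sub>E UNIV \<Longrightarrow> (\<And>j. j < d \<Longrightarrow> \<bar>y j - a j\<bar> < \<Delta> i) \<Longrightarrow> y \<in> \<Theta> \<and> \<bar>partial_deriv i f y - D i\<bar> < \<epsilon>"
      if "i < d" for i y
      using bspec[OF D', of i] that by simp_all
    define \<delta> where "\<delta> = Min (insert 1 (\<Delta> ` {..<d}))"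
    have fin: "finite (insert 1 (\<Delta> ` {..<d}))" by (intro finite.insertI finite_imageI finite_lessThan)
    have \<delta>0: "\<delta> > 0" unfolding \<delta>_def using \<Delta>(1) fin by (subst Min_gr_iff) auto
    have \<delta>: "y \<in> \<Theta> \<and> \<bar>partial_deriv i f y - D i\<bar> < \<epsilon>"
      if "i < d" "y \<in> {..<d} \<rightarrow>\<^sub>E UNIV" "\<And>j. j < d \<Longrightarrow> \<bar>y j - a j\<bar> < \<delta>" for i y
    proof (rule \<Delta>(2)[OF that(1,2)])
      fix j assume "j < d"
      moreover have "\<delta> \<le> \<Delta> i" unfolding \<delta>_def by (rule Min_le[OF fin]) (use that(1) in blast)
      ultimately show "\<bar>y j - a j\<bar> < \<Delta> i" using that(3)[of j] by linarith
    qed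
    show ?thesis
    proof (intro exI[of _ "\<delta> / m"] conjI allI impI)
      show "\<delta> / m > 0" using \<delta>0 m by simp
      fix s assume s: "\<bar>s - t\<bar> < \<delta> / m"
      define \<tau> where "\<tau> = s - t"
      have small: "\<bar>\<tau> * h i\<bar> < \<delta>" if "i < d" for i
      proof -
        have "\<bar>\<tau> * h i\<bar> \<le> \<bar>\<tau>\<bar> * m" unfolding abs_mult using hm[OF that] by (intro mult_left_mono) auto
        also have "\<dots> < \<delta>" using s m by (simp add: \<tau>_def field_simps)
        finally show ?thesis .
      qed
      \<comment> \<open>A path of \<open>d\<close> axis-parallel moves from \<open>a\<close> to the
        point of parameter \<open>s\<close>: the first \<open>k\<close> coordinates have already
        moved.\<close>
      define z where "z k = (\<lambda>i\<in>{..<d}. if i < k then a i + \<tau> * h i else a i)" for k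
      have zstep: "\<bar>f (z (Suc k)) - f (z k) - \<tau> * (D k * h k)\<bar> \<le> \<epsilon> * (\<bar>\<tau>\<bar> * \<bar>h k\<bar>)" if k: "k < d" for k
      proof -
        define S where "S = {u. \<bar>u - a k\<bar> < \<delta>}"
        \<comment> \<open>After subtraction of the linear part the derivative is at most \<epsilon>
          in absolute value, so the mean value inequality bounds the error itself.\<close>
        define F where "F u = f ((z k)(k := u)) - D k * u" for u
        have Sb: "S = Elementary_Metric_Spaces.ball (a k) \<delta>" by (auto simp: S_def dist_real_def abs_minus_commute)
        have zin: "(z k)(k := u) \<in> \<Theta> \<and> \<bar>partial_deriv k f ((z k)(k := u)) - D k\<bar> < \<epsilon>" if "u \<in> S" for u
        proof (rule \<delta>[OF k])
          show "(z k)(k := u) \<in> {..<d} \<rightarrow>\<^sub>E UNIV" using k by (simp add: z_def PiE_iff extensional_def)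
          show "\<bar>((z k)(k := u)) j - a j\<bar> < \<delta>" if "j < d" for j
            using \<open>u \<in> S\<close> small[OF that] \<delta>0 that by (auto simp: z_def S_def)
        qed
        have dF: "(F has_field_derivative (partial_deriv k f ((z k)(k := u)) - D k)) (at u within S)" if u: "u \<in> S" for u
        proof -
          have "(\<lambda>t. f (((z k)(k := u))(k := t))) field_differentiable at (((z k)(k := u)) k)"
            by (rule diff[OF k]) (use zin[OF u] in blast)
          then have "((\<lambda>t. f ((z k)(k := t))) has_field_derivative partial_deriv k f ((z k)(k := u))) (at u)"
            unfolding partial_deriv_def by (simp add: field_differentiable_derivI)
          then have "(F has_field_derivative (partial_deriv k f ((z k)(k := u)) - D k * 1)) (at u)"
            unfolding F_def by (intro DERIV_diff DERIV_cmult DERIV_ident)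
          then show ?thesis by (simp add: has_field_derivative_at_within)
        qed
        have aS: "a k \<in> S" "a k + \<tau> * h k \<in> S" using small[OF k] \<delta>0 by (auto simp: S_def)
        have "norm (F (a k + \<tau> * h k) - F (a k)) \<le> \<epsilon> * norm ((a k + \<tau> * h k) - a k)"
        proof (rule field_differentiable_bound[of S F])
          show "convex S" by (simp add: Sb)
          show "(F has_field_derivative (partial_deriv k f ((z k)(k := u)) - D k)) (at u within S)" if "u \<in> S" for u
            by (rule dF[OF that])
          show "norm (partial_deriv k f ((z k)(k := u)) - D k) \<le> \<epsilon>" if "u \<in> S" for u
            using zin[OF that] by simp
        qed (use aS in auto)
        moreover have "(z k)(k := a k + \<tau> * h k) = z (Suc k)" "(z k)(k := a k) = z k"
          using k by (simp_all add: z_def fun_eq_iff less_Suc_eq)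
        ultimately show ?thesis by (simp add: F_def abs_mult algebra_simps)
      qed
      have sums: "\<bar>f (z k) - f (z 0) - \<tau> * (\<Sum>i<k. D i * h i)\<bar> \<le> \<epsilon> * (\<bar>\<tau>\<bar> * (\<Sum>i<k. \<bar>h i\<bar>))" if "k \<le> d" for k
        using that
      proof (induction k)
        case (Suc k)
        then have "\<bar>f (z k) - f (z 0) - \<tau> * (\<Sum>i<k. D i * h i)\<bar> \<le> \<epsilon> * (\<bar>\<tau>\<bar> * (\<Sum>i<k. \<bar>h i\<bar>))" by simp
        moreover have "\<bar>f (z (Suc k)) - f (z k) - \<tau> * (D k * h k)\<bar> \<le> \<epsilon> * (\<bar>\<tau>\<bar> * \<bar>h k\<bar>)" using zstep Suc.prems by simp
        moreover have "f (z (Suc k)) - f (z 0) - \<tau> * (\<Sum>i<Suc k. D i * h i)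
           = (f (z k) - f (z 0) - \<tau> * (\<Sum>i<k. D i * h i)) + (f (z (Suc k)) - f (z k) - \<tau> * (D k * h k))"
          by (simp add: algebra_simps)
        moreover have "\<epsilon> * (\<bar>\<tau>\<bar> * (\<Sum>i<Suc k. \<bar>h i\<bar>)) = \<epsilon> * (\<bar>\<tau>\<bar> * (\<Sum>i<k. \<bar>h i\<bar>)) + \<epsilon> * (\<bar>\<tau>\<bar> * \<bar>h k\<bar>)"
          by (simp add: algebra_simps)
        ultimately show ?case by linarith
      qed simp
      have z0: "z 0 = a" by (simp add: z_def fun_eq_iff a_def line_def)
      have zd: "z d = line d x h s" by (simp add: z_def fun_eq_iff a_def line_def \<tau>_def algebra_simps)
      have "\<epsilon> * (\<bar>\<tau>\<bar> * (\<Sum>i<d. \<bar>h i\<bar>)) \<le> \<epsilon> * (\<bar>\<tau>\<bar> * m)"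
        using \<epsilon> by (intro mult_left_mono) (auto simp: m_def)
      also have "\<dots> = e * \<bar>\<tau>\<bar>" using m by (simp add: \<epsilon>_def)
      finally show "\<bar>f (line d x h s) - f a - (s - t) * (\<Sum>i<d. D i * h i)\<bar> \<le> e * \<bar>s - t\<bar>"
        using sums[of d] unfolding z0 zd \<tau>_def by linarith
    qed
  qed
  show ?thesis
    unfolding has_field_derivative_def has_derivative_at_alt
  proof (intro conjI allI impI)
    show "bounded_linear ((*) (\<Sum>i<d. partial_deriv i f (line d x h t) * h i))" by (rule bounded_linear_mult_right)
    fix e :: real assume "0 < e"
    from main[OF this] obtain \<eta> where \<eta>: "\<eta> > 0" "\<And>s. \<bar>s - t\<bar> < \<eta> \<Longrightarrow>
      \<bar>f (line d x h s) - f a - (s - t) * (\<Sum>i<d. D i * h i)\<bar> \<le> e * \<bar>s - t\<bar>" by blast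
    show "\<exists>\<eta>>0. \<forall>y. norm (y - t) < \<eta> \<longrightarrow>
      norm (f (line d x h y) - f (line d x h t) - (\<Sum>i<d. partial_deriv i f (line d x h t) * h i) * (y - t)) \<le> e * norm (y - t)"
    proof (intro exI[of _ \<eta>] conjI allI impI \<eta>(1))
      fix y assume "norm (y - t) < \<eta>"
      then have "\<bar>f (line d x h y) - f a - (y - t) * (\<Sum>i<d. D i * h i)\<bar> \<le> e * \<bar>y - t\<bar>" by (intro \<eta>(2)) simp
      then show "norm (f (line d x h y) - f (line d x h t) - (\<Sum>i<d. partial_deriv i f (line d x h t) * h i) * (y - t)) \<le> e * norm (y - t)"
        unfolding D_def a_def real_norm_def mult.commute[of "y - t"] .
    qed
  qed
qed

text \<open>The k-th derivative of \<open>f\<close> at \<open>x\<close>, evaluated on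
  \<open>k\<close> copies of \<open>h\<close>.\<close>

definition line_deriv :: "nat \<Rightarrow> nat \<Rightarrow> (point \<Rightarrow> real) \<Rightarrow> point \<Rightarrow> point \<Rightarrow> real" where
  "line_deriv d k f h x = (\<Sum>is\<in>indices d k. partial_derivs is f x * (\<Prod>i\<leftarrow>is. h i))"

text \<open>The new derivative becomes the head of the index list, which is how
  \<open>partial_derivs\<close> nests, so the sum over lists of length k + 1 comes out
  directly.\<close>

lemma line_deriv_deriv:
  assumes \<Theta>: "openin (powertop_real {..<d}) \<Theta>" and f: "C_k_on d n \<Theta> f" and k: "k < n"
    and t: "line d x h t \<in> \<Theta>"
  shows "((\<lambda>t. line_deriv d k f h (line d x h t)) has_real_derivative line_deriv d (Suc k) f h (line d x h t)) (at t)"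
proof -
  have 1: "((\<lambda>t. partial_derivs is f (line d x h t)) has_real_derivative
      (\<Sum>i<d. partial_deriv i (partial_derivs is f) (line d x h t) * h i)) (at t)" if "is": "is \<in> indices d k" for "is"
  proof (rule deriv_along_line[OF \<Theta> _ _ t])
    show "(\<lambda>t. partial_derivs is f (x(i := t))) field_differentiable at (x i)" if "i < d" "x \<in> \<Theta>" for i x
      using f k "is" that unfolding C_k_on_def by blast
    show "continuous_map (subtopology (powertop_real {..<d}) \<Theta>) euclideanreal (partial_deriv i (partial_derivs is f))" if "i < d" for i
    proof -
      have "i # is \<in> indices d (Suc k)" using "is" that by (auto simp: indices_def)
      then have "continuous_map (subtopology (powertop_real {..<d}) \<Theta>) euclideanreal (partial_derivs (i # is) f)"
        using f k unfolding C_k_on_def by (meson Suc_leI)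
      then show ?thesis by simp
    qed
  qed
  have "((\<lambda>t. line_deriv d k f h (line d x h t)) has_real_derivative
      (\<Sum>is\<in>indices d k. (\<Sum>i<d. partial_deriv i (partial_derivs is f) (line d x h t) * h i) * (\<Prod>i\<leftarrow>is. h i))) (at t)"
    unfolding line_deriv_def by (intro DERIV_sum DERIV_cmult_right 1)
  also have "(\<Sum>is\<in>indices d k. (\<Sum>i<d. partial_deriv i (partial_derivs is f) (line d x h t) * h i) * (\<Prod>i\<leftarrow>is. h i))
     = line_deriv d (Suc k) f h (line d x h t)"
    unfolding line_deriv_def sum_indices_Suc sum_distrib_right
    by (subst sum.swap) (simp add: mult_ac)
  finally show ?thesis .
qed

lemma line_taylor:
  assumes \<Theta>: "openin (powertop_real {..<d}) \<Theta>" and f: "C_k_on d 4 \<Theta> f"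
    and seg: "\<And>t. 0 \<le> t \<Longrightarrow> t \<le> 1 \<Longrightarrow> line d x h t \<in> \<Theta>"
  obtains \<theta> where "0 < \<theta>" "\<theta> < 1"
    "f (line d x h 1) = f (line d x h 0) + line_deriv d 1 f h (line d x h 0) + line_deriv d 2 f h (line d x h 0) / 2
       + line_deriv d 3 f h (line d x h 0) / 6 + line_deriv d 4 f h (line d x h \<theta>) / 24"
proof -
  let ?F = "\<lambda>m t. line_deriv d m f h (line d x h t)"
  have "\<exists>t>0. t < 1 \<and> ?F 0 1 = (\<Sum>m<4. ?F m 0 / fact m * 1 ^ m) + ?F 4 t / fact 4 * 1 ^ 4"
  proof (rule Maclaurin)
    show "\<forall>m t. m < 4 \<and> 0 \<le> t \<and> t \<le> 1 \<longrightarrow> (?F m has_real_derivative ?F (Suc m) t) (at t)"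
      using line_deriv_deriv[OF \<Theta> f] seg by blast
  qed auto
  then obtain \<theta> where "0 < \<theta>" "\<theta> < 1"
    and e: "?F 0 1 = (\<Sum>m<4. ?F m 0 / fact m * 1 ^ m) + ?F 4 \<theta> / fact 4 * 1 ^ 4" by blast
  moreover have "?F 0 t = f (line d x h t)" for t by (simp add: line_deriv_def indices_0)
  ultimately show ?thesis
    using that[of \<theta>] by (simp add: numeral_eq_Suc fact_numeral)
qed

text \<open>A partial derivative depends on values at nearby points, so each step of the induction
  uses that \<Theta> is open: the identity at the previous order has to hold on a
  neighbourhood.\<close>

lemma C_k_on_cmult:
  assumes \<Theta>: "openin (powertop_real {..<d}) \<Theta>" and f: "C_k_on d k \<Theta> f"
  shows "\<And>is x. is \<in> indices d j \<Longrightarrow> j \<le> k \<Longrightarrow> x \<in> \<Theta> \<Longrightarrow> partial_derivs is (\<lambda>x. c * f x) x = c * partial_derivs is f x"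
    and "C_k_on d k \<Theta> (\<lambda>x. c * f x)"
proof -
  let ?g = "\<lambda>x. c * f x"
  have ev: "eventually (\<lambda>t. x(i := t) \<in> \<Theta>) (nhds (x i))" if x: "x \<in> \<Theta>" and i: "i < d" for x i
  proof -
    obtain \<delta> where \<delta>0: "\<delta> > 0" and \<delta>1: "\<forall>y\<in>{..<d} \<rightarrow>\<^sub>E UNIV. (\<forall>i<d. \<bar>y i - x i\<bar> < \<delta>) \<longrightarrow> y \<in> \<Theta>"
      using openin_box[OF \<Theta> x] by blast
    note \<delta> = \<delta>0 \<delta>1[rule_format]
    have "x \<in> {..<d} \<rightarrow>\<^sub>E UNIV" using openin_subset[OF \<Theta>] x by auto
    then have "x(i := t) \<in> \<Theta>" if "dist t (x i) < \<delta>" for t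
      using that \<delta>(1) i by (intro \<delta>(2)) (auto simp: dist_real_def PiE_iff extensional_def)
    then show ?thesis unfolding eventually_nhds_metric using \<delta>(1) by blast
  qed
  have main: "(\<forall>is\<in>indices d j. \<forall>x\<in>\<Theta>. partial_derivs is ?g x = c * partial_derivs is f x)" if "j \<le> k" for j
    using that
  proof (induction j)
    case (Suc j)
    show ?case
    proof (intro ballI)
      fix js x assume js: "js \<in> indices d (Suc j)" and x: "x \<in> \<Theta>"
      obtain i "is" where e: "js = i # is" "i < d" "is \<in> indices d j" using js by (auto simp: indices_Suc)
      have dif: "(\<lambda>t. partial_derivs is f (x(i := t))) field_differentiable at (x i)"
        using f Suc.prems e x unfolding C_k_on_def by (meson Suc_le_lessD)
      have "eventually (\<lambda>t. partial_derivs is ?g (x(i := t)) = c * partial_derivs is f (x(i := t))) (nhds (x i))"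
        using ev[OF x e(2)] by eventually_elim (use Suc e in auto)
      then have "partial_derivs js ?g x = deriv (\<lambda>t. c * partial_derivs is f (x(i := t))) (x i)"
        unfolding e partial_derivs.simps partial_deriv_def by (rule deriv_cong_ev) simp
      also have "\<dots> = c * partial_derivs js f x"
        unfolding e partial_derivs.simps partial_deriv_def by (rule deriv_cmult[OF dif])
      finally show "partial_derivs js ?g x = c * partial_derivs js f x" .
    qed
  qed (simp add: indices_0)
  then show "\<And>is x. is \<in> indices d j \<Longrightarrow> j \<le> k \<Longrightarrow> x \<in> \<Theta> \<Longrightarrow> partial_derivs is ?g x = c * partial_derivs is f x" by blast
  show "C_k_on d k \<Theta> ?g"
    unfolding C_k_on_def
  proof (intro conjI allI impI ballI)
    fix j "is" i x assume a: "j < k" "is \<in> indices d j" "i < d" "x \<in> \<Theta>"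
    have "(\<lambda>t. partial_derivs is f (x(i := t))) field_differentiable at (x i)"
      using f a unfolding C_k_on_def by blast
    then obtain D where "((\<lambda>t. partial_derivs is f (x(i := t))) has_field_derivative D) (at (x i))"
      unfolding field_differentiable_def by blast
    then have dc: "((\<lambda>t. c * partial_derivs is f (x(i := t))) has_field_derivative c * D) (at (x i))"
      by (rule DERIV_cmult)
    have evc: "eventually (\<lambda>t. c * partial_derivs is f (x(i := t)) = partial_derivs is ?g (x(i := t))) (nhds (x i))"
      using ev[OF a(4,3)] by eventually_elim (use main[of j] a in auto)
    have "((\<lambda>t. partial_derivs is ?g (x(i := t))) has_field_derivative c * D) (at (x i))"
      by (rule iffD1[OF DERIV_cong_ev[OF refl evc refl] dc])
    then show "(\<lambda>t. partial_derivs is ?g (x(i := t))) field_differentiable at (x i)"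
      unfolding field_differentiable_def by blast
  next
    fix j "is" assume a: "j \<le> k" "is \<in> indices d j"
    have "continuous_map (subtopology (powertop_real {..<d}) \<Theta>) euclideanreal (partial_derivs is f)"
      using f a unfolding C_k_on_def by blast
    then have "continuous_map (subtopology (powertop_real {..<d}) \<Theta>) euclideanreal (\<lambda>x. c * partial_derivs is f x)"
      by (intro continuous_map_real_mult) auto
    then show "continuous_map (subtopology (powertop_real {..<d}) \<Theta>) euclideanreal (partial_derivs is ?g)"
      by (rule continuous_map_eq) (use main[OF a(1)] a in auto)
  qed
qed

subsection \<open>Measurability, tensor norms and compact ellipsoids\<close>

text \<open>The product sigma-algebra and the topology \<open>powertop_real {..<d}\<close> are
  linked through the full function type \<open>nat \<Rightarrow> real\<close>, where measurability
  into Borel sets is tested coordinatewise: extension by 0 is measurable into it, and restriction is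
  continuous out of it.\<close>

lemma openin_measurable:
  assumes S: "openin (powertop_real {..<d}) S"
  shows "S \<in> sets (lborel_dim d)"
proof -
  define T where "T = {y :: nat \<Rightarrow> real. restrict y {..<d} \<in> S}"
  have cont: "continuous_map euclidean (powertop_real {..<d}) (\<lambda>y :: nat \<Rightarrow> real. restrict y {..<d})"
    unfolding continuous_map_componentwise
  proof (intro conjI ballI)
    show "continuous_map euclidean euclideanreal (\<lambda>y :: nat \<Rightarrow> real. restrict y {..<d} k)" if "k \<in> {..<d}" for k
    proof -
      have "continuous_map (powertop_real UNIV) euclideanreal (\<lambda>y :: nat \<Rightarrow> real. y k)"
        by (rule continuous_map_product_projection) simp
      then show ?thesis using that by (simp add: euclidean_product_topology)
    qed
  qed auto
  have "openin euclidean {y \<in> topspace euclidean. restrict y {..<d} \<in> S}"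
    by (rule openin_continuous_map_preimage[OF cont S])
  then have "open T" by (simp only: T_def open_openin topspace_euclidean UNIV_I simp_thms)
  then have T: "T \<in> sets borel" by simp
  define e where "e x = (\<lambda>i. if i < d then x i else 0 :: real)" for x :: point
  have "e \<in> borel_measurable (lborel_dim d)"
    unfolding e_def
  proof (rule measurable_coordinatewise_then_product)
    show "(\<lambda>x. if i < d then x i else 0) \<in> borel_measurable (lborel_dim d)" for i
      by (cases "i < d") simp_all
  qed
  from measurable_sets[OF this T] have "e -` T \<inter> space (lborel_dim d) \<in> sets (lborel_dim d)" .
  also have "e -` T \<inter> space (lborel_dim d) = S"
  proof (rule Set.set_eqI)
    fix x
    show "x \<in> e -` T \<inter> space (lborel_dim d) \<longleftrightarrow> x \<in> S"
    proof (cases "x \<in> {..<d} \<rightarrow>\<^sub>E UNIV")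
      case True
      then have "restrict (e x) {..<d} = x"
        by (intro ext) (auto simp: e_def PiE_iff extensional_def)
      then show ?thesis using True by (simp add: T_def)
    next
      case False
      then show ?thesis using openin_subset[OF S] by auto
    qed
  qed
  finally show ?thesis .
qed

lemma continuous_map_measurable:
  assumes \<Theta>: "openin (powertop_real {..<d}) \<Theta>"
    and f: "continuous_map (subtopology (powertop_real {..<d}) \<Theta>) euclideanreal f"
  shows "(\<lambda>x. indicator \<Theta> x * f x) \<in> borel_measurable (lborel_dim d)"
proof -
  have sub: "\<Theta> \<subseteq> space (lborel_dim d)" using openin_subset[OF \<Theta>] by simp
  have "f \<in> borel_measurable (restrict_space (lborel_dim d) \<Theta>)"
  proof (rule borel_measurableI)
    fix S :: "real set" assume "open S"
    then have "openin euclideanreal S" by (simp only: open_openin)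
    then have "openin (subtopology (powertop_real {..<d}) \<Theta>) {x \<in> topspace (subtopology (powertop_real {..<d}) \<Theta>). f x \<in> S}"
      by (rule openin_continuous_map_preimage[OF f])
    then have o: "openin (powertop_real {..<d}) {x \<in> topspace (subtopology (powertop_real {..<d}) \<Theta>). f x \<in> S}"
      using \<Theta> by (simp add: openin_open_subtopology)
    have "{x \<in> topspace (subtopology (powertop_real {..<d}) \<Theta>). f x \<in> S} = f -` S \<inter> space (restrict_space (lborel_dim d) \<Theta>)"
      using sub by (intro Set.set_eqI) (auto simp: space_restrict_space)
    with openin_measurable[OF o] have "f -` S \<inter> space (restrict_space (lborel_dim d) \<Theta>) \<in> sets (lborel_dim d)" by simp
    then show "f -` S \<inter> space (restrict_space (lborel_dim d) \<Theta>) \<in> sets (restrict_space (lborel_dim d) \<Theta>)"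
      using openin_measurable[OF \<Theta>] sub by (subst sets_restrict_space_iff) (auto simp: space_restrict_space Int_absorb2)
  qed
  then have "(\<lambda>x. indicator \<Theta> x *\<^sub>R f x) \<in> borel_measurable (lborel_dim d)"
    using openin_measurable[OF \<Theta>] sub by (subst (asm) borel_measurable_restrict_space_iff) (auto simp: Int_absorb2)
  then show ?thesis by simp
qed

section \<open>Boundedness and homogeneity of tensor norms\<close>

lemma wnorm_form:
  assumes "A \<in> carrier_mat d d" "u \<in> carrier_vec d"
  shows "wnorm A u = sqrt (bilf d (\<lambda>i j. A $$ (i, j)) (\<lambda>i. u $ i) (\<lambda>i. u $ i))"
  unfolding wnorm_def quad_vec[OF assms assms(2)] ..

lemma bilf_cong: "(\<And>i. i < d \<Longrightarrow> x i = x' i) \<Longrightarrow> (\<And>i. i < d \<Longrightarrow> y i = y' i) \<Longrightarrow> bilf d A x y = bilf d A x' y'"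
  unfolding bilf_def by (intro sum.cong refl) auto

lemma abs_prod_list_le:
  fixes f :: "'a \<Rightarrow> real"
  assumes "\<And>i. i \<in> set is \<Longrightarrow> \<bar>f i\<bar> \<le> C"
  shows "\<bar>\<Prod>i\<leftarrow>is. f i\<bar> \<le> C ^ length is"
  using assms
proof (induction "is")
  case (Cons i "is")
  then have "\<bar>f i\<bar> * \<bar>\<Prod>i\<leftarrow>is. f i\<bar> \<le> C * C ^ length is"
    by (intro mult_mono) (auto intro: order_trans[OF abs_ge_zero])
  then show ?case by (simp add: abs_mult)
qed simp

lemma prod_list_scale: "(\<Prod>i\<leftarrow>is. f i / a) = (\<Prod>i\<leftarrow>is. f i) / a ^ length is" for f :: "'a \<Rightarrow> real"
  by (induction "is") (simp_all add: field_simps)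

text \<open>\<open>C\<close> does not depend on the tensor. This gives finiteness of
  \<open>tensor_norm\<close> and, for tensors varying over a compact set, of the supremum in
  \<open>eps4\<close>.\<close>

lemma tensor_inner_bound:
  assumes d: "d \<ge> 1" and H: "pos_def d H"
  obtains C where "C \<ge> 0" "\<And>k T u. u \<in> carrier_vec d \<Longrightarrow> wnorm H u = 1 \<Longrightarrow>
    \<bar>tensor_inner d k T (tensor_power u)\<bar> \<le> C ^ k * (\<Sum>is\<in>indices d k. \<bar>T is\<bar>)"
proof -
  interpret pos_def_form d "\<lambda>i j. H $$ (i, j)" by (rule pos_def_form[OF d H])
  have Hc: "H \<in> carrier_mat d d" using H by (simp add: pos_def_def)
  obtain C where C: "C > 0" "\<And>x i. i < d \<Longrightarrow> (x i)\<^sup>2 \<le> C * q x" by (rule coord_bound) blast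
  have "\<bar>tensor_inner d k T (tensor_power u)\<bar> \<le> sqrt C ^ k * (\<Sum>is\<in>indices d k. \<bar>T is\<bar>)"
    if u: "u \<in> carrier_vec d" "wnorm H u = 1" for k T u
  proof -
    have "q (\<lambda>i. u $ i) = 1" using u(2) unfolding wnorm_form[OF Hc u(1)] by simp
    then have ui: "\<bar>u $ i\<bar> \<le> sqrt C" if "i < d" for i
      using C(2)[OF that, of "\<lambda>i. u $ i"] by (simp add: real_le_rsqrt)
    have "\<bar>tensor_inner d k T (tensor_power u)\<bar> \<le> (\<Sum>is\<in>indices d k. \<bar>T is\<bar> * sqrt C ^ k)"
      unfolding tensor_inner_def
    proof (rule order_trans[OF sum_abs], rule sum_mono)
      fix "is" assume i: "is \<in> indices d k"
      then have "\<bar>tensor_power u is\<bar> \<le> sqrt C ^ length is"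
        unfolding tensor_power_def by (intro abs_prod_list_le ui) (auto simp: indices_def)
      then show "\<bar>T is * tensor_power u is\<bar> \<le> \<bar>T is\<bar> * sqrt C ^ k"
        using i unfolding abs_mult by (intro mult_left_mono) (auto simp: indices_def)
    qed
    then show ?thesis by (simp only: sum_distrib_left mult.commute)
  qed
  then show ?thesis using that[of "sqrt C"] C(1) by simp
qed

lemma unit_sphere_nonempty:
  assumes d: "d \<ge> 1" and H: "pos_def d H"
  shows "{u \<in> carrier_vec d. wnorm H u = 1} \<noteq> {}"
proof -
  have Hc: "H \<in> carrier_mat d d" using H by (simp add: pos_def_def)
  define e where "e = (unit_vec d 0 :: real vec)"
  have e: "e \<in> carrier_vec d" "e \<noteq> 0\<^sub>v d" using d by (auto simp: e_def)
  define a where "a = wnorm H e"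
  have a: "a > 0" using H e by (simp add: a_def wnorm_def pos_def_def)
  define u where "u = (1 / a) \<cdot>\<^sub>v e"
  have "u \<bullet> (H *\<^sub>v u) = (1 / a)\<^sup>2 * (e \<bullet> (H *\<^sub>v e))"
    using e Hc by (simp add: u_def mult_mat_vec power2_eq_square)
  also have "e \<bullet> (H *\<^sub>v e) = a\<^sup>2" using H e by (simp add: a_def wnorm_def pos_def_def less_imp_le)
  finally have "wnorm H u = 1" using a by (simp add: wnorm_def power_divide)
  moreover have "u \<in> carrier_vec d" using e by (simp add: u_def)
  ultimately show ?thesis by blast
qed

lemma tensor_norm_bdd:
  assumes d: "d \<ge> 1" and H: "pos_def d H"
  shows "bdd_above ((\<lambda>u. \<bar>tensor_inner d k T (tensor_power u)\<bar>) ` {u \<in> carrier_vec d. wnorm H u = 1})"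
proof -
  obtain C where "C \<ge> 0" and C: "\<And>k T u. u \<in> carrier_vec d \<Longrightarrow> wnorm H u = 1 \<Longrightarrow>
    \<bar>tensor_inner d k T (tensor_power u)\<bar> \<le> C ^ k * (\<Sum>is\<in>indices d k. \<bar>T is\<bar>)"
    by (rule tensor_inner_bound[OF d H]) blast
  show ?thesis by (rule bdd_aboveI2[of _ _ "C ^ k * (\<Sum>is\<in>indices d k. \<bar>T is\<bar>)"]) (use C in simp)
qed

lemma tensor_norm_nonneg:
  assumes d: "d \<ge> 1" and H: "pos_def d H"
  shows "0 \<le> tensor_norm d k H T"
proof -
  obtain u where u: "u \<in> {u \<in> carrier_vec d. wnorm H u = 1}" using unit_sphere_nonempty[OF d H] by blast
  have "0 \<le> \<bar>tensor_inner d k T (tensor_power u)\<bar>" by simp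
  also have "\<dots> \<le> tensor_norm d k H T"
    unfolding tensor_norm_def by (rule cSUP_upper[OF u tensor_norm_bdd[OF d H]])
  finally show ?thesis .
qed

lemma tensor_inner_le:
  assumes d: "d \<ge> 1" and H: "pos_def d H" and k: "k \<ge> 1" and u: "u \<in> carrier_vec d"
  shows "\<bar>tensor_inner d k T (tensor_power u)\<bar> \<le> tensor_norm d k H T * wnorm H u ^ k"
proof -
  interpret pos_def_form d "\<lambda>i j. H $$ (i, j)" by (rule pos_def_form[OF d H])
  have Hc: "H \<in> carrier_mat d d" using H by (simp add: pos_def_def)
  define a where "a = wnorm H u"
  have aq: "a = sqrt (q (\<lambda>i. u $ i))" unfolding a_def by (rule wnorm_form[OF Hc u])
  show ?thesis
  proof (cases "a = 0")
    case True
    then have z: "u $ i = 0" if "i < d" for i using aq that q_eq_0_iff[of "\<lambda>i. u $ i"] by simp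
    have "tensor_power u is = 0" if "is": "is \<in> indices d k" for "is"
    proof -
      obtain i js where "is = i # js" "i < d" using "is" k by (cases "is") (auto simp: indices_def)
      then show ?thesis using z by (simp add: tensor_power_def)
    qed
    then have "tensor_inner d k T (tensor_power u) = 0" by (simp add: tensor_inner_def)
    moreover have "0 < k" using k by simp
    ultimately show ?thesis using True by (simp add: a_def[symmetric] zero_power)
  next
    case False
    then have a: "a > 0" using aq by (simp add: less_le)
    define w where "w = vec d (\<lambda>i. u $ i / a)"
    have wc: "w \<in> carrier_vec d" by (simp add: w_def)
    have "q (\<lambda>i. w $ i) = q (\<lambda>i. (1 / a) * u $ i)" by (rule bilf_cong) (simp_all add: w_def)
    also have "\<dots> = (1 / a)\<^sup>2 * a\<^sup>2" unfolding q_scale using aq by simp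
    finally have "wnorm H w = 1" unfolding wnorm_form[OF Hc wc] using a by (simp add: power_divide)
    then have w: "w \<in> {u \<in> carrier_vec d. wnorm H u = 1}" using wc by simp
    have tp: "tensor_power w is = tensor_power u is / a ^ k" if "is \<in> indices d k" for "is"
    proof -
      have "tensor_power w is = (\<Prod>i\<leftarrow>is. u $ i / a)"
        unfolding tensor_power_def using that
        by (intro arg_cong[of _ _ prod_list] map_cong refl) (auto simp: w_def indices_def)
      also have "\<dots> = tensor_power u is / a ^ k"
        using that unfolding prod_list_scale by (simp add: tensor_power_def indices_def)
      finally show ?thesis .
    qed
    have "tensor_inner d k T (tensor_power w) = tensor_inner d k T (tensor_power u) / a ^ k"
      unfolding tensor_inner_def sum_divide_distrib by (rule sum.cong) (simp_all add: tp)
    moreover have "\<bar>tensor_inner d k T (tensor_power w)\<bar> \<le> tensor_norm d k H T"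
      unfolding tensor_norm_def by (rule cSUP_upper[OF w tensor_norm_bdd[OF d H]])
    ultimately show ?thesis using a by (simp add: a_def[symmetric] divide_le_eq)
  qed
qed

lemma line_deriv_tensor:
  "line_deriv d k f h x = tensor_inner d k (deriv_tensor f x) (tensor_power (vec d h))"
  unfolding line_deriv_def tensor_inner_def deriv_tensor_def tensor_power_def
proof (rule sum.cong[OF refl])
  fix "is" assume "is \<in> indices d k"
  then have "map h is = map (($) (vec d h)) is" by (intro map_cong refl) (auto simp: indices_def)
  then have "prod_list (map h is) = (\<Prod>i\<leftarrow>is. vec d h $ i)" by (rule arg_cong)
  then show "partial_derivs is f x * prod_list (map h is) = partial_derivs is f x * (\<Prod>i\<leftarrow>is. vec d h $ i)" by (simp only:)
qed

context pos_def_form begin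

text \<open>By \<open>coord_bound\<close> the ellipsoid is a closed subset of a compact box.\<close>

lemma compactin_ellipsoid:
  "compactin (powertop_real {..<d}) {x \<in> {..<d} \<rightarrow>\<^sub>E UNIV. q (\<lambda>i. x i - z i) \<le> r}" (is "compactin ?T ?E")
proof -
  obtain C where C: "C > 0" "\<And>x i. i < d \<Longrightarrow> (x i)\<^sup>2 \<le> C * q x" by (rule coord_bound) blast
  define b where "b = sqrt (C * \<bar>r\<bar>)"
  have "compactin ?T (Pi\<^sub>E {..<d} (\<lambda>i. {z i - b..z i + b}))"
    unfolding compactin_PiE by simp
  moreover have "?E \<subseteq> Pi\<^sub>E {..<d} (\<lambda>i. {z i - b..z i + b})"
  proof
    fix x assume x: "x \<in> ?E"
    have ab: "\<bar>x i - z i\<bar> \<le> b" if "i < d" for i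
    proof -
      have "(x i - z i)\<^sup>2 \<le> C * q (\<lambda>i. x i - z i)" by (rule C(2)[OF that])
      also have "\<dots> \<le> C * \<bar>r\<bar>" using x C by (intro mult_left_mono) auto
      finally show ?thesis unfolding b_def by (intro real_le_rsqrt) simp
    qed
    have "z i - b \<le> x i \<and> x i \<le> z i + b" if "i < d" for i using ab[OF that] by (simp add: abs_le_iff)
    then show "x \<in> Pi\<^sub>E {..<d} (\<lambda>i. {z i - b..z i + b})" using x by (simp add: PiE_iff)
  qed
  moreover have "closedin ?T ?E"
  proof -
    have "continuous_map ?T euclideanreal (\<lambda>x. q (\<lambda>i. x i - z i))"
      unfolding bilf_def
      by (intro continuous_map_sum continuous_map_real_mult continuous_map_diff continuous_map_product_projection) auto
    then have "closedin ?T {x \<in> topspace ?T. q (\<lambda>i. x i - z i) \<in> {..r}}"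
      by (rule closedin_continuous_map_preimage) (simp only: closed_closedin[symmetric] closed_atMost)
    then show ?thesis by (simp only: topspace_product_topology topspace_euclidean atMost_iff)
  qed
  ultimately show ?thesis by (rule closed_compactin)
qed

end

lemma compactin_bounded:
  assumes K: "compactin (powertop_real {..<d}) K" and sub: "K \<subseteq> \<Theta>"
    and f: "continuous_map (subtopology (powertop_real {..<d}) \<Theta>) euclideanreal f"
  shows "\<exists>B. \<forall>x\<in>K. \<bar>f x\<bar> \<le> B"
proof -
  have "compactin (subtopology (powertop_real {..<d}) \<Theta>) K" using K sub by (simp add: compactin_subtopology)
  then have "compactin euclideanreal (f ` K)" by (rule image_compactin[OF _ f])
  then have "compact (f ` K)" by simp
  then have "bounded (f ` K)" by (rule compact_imp_bounded)
  then show ?thesis unfolding bounded_iff by simp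
qed

subsection \<open>The target measure\<close>

locale laplace_setup =
  fixes d :: nat and n :: real and \<Theta> :: "point set" and v :: "point \<Rightarrow> real" and xhat :: point
    and s0 c0 s a M :: real
  assumes d1: "d \<ge> 1" and n0: "n > 0" and \<Theta>: "openin (powertop_real {..<d}) \<Theta>"
    and A1: "assumption_A1 d \<Theta> v xhat" and A2: "assumption_A2 a d n \<Theta> v xhat s0 c0"
    and a0: "a > 0" and s_ge: "s \<ge> s_star s0 c0" and region: "local_region d n v xhat s \<subseteq> \<Theta>"
    and eps3_le: "eps3 d n v xhat \<le> M" and eps4_le: "eps4 d n v xhat s \<le> M"
begin

definition V where "V = (\<lambda>x. n * v x)"
definition Hm where "Hm = hessian d V xhat"
definition A where "A = (\<lambda>i j. Hm $$ (i, j))"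

lemma xhat_in: "xhat \<in> \<Theta>" and v_min: "x \<in> \<Theta> \<Longrightarrow> v xhat \<le> v x"
proof -
  have "is_arg_min v (\<lambda>x. x \<in> \<Theta>) xhat" using A1 unfolding assumption_A1_def by blast
  then show "xhat \<in> \<Theta>" "x \<in> \<Theta> \<Longrightarrow> v xhat \<le> v x" by (auto simp: is_arg_min_def not_less)
qed

lemma \<Theta>_sub: "\<Theta> \<subseteq> {..<d} \<rightarrow>\<^sub>E UNIV"
  using openin_subset[OF \<Theta>] by simp

lemma C4_v: "C_k_on d 4 \<Theta> v" using A1 by (simp add: assumption_A1_def)

lemma C4: "C_k_on d 4 \<Theta> V" unfolding V_def by (rule C_k_on_cmult(2)[OF \<Theta> C4_v])

lemma Hm_entry: "i < d \<Longrightarrow> j < d \<Longrightarrow> Hm $$ (i, j) = n * hessian d v xhat $$ (i, j)"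
proof -
  assume ij: "i < d" "j < d"
  have "partial_derivs [i, j] (\<lambda>x. n * v x) xhat = n * partial_derivs [i, j] v xhat"
    by (rule C_k_on_cmult(1)[OF \<Theta> C4_v, of _ 2]) (use ij xhat_in in \<open>auto simp: indices_def\<close>)
  then show ?thesis using ij by (simp add: Hm_def hessian_def V_def)
qed

lemma Hv_pos: "pos_def d (hessian d v xhat)" using A1 by (simp add: assumption_A1_def)

lemma Hm_carrier: "Hm \<in> carrier_mat d d" by (simp add: Hm_def hessian_def)

lemma Hv_carrier: "hessian d v xhat \<in> carrier_mat d d" by (simp add: hessian_def)

lemma bilf_A: "bilf d A x y = n * bilf d (\<lambda>i j. hessian d v xhat $$ (i, j)) x y"
  unfolding bilf_def A_def sum_distrib_left by (intro sum.cong refl) (simp add: Hm_entry)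

lemma Hm_pos: "pos_def d Hm"
  unfolding pos_def_def
proof (intro conjI ballI impI)
  show "Hm \<in> carrier_mat d d" by (rule Hm_carrier)
  show "transpose_mat Hm = Hm"
    by (rule eq_matI) (use Hm_carrier pos_def_sym[OF Hv_pos] in \<open>auto simp: Hm_entry\<close>)
  fix u :: "real vec" assume u: "u \<in> carrier_vec d" "u \<noteq> 0\<^sub>v d"
  have "u \<bullet> (Hm *\<^sub>v u) = n * (u \<bullet> (hessian d v xhat *\<^sub>v u))"
    unfolding quad_vec[OF Hm_carrier u(1) u(1)] quad_vec[OF Hv_carrier u(1) u(1)] bilf_A[symmetric] A_def ..
  moreover have "u \<bullet> (hessian d v xhat *\<^sub>v u) > 0" using Hv_pos u unfolding pos_def_def by blast
  ultimately show "u \<bullet> (Hm *\<^sub>v u) > 0" using n0 by simp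
qed

sublocale pos_def_form d A
  unfolding A_def by (rule pos_def_form[OF d1 Hm_pos])

lemma wnorm_Hv: "wnorm (hessian d v xhat) (point_diff d x xhat) = sqrt (q (\<lambda>i. x i - xhat i) / n)"
proof -
  have c: "point_diff d x xhat \<in> carrier_vec d" by (simp add: point_diff_def)
  have "bilf d (\<lambda>i j. hessian d v xhat $$ (i, j)) (\<lambda>i. point_diff d x xhat $ i) (\<lambda>i. point_diff d x xhat $ i)
      = bilf d (\<lambda>i j. hessian d v xhat $$ (i, j)) (\<lambda>i. x i - xhat i) (\<lambda>i. x i - xhat i)"
    by (rule bilf_cong) (simp_all add: point_diff_def)
  then show ?thesis unfolding wnorm_form[OF Hv_carrier c] bilf_A using n0 by simp
qed

lemma local_region_eq:
  assumes "s' \<ge> 0"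
  shows "local_region d n v xhat s' = {x \<in> {..<d} \<rightarrow>\<^sub>E UNIV. q (\<lambda>i. x i - xhat i) \<le> s'\<^sup>2 * d}"
proof -
  have "sqrt (q (\<lambda>i. x i - xhat i) / n) \<le> s' * sqrt (d / n) \<longleftrightarrow> q (\<lambda>i. x i - xhat i) \<le> s'\<^sup>2 * d" for x
  proof -
    have "s' * sqrt (d / n) = sqrt (s'\<^sup>2 * (d / n))" using assms by (simp only: real_sqrt_mult real_sqrt_abs abs_of_nonneg)
    then show ?thesis using n0 by (simp add: field_simps)
  qed
  then show ?thesis unfolding local_region_def wnorm_Hv by simp
qed

lemma c0: "0 < c0" "c0 \<le> 1" "a / sqrt d < c0" and s0: "s0 > 0"
  and growth: "x \<in> \<Theta> \<Longrightarrow> x \<notin> local_region d n v xhat s0 \<Longrightarrow>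
    v x - v xhat \<ge> c0 * sqrt (d / n) * sqrt (q (\<lambda>i. x i - xhat i) / n)"
proof -
  show "s0 > 0" "c0 \<le> 1" "a / sqrt d < c0" using A2 by (auto simp: assumption_A2_def)
  have "0 < a / sqrt d" using a0 d1 by simp
  then show "0 < c0" using \<open>a / sqrt d < c0\<close> by linarith
  show "x \<in> \<Theta> \<Longrightarrow> x \<notin> local_region d n v xhat s0 \<Longrightarrow>
    v x - v xhat \<ge> c0 * sqrt (d / n) * sqrt (q (\<lambda>i. x i - xhat i) / n)"
    using A2 unfolding assumption_A2_def wnorm_Hv by blast
qed

lemma s_bounds: "s \<ge> s0" "s \<ge> 8 / c0 * ln (2 * exp 1 / c0)" "s \<ge> 4"
proof -
  show "s \<ge> s0" and b: "s \<ge> 8 / c0 * ln (2 * exp 1 / c0)" using s_ge by (auto simp: s_star_def)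
  have "exp 1 \<le> 2 * exp 1 / c0" using c0 by (simp add: field_simps)
  then have "1 \<le> ln (2 * exp 1 / c0)" using c0 by (simp add: ln_ge_iff)
  moreover have "8 \<le> 8 / c0" using c0 by (simp add: field_simps)
  ultimately have "8 * 1 \<le> 8 / c0 * ln (2 * exp 1 / c0)" using c0(1) by (intro mult_mono) auto
  then show "s \<ge> 4" using b by linarith
qed

text \<open>The factor 1 gives the map the shape of \<open>integral_affine_point\<close>.\<close>

definition sh where "sh y = (\<lambda>i\<in>{..<d}. 1 * y i + xhat i)"

lemma sh_line: "sh y = line d xhat y 1"
  by (simp add: sh_def line_def add.commute)

lemma line_0: "line d xhat y 0 = xhat"
  using \<Theta>_sub xhat_in by (auto simp: line_def fun_eq_iff PiE_iff extensional_def)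

lemma q_line: "q (\<lambda>i. line d xhat y t i - xhat i) = t\<^sup>2 * q y"
proof -
  have "q (\<lambda>i. line d xhat y t i - xhat i) = q (\<lambda>i. t * y i)" by (rule bilf_cong) (simp_all add: line_def)
  then show ?thesis by (simp only: q_scale)
qed

lemma line_in_region:
  assumes "y \<in> qball s" "0 \<le> t" "t \<le> 1"
  shows "line d xhat y t \<in> local_region d n v xhat s"
proof -
  have "t\<^sup>2 \<le> 1" using assms by (simp add: power_le_one)
  then have "t\<^sup>2 * q y \<le> 1 * q y" by (rule mult_right_mono) simp
  then show ?thesis using assms(1) s_bounds s0 by (simp add: local_region_eq q_line qball_def)
qed

lemma sh_region: "sh y \<in> local_region d n v xhat s' \<longleftrightarrow> y \<in> qball s'" if "s' \<ge> 0"
  unfolding sh_line local_region_eq[OF that] using q_line[of y 1] by (simp add: qball_def)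

section \<open>Taylor expansion at the minimiser\<close>

lemma gradient_zero: "line_deriv d 1 V y xhat = 0"
proof -
  have deriv: "((\<lambda>t. V (line d xhat y t)) has_real_derivative line_deriv d 1 V y xhat) (at 0)"
    using line_deriv_deriv[OF \<Theta> C4, of 0 xhat y 0] xhat_in by (simp add: line_0 line_deriv_def indices_0)
  obtain \<delta> where \<delta>: "\<delta> > 0" "\<forall>x\<in>{..<d} \<rightarrow>\<^sub>E UNIV. (\<forall>i<d. \<bar>x i - xhat i\<bar> < \<delta>) \<longrightarrow> x \<in> \<Theta>"
    using openin_box[OF \<Theta> xhat_in] by (elim exE conjE)
  define m where "m = 1 + (\<Sum>i<d. \<bar>y i\<bar>)"
  have m: "m > 0" unfolding m_def by (intro add_pos_nonneg sum_nonneg) auto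
  have pos: "0 < \<delta> / m" using \<delta> m by simp
  have min: "\<forall>t. \<bar>0 - t\<bar> < \<delta> / m \<longrightarrow> V (line d xhat y 0) \<le> V (line d xhat y t)"
  proof (intro allI impI)
    fix t :: real assume t: "\<bar>0 - t\<bar> < \<delta> / m"
    have "\<bar>line d xhat y t i - xhat i\<bar> < \<delta>" if "i < d" for i
    proof -
      have "\<bar>y i\<bar> \<le> (\<Sum>i<d. \<bar>y i\<bar>)" by (rule member_le_sum) (use that in auto)
      then have "\<bar>y i\<bar> \<le> m" by (simp add: m_def)
      then have "\<bar>t\<bar> * \<bar>y i\<bar> \<le> \<bar>t\<bar> * m" by (intro mult_left_mono) auto
      also have "\<dots> < \<delta>" using t m by (simp add: field_simps)
      finally show ?thesis using that by (simp add: line_def abs_mult)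
    qed
    then have "line d xhat y t \<in> \<Theta>" using \<delta>(2) by simp
    then show "V (line d xhat y 0) \<le> V (line d xhat y t)"
      unfolding line_0 V_def using v_min n0 by (intro mult_left_mono) auto
  qed
  show ?thesis by (rule DERIV_local_min[OF deriv pos min])
qed

definition cc where "cc i j k = partial_derivs [i, j, k] V xhat / 6"

lemma line_deriv_2: "line_deriv d 2 V y xhat = q y"
  unfolding line_deriv_def sum_indices_2 bilf_def
  by (intro sum.cong refl) (simp add: A_def Hm_def hessian_def mult.assoc)

lemma line_deriv_3: "line_deriv d 3 V y xhat / 6 = cubic d cc y"
  unfolding line_deriv_def sum_indices_3 cubic_def cc_def sum_divide_distrib
  by (intro sum.cong refl) (simp add: mult.assoc)

abbreviation e3 where "e3 \<equiv> eps3 d n v xhat"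
abbreviation e4 where "e4 \<equiv> eps4 d n v xhat s"

lemma e3_eq: "e3 = d * tensor_norm d 3 Hm (deriv_tensor V xhat)"
  by (simp add: eps3_def Let_def Hm_def V_def)

lemma wnorm_vec: "wnorm Hm (vec d y) = sqrt (q y)"
proof -
  have "bilf d (\<lambda>i j. Hm $$ (i, j)) (\<lambda>i. vec d y $ i) (\<lambda>i. vec d y $ i) = q y"
    unfolding A_def by (rule bilf_cong) simp_all
  then show ?thesis using wnorm_form[OF Hm_carrier, of "vec d y"] by simp
qed

lemma e3_nonneg: "0 \<le> e3"
  unfolding e3_eq using tensor_norm_nonneg[OF d1 Hm_pos] by simp

lemma cubic_bound: "\<bar>cubic d cc y\<bar> \<le> e3 * (q y * sqrt (q y)) / (6 * real d)"
proof -
  have "\<bar>line_deriv d 3 V y xhat\<bar> \<le> tensor_norm d 3 Hm (deriv_tensor V xhat) * sqrt (q y) ^ 3"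
    unfolding line_deriv_tensor wnorm_vec[symmetric] by (rule tensor_inner_le[OF d1 Hm_pos]) simp_all
  also have "sqrt (q y) ^ 3 = q y * sqrt (q y)" by (simp add: power3_eq_cube)
  finally have "\<bar>line_deriv d 3 V y xhat / 6\<bar> \<le> tensor_norm d 3 Hm (deriv_tensor V xhat) * (q y * sqrt (q y)) / 6" by simp
  also have "\<dots> = e3 * (q y * sqrt (q y)) / (6 * real d)" unfolding e3_eq using d1 by simp
  finally show ?thesis unfolding line_deriv_3 .
qed

text \<open>The point is that the \<open>SUP\<close> in \<open>eps4\<close> runs over a bounded set:
  the region is a compact ellipsoid inside \<Theta>, the fourth partial derivatives are continuous
  there, and \<open>tensor_inner_bound\<close> is uniform in the tensor.\<close>

lemma eps4_upper:
  assumes x: "x \<in> local_region d n v xhat s"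
  shows "d * sqrt (tensor_norm d 4 Hm (deriv_tensor V x)) \<le> e4"
proof -
  obtain C where C0: "C \<ge> 0" and C: "\<And>k T u. u \<in> carrier_vec d \<Longrightarrow> wnorm Hm u = 1 \<Longrightarrow>
    \<bar>tensor_inner d k T (tensor_power u)\<bar> \<le> C ^ k * (\<Sum>is\<in>indices d k. \<bar>T is\<bar>)"
    by (rule tensor_inner_bound[OF d1 Hm_pos]) blast
  have s': "s \<ge> 0" using s_bounds by linarith
  have comp: "compactin (powertop_real {..<d}) (local_region d n v xhat s)"
    unfolding local_region_eq[OF s'] by (rule compactin_ellipsoid)
  have "\<exists>B. \<forall>x\<in>local_region d n v xhat s. \<bar>partial_derivs is V x\<bar> \<le> B" if "is \<in> indices d 4" for "is"
  proof -
    have "continuous_map (subtopology (powertop_real {..<d}) \<Theta>) euclideanreal (partial_derivs is V)"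
      using C4 that unfolding C_k_on_def by blast
    then show ?thesis by (rule compactin_bounded[OF comp region])
  qed
  then have "\<forall>is\<in>indices d 4. \<exists>B. \<forall>x\<in>local_region d n v xhat s. \<bar>partial_derivs is V x\<bar> \<le> B" by blast
  from bchoice[OF this] obtain B where B: "\<forall>is\<in>indices d 4. \<forall>x\<in>local_region d n v xhat s. \<bar>partial_derivs is V x\<bar> \<le> B is"
    by (rule exE)
  have "bdd_above ((\<lambda>x. sqrt (tensor_norm d 4 Hm (deriv_tensor V x))) ` local_region d n v xhat s)"
  proof (rule bdd_aboveI2)
    fix x assume x: "x \<in> local_region d n v xhat s"
    have "tensor_norm d 4 Hm (deriv_tensor V x) \<le> C ^ 4 * (\<Sum>is\<in>indices d 4. B is)"
      unfolding tensor_norm_def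
    proof (rule cSUP_least[OF unit_sphere_nonempty[OF d1 Hm_pos]])
      fix u assume u: "u \<in> {u \<in> carrier_vec d. wnorm Hm u = 1}"
      then have "\<bar>tensor_inner d 4 (deriv_tensor V x) (tensor_power u)\<bar> \<le> C ^ 4 * (\<Sum>is\<in>indices d 4. \<bar>deriv_tensor V x is\<bar>)"
        by (intro C) auto
      also have "\<dots> \<le> C ^ 4 * (\<Sum>is\<in>indices d 4. B is)"
        using B x C0 by (intro mult_left_mono sum_mono) (auto simp: deriv_tensor_def)
      finally show "\<bar>tensor_inner d 4 (deriv_tensor V x) (tensor_power u)\<bar> \<le> C ^ 4 * (\<Sum>is\<in>indices d 4. B is)" .
    qed
    then show "sqrt (tensor_norm d 4 Hm (deriv_tensor V x)) \<le> sqrt (C ^ 4 * (\<Sum>is\<in>indices d 4. B is))" by simp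
  qed
  from cSUP_upper[OF x this] have "sqrt (tensor_norm d 4 Hm (deriv_tensor V x))
      \<le> (SUP x\<in>local_region d n v xhat s. sqrt (tensor_norm d 4 Hm (deriv_tensor V x)))" .
  then show ?thesis unfolding eps4_def Let_def V_def[symmetric] Hm_def[symmetric] by (intro mult_left_mono) auto
qed

lemma xhat_region: "xhat \<in> local_region d n v xhat s"
  using line_in_region[of "\<lambda>_. 0" 0] by (simp add: line_0 qball_def bilf_def)

lemma e4_nonneg: "0 \<le> e4"
proof -
  have "0 \<le> d * sqrt (tensor_norm d 4 Hm (deriv_tensor V xhat))" using tensor_norm_nonneg[OF d1 Hm_pos] by simp
  also have "\<dots> \<le> e4" by (rule eps4_upper[OF xhat_region])
  finally show ?thesis .
qed

text \<open>
  The cutoff makes the bound on \<open>r4\<close> global; \<open>V\<close> is not controlled outside \<open>\<Theta>\<close>.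
\<close>

definition r4 where "r4 y = indicator (qball s) y * (V (sh y) - V xhat - q y / 2 - cubic d cc y)"

lemma r4_bound: "\<bar>r4 y\<bar> \<le> e4\<^sup>2 * (q y / d)\<^sup>2 / 24"
proof (cases "y \<in> qball s")
  case True
  have seg: "line d xhat y t \<in> \<Theta>" if "0 \<le> t" "t \<le> 1" for t
    using line_in_region[OF True that] region by blast
  obtain \<theta> where \<theta>: "0 < \<theta>" "\<theta> < 1"
    "V (line d xhat y 1) = V (line d xhat y 0) + line_deriv d 1 V y (line d xhat y 0) + line_deriv d 2 V y (line d xhat y 0) / 2
       + line_deriv d 3 V y (line d xhat y 0) / 6 + line_deriv d 4 V y (line d xhat y \<theta>) / 24"
    by (rule line_taylor[OF \<Theta> C4 seg])
  define x where "x = line d xhat y \<theta>"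
  have x: "x \<in> local_region d n v xhat s" unfolding x_def by (rule line_in_region[OF True]) (use \<theta> in auto)
  have "r4 y = line_deriv d 4 V y x / 24"
    using \<theta>(3) True unfolding line_0 gradient_zero line_deriv_2 line_deriv_3 x_def[symmetric]
    by (simp add: r4_def sh_line)
  moreover have "\<bar>line_deriv d 4 V y x\<bar> \<le> e4\<^sup>2 * (q y / d)\<^sup>2"
  proof -
    define T where "T = tensor_norm d 4 Hm (deriv_tensor V x)"
    have T0: "T \<ge> 0" unfolding T_def by (rule tensor_norm_nonneg[OF d1 Hm_pos])
    have "\<bar>line_deriv d 4 V y x\<bar> \<le> T * sqrt (q y) ^ 4"
      unfolding line_deriv_tensor wnorm_vec[symmetric] T_def by (rule tensor_inner_le[OF d1 Hm_pos]) simp_all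
    also have "sqrt (q y) ^ 4 = (q y)\<^sup>2" by (simp add: power4_eq_xxxx power2_eq_square)
    \<comment> \<open>Distributes d^2 so that the first factor is the quantity in
      \<open>eps4\<close> and the second matches the remainder bound of
      \<open>laplace_expansion\<close>.\<close>
    also have "T * (q y)\<^sup>2 = (d * sqrt T)\<^sup>2 * (q y / d)\<^sup>2" using T0 d1 by (simp add: power_mult_distrib power_divide)
    also have "\<dots> \<le> e4\<^sup>2 * (q y / d)\<^sup>2"
      using eps4_upper[OF x, folded T_def] T0 by (intro mult_right_mono power_mono) auto
    finally show ?thesis .
  qed
  ultimately show ?thesis by simp
qed (simp add: r4_def)

lemma sh_meas [measurable]: "sh \<in> lborel_dim d \<rightarrow>\<^sub>M lborel_dim d"
  unfolding sh_def by (rule measurable_affine_point)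

lemma V_meas: "(\<lambda>x. indicator \<Theta> x * V x) \<in> borel_measurable (lborel_dim d)"
proof (rule continuous_map_measurable[OF \<Theta>])
  have "[] \<in> indices d 0" by (simp add: indices_0)
  then have "continuous_map (subtopology (powertop_real {..<d}) \<Theta>) euclideanreal (partial_derivs [] V)"
    using C4 unfolding C_k_on_def by blast
  then show "continuous_map (subtopology (powertop_real {..<d}) \<Theta>) euclideanreal V" by simp
qed

lemma \<Theta>_meas: "(\<lambda>x. indicator \<Theta> x :: real) \<in> borel_measurable (lborel_dim d)"
  by (rule borel_measurable_indicator[OF openin_measurable[OF \<Theta>]])

lemma V_sh_meas [measurable]: "(\<lambda>y. indicator \<Theta> (sh y) * V (sh y)) \<in> borel_measurable (lborel_dim d)"
  by (rule measurable_compose[OF sh_meas V_meas])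

lemma \<Theta>_sh_meas [measurable]: "(\<lambda>y. indicator \<Theta> (sh y) :: real) \<in> borel_measurable (lborel_dim d)"
  by (rule measurable_compose[OF sh_meas \<Theta>_meas])

lemma sh_in_\<Theta>: "y \<in> qball s \<Longrightarrow> sh y \<in> \<Theta>"
  using sh_region[of s y] region s_bounds by auto

lemma r4_meas: "r4 \<in> borel_measurable (lborel_dim d)"
proof -
  have "r4 = (\<lambda>y. indicator (qball s) y * (indicator \<Theta> (sh y) * V (sh y) - V xhat - q y / 2 - cubic d cc y))"
    by (rule ext) (auto simp: r4_def indicator_def sh_in_\<Theta>)
  moreover have "(\<lambda>y. indicator (qball s) y * (indicator \<Theta> (sh y) * V (sh y) - V xhat - q y / 2 - cubic d cc y))
      \<in> borel_measurable (lborel_dim d)" by measurable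
  ultimately show ?thesis by simp
qed

lemma N_bound: "sqrt (e3\<^sup>2 + e4\<^sup>2) \<le> 2 * M"
proof (rule real_le_lsqrt)
  have M: "0 \<le> M" using e3_nonneg eps3_le by linarith
  then show "0 \<le> 2 * M" by simp
  have "e3\<^sup>2 \<le> M\<^sup>2" "e4\<^sup>2 \<le> M\<^sup>2" using e3_nonneg eps3_le e4_nonneg eps4_le by (intro power_mono, auto)+
  then show "e3\<^sup>2 + e4\<^sup>2 \<le> (2 * M)\<^sup>2"   proof -
    have "(2 * M)\<^sup>2 = 4 * M\<^sup>2" by simp
    then show ?thesis using \<open>e3\<^sup>2 \<le> M\<^sup>2\<close> \<open>e4\<^sup>2 \<le> M\<^sup>2\<close> zero_le_power2[of M] by linarith
  qed
qed

sublocale laplace_expansion d A cc r4 e3 e4 s "2 * M"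
  by unfold_locales (rule e3_nonneg cubic_bound e4_nonneg r4_bound r4_meas s_bounds N_bound)+

text \<open>The target density in the centred coordinate, scaled to the value 1 at the mode; the
  factor exp (V xhat) cancels in \<open>EE\<close>.\<close>

definition p where "p y = indicator \<Theta> (sh y) * exp (- (V (sh y) - V xhat))"

lemma p_meas: "p \<in> borel_measurable (lborel_dim d)"
proof -
  have "p = (\<lambda>y. indicator \<Theta> (sh y) * exp (- (indicator \<Theta> (sh y) * V (sh y) - V xhat)))"
    by (rule ext) (simp add: p_def indicator_def)
  moreover have "(\<lambda>y. indicator \<Theta> (sh y) * exp (- (indicator \<Theta> (sh y) * V (sh y) - V xhat))) \<in> borel_measurable (lborel_dim d)"
    by measurable
  ultimately show ?thesis by simp
qed

lemma p_in: "p y = exp (- q y / 2 - r y)" if "y \<in> space (lborel_dim d)" "y \<in> qball s"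
proof -
  have "r y = V (sh y) - V xhat - q y / 2" using that by (simp add: r_def r4_def)
  then show ?thesis using sh_in_\<Theta>[OF that(2)] by (simp add: p_def)
qed

text \<open>As s >= s0, the growth condition is available; the powers of \<open>n\<close> cancel in
  n * sqrt (d / n) * sqrt (q y / n) = sqrt d * sqrt (q y).\<close>

lemma p_out: "0 \<le> p y \<and> p y \<le> exp (- c0 * sqrt d * sqrt (q y))"
  if "y \<in> space (lborel_dim d)" and y: "y \<notin> qball s"
proof (cases "sh y \<in> \<Theta>")
  case True
  have "q y > s\<^sup>2 * d" using y by (simp add: qball_def)
  moreover have "s0\<^sup>2 * d \<le> s\<^sup>2 * d" using s_bounds(1) s0 by (intro mult_right_mono power_mono) auto
  ultimately have "y \<notin> qball s0" by (simp add: qball_def)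
  then have "sh y \<notin> local_region d n v xhat s0" using sh_region[of s0 y] s0 by simp
  then have "v (sh y) - v xhat \<ge> c0 * sqrt (d / n) * sqrt (q (\<lambda>i. sh y i - xhat i) / n)" by (rule growth[OF True])
  also have "q (\<lambda>i. sh y i - xhat i) = q y" using q_line[of y 1] by (simp add: sh_line)
  finally have "n * (c0 * sqrt (d / n) * sqrt (q y / n)) \<le> n * (v (sh y) - v xhat)" using n0 by (intro mult_left_mono) auto
  also have "n * (c0 * sqrt (d / n) * sqrt (q y / n)) = c0 * sqrt d * sqrt (q y) * (n / (sqrt n * sqrt n))"
    by (simp add: real_sqrt_divide)
  also have "n / (sqrt n * sqrt n) = 1" using n0 by simp
  finally have "c0 * sqrt d * sqrt (q y) \<le> V (sh y) - V xhat" by (simp add: V_def right_diff_distrib)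
  then show ?thesis using True by (simp add: p_def)
qed (simp add: p_def)

lemmas p_split = split_integral[OF p_meas p_in p_out a0 c0(3) c0(2) s_bounds(2)]
lemmas p_variance = laplace_variance[OF p_meas p_in p_out a0 c0(3) c0(2) s_bounds(2)]

section \<open>Expectations under the target and its covariance\<close>

definition D where "D = (\<integral>y. p y \<partial>lborel_dim d)"
definition EE where "EE f = (\<integral>y. f y * p y \<partial>lborel_dim d) / D"

lemma target_integral:
  assumes D: "D > 0" and F: "F \<in> borel_measurable (lborel_dim d)"
  shows "(\<integral>x. F x \<partial>target d \<Theta> V) = EE (\<lambda>y. F (sh y))"
proof -
  define w where "w x = indicator \<Theta> x * exp (- V x)" for x
  have w_meas [measurable]: "w \<in> borel_measurable (lborel_dim d)"
  proof -
    note [measurable] = V_meas \<Theta>_meas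
    have "w = (\<lambda>x. indicator \<Theta> x * exp (- (indicator \<Theta> x * V x)))" by (rule ext) (simp add: w_def indicator_def)
    moreover have "(\<lambda>x. indicator \<Theta> x * exp (- (indicator \<Theta> x * V x))) \<in> borel_measurable (lborel_dim d)" by measurable
    ultimately show ?thesis by simp
  qed
  have wp: "w (sh y) = exp (- V xhat) * p y" for y
    by (simp add: w_def p_def exp_add[symmetric] indicator_def)
  have shift: "(\<integral>x. f x \<partial>lborel_dim d) = (\<integral>y. f (sh y) \<partial>lborel_dim d)"
    if "f \<in> borel_measurable (lborel_dim d)" for f :: "point \<Rightarrow> real"
    unfolding sh_def using integral_affine_point[of 1 f d xhat] that by simp
  have Zt: "(\<integral>x. w x \<partial>lborel_dim d) = exp (- V xhat) * D"
    unfolding shift[OF w_meas] wp D_def by simp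
  have w0: "0 \<le> w x" for x by (simp add: w_def)
  have "(\<integral>x. F x \<partial>target d \<Theta> V) = (\<integral>x. w x / (\<integral>x. w x \<partial>lborel_dim d) * F x \<partial>lborel_dim d)"
    unfolding target_def w_def[symmetric]
    by (subst integral_density) (use F w0 in \<open>auto intro!: divide_nonneg_nonneg\<close>)
  also have "\<dots> = (\<integral>y. w (sh y) / (exp (- V xhat) * D) * F (sh y) \<partial>lborel_dim d)"
    unfolding Zt by (rule shift) (use F in measurable)
  also have "\<dots> = (\<integral>y. (F (sh y) * p y) / D \<partial>lborel_dim d)"
    unfolding wp by (simp add: mult_ac)
  finally show ?thesis by (simp add: EE_def)
qed

context
  fixes u :: "real vec"
  assumes u: "u \<in> carrier_vec d" and wu: "wnorm (mat_inv Hm) u = 1"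
begin

text \<open>The representer of y -> u . y with respect to the Hessian form. Its \<open>q\<close> is
  the squared norm of \<open>u\<close> for the inverse Hessian, which is 1.\<close>

definition h where "h = (\<lambda>i. (mat_inv Hm *\<^sub>v u) $ i)"

lemma bil_h: "bil h y = (\<Sum>i<d. u $ i * y i)"
proof -
  note K = pos_def_inverse[OF Hm_pos]
  define w where "w = mat_inv Hm *\<^sub>v u"
  have wc: "w \<in> carrier_vec d" unfolding w_def by (rule mult_mat_vec_carrier[OF K(1) u])
  have "Hm *\<^sub>v w = (Hm * mat_inv Hm) *\<^sub>v u"
    unfolding w_def by (rule assoc_mult_mat_vec[OF Hm_carrier K(1) u, symmetric])
  also have "\<dots> = u" unfolding K(2) using u by simp
  finally have Hw: "Hm *\<^sub>v w = u" .
  have "bil h y = bil (\<lambda>i. vec d y $ i) (\<lambda>i. w $ i)"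
    unfolding h_def w_def[symmetric] by (subst bil_sym, rule bilf_cong) simp_all
  also have "\<dots> = vec d y \<bullet> (Hm *\<^sub>v w)" unfolding A_def by (rule quad_vec[symmetric]) (use Hm_carrier wc in auto)
  also have "\<dots> = (\<Sum>i<d. vec d y $ i * u $ i)" unfolding Hw by (rule scalar_prod_sum[OF u])
  also have "\<dots> = (\<Sum>i<d. u $ i * y i)" by (rule sum.cong) (simp_all add: mult.commute)
  finally show ?thesis .
qed

lemma u_inv_u: "u \<bullet> (mat_inv Hm *\<^sub>v u) = 1"
  using wu by (simp add: wnorm_def)

lemma q_h: "q h = 1"
proof -
  have "mat_inv Hm *\<^sub>v u \<in> carrier_vec d" by (rule mult_mat_vec_carrier[OF pos_def_inverse(1)[OF Hm_pos] u])
  then have "u \<bullet> (mat_inv Hm *\<^sub>v u) = (\<Sum>i<d. u $ i * h i)" unfolding h_def by (rule scalar_prod_sum)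
  then show ?thesis using u_inv_u by (simp add: bil_h)
qed

lemma D_pos: "D > 0"
  by (rule p_variance(1)[OF _ _ _ _ q_h D_def])

lemma integrable_p:
  assumes f: "f \<in> borel_measurable (lborel_dim d)" and C: "C > 0" and le: "\<And>y. \<bar>f y\<bar> \<le> C * (1 + q y)"
  shows "integrable (lborel_dim d) (\<lambda>y. f y * p y)"
proof -
  have "integrable (lborel_dim d) (\<lambda>y. (f y / C) * p y)"
  proof (rule p_split(1)[OF _ _ _ _ _ _ q_h])
    show "(\<lambda>y. f y / C) \<in> borel_measurable (lborel_dim d)" using f by simp
    show "\<bar>f y / C\<bar> \<le> 1 + q y" for y using le[of y] C by (simp add: abs_divide divide_le_eq mult.commute)
  qed simp_all
  then have "integrable (lborel_dim d) (\<lambda>y. C * ((f y / C) * p y))" by (rule integrable_mult_right)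
  then show ?thesis using C by simp
qed

lemma integrable_moments:
  shows "integrable (lborel_dim d) p"
    and "i < d \<Longrightarrow> integrable (lborel_dim d) (\<lambda>y. y i * p y)"
    and "i < d \<Longrightarrow> j < d \<Longrightarrow> integrable (lborel_dim d) (\<lambda>y. y i * y j * p y)"
proof -
  obtain C where C: "C > 0" "\<And>x i. i < d \<Longrightarrow> (x i)\<^sup>2 \<le> C * q x" by (rule coord_bound) blast
  have "integrable (lborel_dim d) (\<lambda>y. 1 * p y)" by (rule integrable_p[of _ 1]) auto
  then show "integrable (lborel_dim d) p" by simp
  show "integrable (lborel_dim d) (\<lambda>y. y i * p y)" if i: "i < d"
  proof (rule integrable_p[of _ "1 + C"])
    show "(\<lambda>y. y i) \<in> borel_measurable (lborel_dim d)" by (rule measurable_coord[OF i])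
    show "\<bar>y i\<bar> \<le> (1 + C) * (1 + q y)" for y
    proof -
      have "(1 + C) * (1 + q y) = 1 + C + q y + C * q y" by (simp add: algebra_simps)
      then show ?thesis using abs_le_one_plus_sq[of "y i"] C(2)[OF i, of y] C(1) q_nonneg[of y] by linarith
    qed
  qed (use C in simp)
  show "integrable (lborel_dim d) (\<lambda>y. y i * y j * p y)" if i: "i < d" and j: "j < d"
  proof (rule integrable_p[of _ C])
    show "(\<lambda>y. y i * y j) \<in> borel_measurable (lborel_dim d)"
      by (intro borel_measurable_times measurable_coord i j)
    show "\<bar>y i * y j\<bar> \<le> C * (1 + q y)" for y
    proof -
      have "2 * (\<bar>y i\<bar> * \<bar>y j\<bar>) \<le> (y i)\<^sup>2 + (y j)\<^sup>2" using sum_squares_bound[of "\<bar>y i\<bar>" "\<bar>y j\<bar>"] by simp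
      then have "\<bar>y i\<bar> * \<bar>y j\<bar> \<le> C * q y" using C(2)[OF i, of y] C(2)[OF j, of y] by linarith
      then show ?thesis using C(1) by (simp add: abs_mult distrib_left)
    qed
  qed (use C in simp)
qed

lemma mean_target: "i < d \<Longrightarrow> mean (target d \<Theta> V) i = EE (\<lambda>y. y i) + xhat i"
proof -
  assume i: "i < d"
  have "mean (target d \<Theta> V) i = EE (\<lambda>y. sh y i)"
    unfolding mean_def by (rule target_integral[OF D_pos measurable_coord[OF i]])
  also have "\<dots> = (\<integral>y. y i * p y + xhat i * p y \<partial>lborel_dim d) / D"
    unfolding EE_def using i by (simp add: sh_def distrib_right)
  also have "\<dots> = ((\<integral>y. y i * p y \<partial>lborel_dim d) + xhat i * D) / D"
    using integrable_moments(1) integrable_moments(2)[OF i] by (simp add: D_def)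
  also have "\<dots> = EE (\<lambda>y. y i) + xhat i" using D_pos by (simp add: EE_def add_divide_distrib)
  finally show ?thesis .
qed

lemma covariance_target:
  assumes i: "i < d" and j: "j < d"
  shows "covariance d (target d \<Theta> V) $$ (i, j) = EE (\<lambda>y. y i * y j) - EE (\<lambda>y. y i) * EE (\<lambda>y. y j)"
proof -
  define \<mu> where "\<mu> i = EE (\<lambda>y. y i)" for i
  note I = integrable_moments(1) integrable_moments(2)[OF i] integrable_moments(2)[OF j] integrable_moments(3)[OF i j]
  have m: "(\<lambda>x. (x i - mean (target d \<Theta> V) i) * (x j - mean (target d \<Theta> V) j)) \<in> borel_measurable (lborel_dim d)"
    by (intro borel_measurable_times borel_measurable_diff measurable_coord i j) auto
  have "covariance d (target d \<Theta> V) $$ (i, j)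
      = (\<integral>x. (x i - mean (target d \<Theta> V) i) * (x j - mean (target d \<Theta> V) j) \<partial>target d \<Theta> V)"
    using i j by (simp add: covariance_def)
  also have "\<dots> = EE (\<lambda>y. (sh y i - mean (target d \<Theta> V) i) * (sh y j - mean (target d \<Theta> V) j))"
    by (rule target_integral[OF D_pos m])
  also have "\<dots> = EE (\<lambda>y. (y i - \<mu> i) * (y j - \<mu> j))"
    unfolding mean_target[OF i] mean_target[OF j] using i j by (simp add: sh_def \<mu>_def)
  also have "\<dots> = (\<integral>y. y i * y j * p y - \<mu> j * (y i * p y) - \<mu> i * (y j * p y) + \<mu> i * \<mu> j * p y \<partial>lborel_dim d) / D"
    unfolding EE_def by (simp add: algebra_simps)
  also have "\<dots> = ((\<integral>y. y i * y j * p y \<partial>lborel_dim d) - \<mu> j * (\<integral>y. y i * p y \<partial>lborel_dim d)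
      - \<mu> i * (\<integral>y. y j * p y \<partial>lborel_dim d) + \<mu> i * \<mu> j * D) / D"
    using I by (simp add: D_def)
  also have "\<dots> = EE (\<lambda>y. y i * y j) - \<mu> j * \<mu> i - \<mu> i * \<mu> j + \<mu> i * \<mu> j"
    using D_pos by (simp add: EE_def \<mu>_def add_divide_distrib diff_divide_distrib)
  finally show ?thesis by (simp add: \<mu>_def mult.commute)
qed

lemma covariance_form:
  "u \<bullet> (covariance d (target d \<Theta> V) *\<^sub>v u) = EE (\<lambda>y. (bil h y)\<^sup>2) - (EE (\<lambda>y. bil h y))\<^sup>2"
proof -
  have c: "covariance d (target d \<Theta> V) \<in> carrier_mat d d" by (simp add: covariance_def)
  have 1: "EE (\<lambda>y. bil h y) = (\<Sum>i<d. u $ i * EE (\<lambda>y. y i))"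
  proof -
    have "(\<integral>y. bil h y * p y \<partial>lborel_dim d) = (\<integral>y. (\<Sum>i<d. u $ i * (y i * p y)) \<partial>lborel_dim d)"
      unfolding bil_h by (simp add: sum_distrib_right mult.assoc)
    also have "\<dots> = (\<Sum>i<d. \<integral>y. u $ i * (y i * p y) \<partial>lborel_dim d)"
      by (rule Bochner_Integration.integral_sum) (use integrable_moments(2) in auto)
    also have "\<dots> = (\<Sum>i<d. u $ i * (\<integral>y. y i * p y \<partial>lborel_dim d))" by simp
    finally show ?thesis unfolding EE_def by (simp add: sum_divide_distrib)
  qed
  have 2: "EE (\<lambda>y. (bil h y)\<^sup>2) = (\<Sum>i<d. \<Sum>j<d. u $ i * u $ j * EE (\<lambda>y. y i * y j))"
  proof -
    have sq: "(bil h y)\<^sup>2 * p y = (\<Sum>i<d. \<Sum>j<d. u $ i * u $ j * (y i * y j * p y))" for y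
    proof -
      have "(bil h y)\<^sup>2 * p y = (\<Sum>i<d. \<Sum>j<d. (u $ i * y i) * (u $ j * y j) * p y)"
        unfolding bil_h power2_eq_square sum_product by (simp only: sum_distrib_right)
      also have "\<dots> = (\<Sum>i<d. \<Sum>j<d. u $ i * u $ j * (y i * y j * p y))" by (simp only: mult_ac)
      finally show ?thesis .
    qed
    have "(\<integral>y. (bil h y)\<^sup>2 * p y \<partial>lborel_dim d) = (\<Sum>i<d. \<integral>y. (\<Sum>j<d. u $ i * u $ j * (y i * y j * p y)) \<partial>lborel_dim d)"
      unfolding sq
      by (rule Bochner_Integration.integral_sum)
         (intro Bochner_Integration.integrable_sum integrable_mult_right integrable_moments(3), auto)
    also have "\<dots> = (\<Sum>i<d. \<Sum>j<d. \<integral>y. u $ i * u $ j * (y i * y j * p y) \<partial>lborel_dim d)"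
      by (intro sum.cong refl Bochner_Integration.integral_sum integrable_mult_right integrable_moments(3)) auto
    also have "\<dots> = (\<Sum>i<d. \<Sum>j<d. u $ i * u $ j * (\<integral>y. y i * y j * p y \<partial>lborel_dim d))" by simp
    finally show ?thesis unfolding EE_def by (simp add: sum_divide_distrib)
  qed
  have "u \<bullet> (covariance d (target d \<Theta> V) *\<^sub>v u)
      = (\<Sum>i<d. \<Sum>j<d. (EE (\<lambda>y. y i * y j) - EE (\<lambda>y. y i) * EE (\<lambda>y. y j)) * u $ i * u $ j)"
    unfolding quad_vec[OF c u u] bilf_def by (intro sum.cong refl) (simp add: covariance_target)
  also have "\<dots> = (\<Sum>i<d. \<Sum>j<d. u $ i * u $ j * EE (\<lambda>y. y i * y j)) - (\<Sum>i<d. \<Sum>j<d. (u $ i * EE (\<lambda>y. y i)) * (u $ j * EE (\<lambda>y. y j)))"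
    unfolding sum_subtractf[symmetric] by (intro sum.cong refl) (simp add: algebra_simps)
  also have "(\<Sum>i<d. \<Sum>j<d. (u $ i * EE (\<lambda>y. y i)) * (u $ j * EE (\<lambda>y. y j))) = (EE (\<lambda>y. bil h y))\<^sup>2"
    unfolding 1 power2_eq_square sum_product ..
  finally show ?thesis by (simp only: 2)
qed

lemma covariance_error:
  "\<bar>u \<bullet> ((covariance d (target d \<Theta> V) - mat_inv Hm) *\<^sub>v u)\<bar>
    \<le> laplace_const (2 * M) a * ((E_factor d n v xhat s)\<^sup>2 * (e3\<^sup>2 + e4\<^sup>2) + tau d c0 s)"
proof -
  have c: "covariance d (target d \<Theta> V) \<in> carrier_mat d d" by (simp add: covariance_def)
  note K = pos_def_inverse(1)[OF Hm_pos]
  have "(covariance d (target d \<Theta> V) - mat_inv Hm) *\<^sub>v u = covariance d (target d \<Theta> V) *\<^sub>v u - mat_inv Hm *\<^sub>v u"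
    by (rule minus_mult_distrib_mat_vec[OF c K u])
  then have "u \<bullet> ((covariance d (target d \<Theta> V) - mat_inv Hm) *\<^sub>v u)
     = u \<bullet> (covariance d (target d \<Theta> V) *\<^sub>v u) - u \<bullet> (mat_inv Hm *\<^sub>v u)"
    using scalar_prod_minus_distrib[OF u mult_mat_vec_carrier[OF c u] mult_mat_vec_carrier[OF K u]] by (simp only:)
  then have "\<bar>u \<bullet> ((covariance d (target d \<Theta> V) - mat_inv Hm) *\<^sub>v u)\<bar>
      = \<bar>EE (\<lambda>y. (bil h y)\<^sup>2) - (EE (\<lambda>y. bil h y))\<^sup>2 - 1\<bar>"
    unfolding covariance_form u_inv_u by (simp only:)
  also have "\<dots> \<le> laplace_const (2 * M) a * ((exp (\<epsilon>\<^sup>2 * s ^ 4))\<^sup>2 * \<epsilon>\<^sup>2 + exp (- c0 * s * d / 8))"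
    unfolding EE_def by (rule p_variance(2)[OF _ _ _ _ q_h D_def])
  also have "\<dots> \<le> laplace_const (2 * M) a * ((E_factor d n v xhat s)\<^sup>2 * (e3\<^sup>2 + e4\<^sup>2) + tau d c0 s)"
  proof (rule mult_left_mono)
    \<comment> \<open>\<open>tau\<close> has the additional factor \<open>d\<close>, which is at
      least 1.\<close>
    have "1 * exp (- c0 * s * d / 8) \<le> d * exp (- c0 * s * d / 8)" using d1 by (intro mult_right_mono) auto
    then have "exp (- c0 * s * d / 8) \<le> tau d c0 s" by (simp add: tau_def)
    then show "(exp (\<epsilon>\<^sup>2 * s ^ 4))\<^sup>2 * \<epsilon>\<^sup>2 + exp (- c0 * s * d / 8) \<le> (E_factor d n v xhat s)\<^sup>2 * (e3\<^sup>2 + e4\<^sup>2) + tau d c0 s"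
      unfolding E_factor_def eps(5) by simp
    show "0 \<le> laplace_const (2 * M) a" using laplace_const_pos[OF a0] less_imp_le by blast
  qed
  finally show ?thesis .
qed

end

lemma covariance_sym: "i < d \<Longrightarrow> j < d \<Longrightarrow> covariance d (target d \<Theta> V) $$ (i, j) = covariance d (target d \<Theta> V) $$ (j, i)"
  by (simp add: covariance_def mult.commute)

lemma diff_sym: "transpose_mat (covariance d (target d \<Theta> V) - mat_inv Hm) = covariance d (target d \<Theta> V) - mat_inv Hm"
proof -
  note K = pos_def_inverse[OF Hm_pos]
  have Ht: "transpose_mat Hm = Hm" using Hm_pos by (simp add: pos_def_def)
  have KT: "transpose_mat (mat_inv Hm) = mat_inv Hm"
  proof -
    have Kc: "transpose_mat (mat_inv Hm) \<in> carrier_mat d d" using K(1) by simp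
    have "transpose_mat (mat_inv Hm) * Hm = transpose_mat (Hm * mat_inv Hm)"
      using transpose_mult[OF Hm_carrier K(1)] unfolding Ht by (rule sym)
    then have TH: "transpose_mat (mat_inv Hm) * Hm = 1\<^sub>m d" unfolding K(2) by simp
    have "transpose_mat (mat_inv Hm) = transpose_mat (mat_inv Hm) * (Hm * mat_inv Hm)"
      unfolding K(2) by (rule right_mult_one_mat[OF Kc, symmetric])
    also have "\<dots> = (transpose_mat (mat_inv Hm) * Hm) * mat_inv Hm"
      by (rule assoc_mult_mat[OF Kc Hm_carrier K(1), symmetric])
    also have "\<dots> = mat_inv Hm" unfolding TH by (rule left_mult_one_mat[OF K(1)])
    finally show ?thesis .
  qed
  have Ksym: "mat_inv Hm $$ (i, j) = mat_inv Hm $$ (j, i)" if "i < d" "j < d" for i j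
  proof -
    have "mat_inv Hm $$ (i, j) = transpose_mat (mat_inv Hm) $$ (i, j)" by (simp only: KT)
    also have "\<dots> = mat_inv Hm $$ (j, i)" using K(1) that by simp
    finally show ?thesis .
  qed
  have c: "covariance d (target d \<Theta> V) \<in> carrier_mat d d" by (simp add: covariance_def)
  show ?thesis
    by (rule eq_matI) (use c K(1) covariance_sym Ksym in auto)
qed

lemma covariance_bound:
  "mat_wnorm d (mat_inv Hm) (covariance d (target d \<Theta> V) - mat_inv Hm)
     = op_norm d (mat_sqrt d Hm * (covariance d (target d \<Theta> V) - mat_inv Hm) * mat_sqrt d Hm)" (is ?eq)
  "mat_wnorm d (mat_inv Hm) (covariance d (target d \<Theta> V) - mat_inv Hm)
     \<le> laplace_const (2 * M) a * ((E_factor d n v xhat s)\<^sup>2 * (e3\<^sup>2 + e4\<^sup>2) + tau d c0 s)" (is ?le)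
proof -
  have c: "covariance d (target d \<Theta> V) - mat_inv Hm \<in> carrier_mat d d"
    by (rule minus_carrier_mat[OF pos_def_inverse(1)[OF Hm_pos]])
  show ?eq by (rule mat_wnorm_eq_op_norm[OF d1 Hm_pos c diff_sym])
  have ne: "{u \<in> carrier_vec d. wnorm (mat_inv Hm) u = 1} \<noteq> {}"
  proof -
    have "unit_vec d 0 \<in> {w \<in> carrier_vec d. w \<bullet> w = (1::real)}" using d1 by simp
    then show ?thesis unfolding wnorm_inv_sphere[OF d1 Hm_pos] by blast
  qed
  show ?le
    unfolding mat_wnorm_def tensor_norm_def
  proof (rule cSUP_least[OF ne])
    fix u assume "u \<in> {u \<in> carrier_vec d. wnorm (mat_inv Hm) u = 1}"
    then have u: "u \<in> carrier_vec d" "wnorm (mat_inv Hm) u = 1" by auto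
    show "\<bar>tensor_inner d 2 (mat_tensor (covariance d (target d \<Theta> V) - mat_inv Hm)) (tensor_power u)\<bar>
      \<le> laplace_const (2 * M) a * ((E_factor d n v xhat s)\<^sup>2 * (e3\<^sup>2 + e4\<^sup>2) + tau d c0 s)"
      unfolding tensor_inner_mat[OF c u(1)] by (rule covariance_error[OF u])
  qed
qed

end

theorem corollary2p25:
  shows "\<forall>(a::real) > 0. \<forall>M::real. \<exists>K::real. K > 0 \<and>
    (\<forall>(d::nat) (n::real) (\<Theta>::(nat \<Rightarrow> real) set) (v::(nat \<Rightarrow> real) \<Rightarrow> real)
      (xhat::nat \<Rightarrow> real) (s0::real) (c0::real) (s::real).
      d \<ge> 1 \<and> n > 0 \<and> openin (powertop_real {..<d}) \<Theta> \<and>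
      assumption_A1 d \<Theta> v xhat \<and>
      assumption_A2 a d n \<Theta> v xhat s0 c0 \<and>
      s \<ge> s_star s0 c0 \<and>
      local_region d n v xhat s \<subseteq> \<Theta> \<and>
      eps3 d n v xhat \<le> M \<and> eps4 d n v xhat s \<le> M \<longrightarrow>
      (let V = (\<lambda>x. n * v x);
           H = hessian d V xhat;
           \<Sigma> = covariance d (target d \<Theta> V);
           R = mat_sqrt d H
       in mat_wnorm d (mat_inv H) (\<Sigma> - mat_inv H) = op_norm d (R * (\<Sigma> - mat_inv H) * R) \<and>
          mat_wnorm d (mat_inv H) (\<Sigma> - mat_inv H)
            \<le> K * ((E_factor d n v xhat s)\<^sup>2 * ((eps3 d n v xhat)\<^sup>2 + (eps4 d n v xhat s)\<^sup>2)
                    + tau d c0 s)))"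
proof (intro allI impI)
  fix a M :: real assume a: "a > 0"
  show "\<exists>K::real. K > 0 \<and>
    (\<forall>(d::nat) (n::real) (\<Theta>::(nat \<Rightarrow> real) set) (v::(nat \<Rightarrow> real) \<Rightarrow> real)
      (xhat::nat \<Rightarrow> real) (s0::real) (c0::real) (s::real).
      d \<ge> 1 \<and> n > 0 \<and> openin (powertop_real {..<d}) \<Theta> \<and>
      assumption_A1 d \<Theta> v xhat \<and>
      assumption_A2 a d n \<Theta> v xhat s0 c0 \<and>
      s \<ge> s_star s0 c0 \<and>
      local_region d n v xhat s \<subseteq> \<Theta> \<and>
      eps3 d n v xhat \<le> M \<and> eps4 d n v xhat s \<le> M \<longrightarrow>
      (let V = (\<lambda>x. n * v x);
           H = hessian d V xhat;
           \<Sigma> = covariance d (target d \<Theta> V);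
           R = mat_sqrt d H
       in mat_wnorm d (mat_inv H) (\<Sigma> - mat_inv H) = op_norm d (R * (\<Sigma> - mat_inv H) * R) \<and>
          mat_wnorm d (mat_inv H) (\<Sigma> - mat_inv H)
            \<le> K * ((E_factor d n v xhat s)\<^sup>2 * ((eps3 d n v xhat)\<^sup>2 + (eps4 d n v xhat s)\<^sup>2)
                    + tau d c0 s)))"
  \<comment> \<open>By \<open>N_bound\<close>, N = 2 * M dominates sqrt (e3^2 + e4^2). The witness
    is chosen before \<open>d\<close> and positive for every real \<open>M\<close>.\<close>
  proof (intro exI[of _ "laplace_const (2 * M) a"] conjI allI impI laplace_const_pos a, elim conjE)
    fix d :: nat and n :: real and \<Theta> v xhat and s0 c0 s :: real
    assume *: "d \<ge> 1" "n > 0" "openin (powertop_real {..<d}) \<Theta>"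
      "assumption_A1 d \<Theta> v xhat" "assumption_A2 a d n \<Theta> v xhat s0 c0" "s \<ge> s_star s0 c0"
      "local_region d n v xhat s \<subseteq> \<Theta>" "eps3 d n v xhat \<le> M" "eps4 d n v xhat s \<le> M"
    interpret laplace_setup d n \<Theta> v xhat s0 c0 s a M
      by unfold_locales (rule * a)+
    show "let V = (\<lambda>x. n * v x);
           H = hessian d V xhat;
           \<Sigma> = covariance d (target d \<Theta> V);
           R = mat_sqrt d H
       in mat_wnorm d (mat_inv H) (\<Sigma> - mat_inv H) = op_norm d (R * (\<Sigma> - mat_inv H) * R) \<and>
          mat_wnorm d (mat_inv H) (\<Sigma> - mat_inv H)
            \<le> laplace_const (2 * M) a * ((E_factor d n v xhat s)\<^sup>2 * ((eps3 d n v xhat)\<^sup>2 + (eps4 d n v xhat s)\<^sup>2)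
                    + tau d c0 s)"
      using covariance_bound unfolding Let_def Hm_def V_def by blast
  qed
qed

end
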